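(* Let $1\le p\le q<s\le\infty$, $r\in(0,p)$ and $\frac1p-\frac1q\le\alpha<\frac1r-\frac1s$. Let $\omega,\sigma$ be two weights and let $\mathcal S\subset\mathscr D$ be a sparse family of cubes in a dyadic lattice $\mathscr D$ in $\mathbb R^n$. Let $\mathcal N$ be the best constant such that for any $f\in L^p(\omega)$ and $g\in L^{q'}(\sigma)$ $$\sum_{Q\in\mathcal S}\langle|f|\rangle_{r,Q}\langle|g|\rangle_{s',Q}|Q|^{1+\alpha}\le\mathcal N\|f\|_{L^p(\omega)}\|g\|_{L^{q'}(\sigma)} .$$ Put $u=\omega^{\frac r{r-p}}$ and $v=\sigma^{\frac{s'}{s'-q'}}$. If $\mathcal N<\infty$, then $(u,v)\in A^{\alpha-\frac1r+\frac1s}_{\frac1r-\frac1p,\ \frac1q-\frac1s}$, and in this case, writing $[u,v]:=[u,v]_{A^{\alpha-\frac1r+\frac1s}_{\frac1r-\frac1p,\,\frac1q-\frac1s}}$ (supremum over all cubes in $\mathbb R^n$), $$[u,v]\le\mathcal N\lesssim[u,v]\cdot\begin{cases}[u]_{A_\infty}^{1-\frac1{(p')^2}}[v]_{A_\infty}^{\frac1{(p')^2}}+[u]_{A_\infty}^{\frac1{p^2}}[v]_{A_\infty}^{1-\frac1{p^2}}&\text{if }p=q,\ \alpha>0,\\[4pt][u]_{A_\infty}^{\frac1q}+[v]_{A_\infty}^{\frac1{p'}}&\text{otherwise.}\end{cases}$$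
   Context: Cubes are half-open with sides parallel to the axes. For $r>0$, $\langle f\rangle_{r,Q}=\big(\frac1{|Q|}\int_Qf^r\big)^{1/r}$. Primes denote conjugate exponents, with the usual convention $1/\infty=0$. A weight is a non-negative locally integrable function; $w(Q)=\int_Qw$; $\|f\|_{L^p(w)}=(\int|f|^pw)^{1/p}$. $[w]_{A_\infty}=\sup_Q\frac1{w(Q)}\int_QM(w\chi_Q)$, where the supremum is over all cubes $Q\subset\mathbb R^n$ and $M$ is the Hardy–Littlewood maximal function. For $a,\beta,\gamma\in\mathbb R$, the class $A^a_{\beta,\gamma}$ consists of the pairs of weights $(u,v)$ with $$[u,v]_{A^a_{\beta,\gamma}}:=\sup_{Q}|Q|^a\,u(Q)^\beta\,v(Q)^\gamma<\infty,$$ the supremum being taken over all cubes $Q$ in $\mathbb R^n$. Dyadic lattice: for a cube $Q_0$, $\mathscr D(Q_0)$ is the set of cubes obtained by repeated subdivision of $Q_0$ and each of its descendants into $2^n$ congruent subcubes. A dyadic lattice $\mathscr D$ is a collection of cubes such that: (i) $Q\in\mathscr D$ implies $\mathscr D(Q)\subset\mathscr D$; (ii) for all $Q,Q'\in\mathscr D$ there is $R\in\mathscr D$ with $Q,Q'\in\mathscr D(R)$; (iii) every compact set is contained in some $Q\in\mathscr D$. A family $\mathcal S$ of cubes is sparse if for some $\eta\in(0,1)$ there are pairwise disjoint measurable sets $E_Q\subset Q$, $Q\in\mathcal S$, with $|E_Q|\ge\eta|Q|$. $A\lesssim B$ means $A\le CB$ for some $C>0$ which possibly depends on $n,r,p,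q,s$.
   Formalization: The lower bound and class membership are proved for the best constant uniform over all sparse families with a given sparseness η (they fail for one fixed family, e.g. the empty one); the implied constant may also depend on η and α. *)

theory Defs
  imports "HOL-Probability.Essential_Supremum"
begin

section \<open>Cubes, dyadic lattices and sparse families\<close>

definition cube :: "real ^ 'n \<Rightarrow> real \<Rightarrow> (real ^ 'n) set" where
  "cube a l = {x. \<forall>i. a $ i \<le> x $ i \<and> x $ i < a $ i + l}"

definition cubes :: "(real ^ 'n) set set" where
  "cubes = {cube a l |a l. l > 0}"

definition dyadic_children :: "(real ^ 'n) set \<Rightarrow> (real ^ 'n) set set" where
  "dyadic_children Q =
     {cube (a + (l / 2) *\<^sub>R e) (l / 2) |a l e. l > 0 \<and> Q = cube a l \<and> (\<forall>i. e $ i \<in> {0, 1})}"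

text \<open>The cube itself belongs to its own dyadic family (zero subdivisions).\<close>

inductive_set dyadic :: "(real ^ 'n) set \<Rightarrow> (real ^ 'n) set set" for Q where
  self: "Q \<in> dyadic Q"
| child: "P \<in> dyadic Q \<Longrightarrow> P' \<in> dyadic_children P \<Longrightarrow> P' \<in> dyadic Q"

definition dyadic_lattice :: "(real ^ 'n) set set \<Rightarrow> bool" where
  "dyadic_lattice D \<longleftrightarrow>
     D \<subseteq> cubes \<and>
     (\<forall>Q\<in>D. dyadic Q \<subseteq> D) \<and>
     (\<forall>Q\<in>D. \<forall>Q'\<in>D. \<exists>R\<in>D. Q \<in> dyadic R \<and> Q' \<in> dyadic R) \<and>
     (\<forall>K. compact K \<longrightarrow> (\<exists>Q\<in>D. K \<subseteq> Q))"

definition sparse_family :: "real \<Rightarrow> (real ^ 'n) set set \<Rightarrow> bool" where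
  "sparse_family \<eta> S \<longleftrightarrow>
     (\<exists>E. disjoint_family_on E S \<and>
        (\<forall>Q\<in>S. E Q \<subseteq> Q \<and> E Q \<in> sets lebesgue \<and>
               emeasure lebesgue (E Q) \<ge> ennreal \<eta> * emeasure lebesgue Q))"

definition sparse_families :: "real \<Rightarrow> (real ^ 'n) set set set" where
  "sparse_families \<eta> = {S. sparse_family \<eta> S \<and> (\<exists>D. dyadic_lattice D \<and> S \<subseteq> D)}"


section \<open>Exponents, weights and norms\<close>

text \<open>
  Real powers on \<open>[0, \<infinity>]\<close>: a negative power of \<open>0\<close> is \<open>\<infinity>\<close> (whereas \<open>powr\<close> would give \<open>0\<close>),
  and \<open>x\<^sup>0 = 1\<close> for every \<open>x\<close>.
\<close>

definition epow :: "ennreal \<Rightarrow> real \<Rightarrow> ennreal" where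
  "epow x a =
     (if a = 0 then 1
      else if x = 0 then (if a > 0 then 0 else \<infinity>)
      else if x = \<infinity> then (if a > 0 then \<infinity> else 0)
      else ennreal (enn2real x powr a))"

text \<open>In \<open>ereal\<close>, \<open>1 / 0 = \<infinity>\<close> and \<open>1 / \<infinity> = 0\<close>, so \<open>conj_exp 1 = \<infinity>\<close> and \<open>conj_exp \<infinity> = 1\<close>.\<close>

definition conj_exp :: "ereal \<Rightarrow> ereal" where
  "conj_exp p = 1 / (1 - 1 / p)"

text \<open>
  Weights take values in \<open>[0, \<infinity>]\<close>, because negative powers of weights are considered;
  local integrability makes them finite almost everywhere.
\<close>

definition weight :: "(real ^ 'n \<Rightarrow> ennreal) \<Rightarrow> bool" where
  "weight w \<longleftrightarrow>
     w \<in> borel_measurable lebesgue \<and>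
     (\<forall>K. compact K \<longrightarrow> (\<integral>\<^sup>+x\<in>K. w x \<partial>lebesgue) < \<infinity>)"

definition mass :: "(real ^ 'n \<Rightarrow> ennreal) \<Rightarrow> (real ^ 'n) set \<Rightarrow> ennreal" where
  "mass w Q = (\<integral>\<^sup>+x\<in>Q. w x \<partial>lebesgue)"

text \<open>For \<open>p = \<infinity>\<close> this is the essential supremum with respect to the measure \<open>w dx\<close>.\<close>

definition Lp_norm :: "ereal \<Rightarrow> (real ^ 'n \<Rightarrow> ennreal) \<Rightarrow> (real ^ 'n \<Rightarrow> real) \<Rightarrow> ennreal" where
  "Lp_norm p w f =
     (if p = \<infinity> then esssup (density lebesgue w) (\<lambda>x. ennreal \<bar>f x\<bar>)
      else epow (\<integral>\<^sup>+x. ennreal (\<bar>f x\<bar> powr real_of_ereal p) * w x \<partial>lebesgue)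
                (1 / real_of_ereal p))"

definition Lp :: "ereal \<Rightarrow> (real ^ 'n \<Rightarrow> ennreal) \<Rightarrow> (real ^ 'n \<Rightarrow> real) set" where
  "Lp p w = {f \<in> borel_measurable lebesgue. Lp_norm p w f < \<infinity>}"

definition average :: "real \<Rightarrow> (real ^ 'n \<Rightarrow> real) \<Rightarrow> (real ^ 'n) set \<Rightarrow> ennreal" where
  "average r f Q =
     epow ((\<integral>\<^sup>+x\<in>Q. ennreal (f x powr r) \<partial>lebesgue) / emeasure lebesgue Q) (1 / r)"

text \<open>The uncentred Hardy--Littlewood maximal function over cubes.\<close>

definition maximal_fun :: "(real ^ 'n \<Rightarrow> ennreal) \<Rightarrow> real ^ 'n \<Rightarrow> ennreal" where
  "maximal_fun w x = (SUP Q \<in> {Q \<in> cubes. x \<in> Q}. mass w Q / emeasure lebesgue Q)"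

definition A_infty_const :: "(real ^ 'n \<Rightarrow> ennreal) \<Rightarrow> ennreal" where
  "A_infty_const w =
     (SUP Q \<in> cubes. mass (maximal_fun (\<lambda>x. w x * indicator Q x)) Q / mass w Q)"

definition A_const ::
  "real \<Rightarrow> real \<Rightarrow> real \<Rightarrow> (real ^ 'n \<Rightarrow> ennreal) \<Rightarrow> (real ^ 'n \<Rightarrow> ennreal) \<Rightarrow> ennreal" where
  "A_const a \<beta> \<gamma> u v =
     (SUP Q \<in> cubes. epow (emeasure lebesgue Q) a * epow (mass u Q) \<beta> * epow (mass v Q) \<gamma>)"

definition A_class ::
  "real \<Rightarrow> real \<Rightarrow> real \<Rightarrow> ((real ^ 'n \<Rightarrow> ennreal) \<times> (real ^ 'n \<Rightarrow> ennreal)) set" where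
  "A_class a \<beta> \<gamma> = {(u, v). weight u \<and> weight v \<and> A_const a \<beta> \<gamma> u v < \<infinity>}"


section \<open>The sparse form and its best constants\<close>

definition sparse_form ::
  "real \<Rightarrow> real \<Rightarrow> real \<Rightarrow> (real ^ 'n) set set \<Rightarrow> (real ^ 'n \<Rightarrow> real) \<Rightarrow> (real ^ 'n \<Rightarrow> real) \<Rightarrow> ennreal"
  where
  "sparse_form r t \<alpha> S f g =
     (\<Sum>\<^sub>\<infinity>Q\<in>S. average r (\<lambda>x. \<bar>f x\<bar>) Q * average t (\<lambda>x. \<bar>g x\<bar>) Q
               * epow (emeasure lebesgue Q) (1 + \<alpha>))"

definition best_const ::
  "real \<Rightarrow> ereal \<Rightarrow> real \<Rightarrow> real \<Rightarrow> real \<Rightarrow> (real ^ 'n \<Rightarrow> ennreal) \<Rightarrow> (real ^ 'n \<Rightarrow> ennreal) \<Rightarrow>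
     (real ^ 'n) set set \<Rightarrow> ennreal" where
  "best_const r s \<alpha> p q \<omega> \<sigma> S =
     Inf {N. \<forall>f \<in> Lp (ereal p) \<omega>. \<forall>g \<in> Lp (conj_exp (ereal q)) \<sigma>.
            sparse_form r (real_of_ereal (conj_exp s)) \<alpha> S f g
              \<le> N * Lp_norm (ereal p) \<omega> f * Lp_norm (conj_exp (ereal q)) \<sigma> g}"

text \<open>
  For one fixed family \<open>S\<close> (for instance the empty one), \<open>best_const\<close> cannot dominate a supremum
  over all cubes; the constant below is uniform in \<open>S\<close>, for a given sparseness \<open>\<eta>\<close>.
\<close>

definition uniform_best_const ::
  "real \<Rightarrow> real \<Rightarrow> ereal \<Rightarrow> real \<Rightarrow> real \<Rightarrow> real \<Rightarrow> (real ^ 'n \<Rightarrow> ennreal) \<Rightarrow>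
     (real ^ 'n \<Rightarrow> ennreal) \<Rightarrow> ennreal" where
  "uniform_best_const \<eta> r s \<alpha> p q \<omega> \<sigma> =
     (SUP S \<in> sparse_families \<eta>. best_const r s \<alpha> p q \<omega> \<sigma> S)"

text \<open>The factor involving the \<open>A\<^sub>\<infinity>\<close> constants; \<open>p'\<close> may be infinite, with \<open>1 / p' = 0\<close>.\<close>

definition A_infty_factor ::
  "real \<Rightarrow> real \<Rightarrow> real \<Rightarrow> (real ^ 'n \<Rightarrow> ennreal) \<Rightarrow> (real ^ 'n \<Rightarrow> ennreal) \<Rightarrow> ennreal" where
  "A_infty_factor p q \<alpha> u v =
     (let p' = conj_exp (ereal p) in
      if p = q \<and> \<alpha> > 0 then
        epow (A_infty_const u) (1 - real_of_ereal (1 / p'^2)) *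
          epow (A_infty_const v) (real_of_ereal (1 / p'^2)) +
        epow (A_infty_const u) (1 / p^2) * epow (A_infty_const v) (1 - 1 / p^2)
      else
        epow (A_infty_const u) (1 / q) + epow (A_infty_const v) (real_of_ereal (1 / p')))"

end

(*
With h = |f|^r / u and k = |g|^(s') / v the form becomes
  sum_Q |Q|^a u(Q)^(1/r) v(Q)^(1/s') <h>_Q^(1/r) <k>_Q^(1/s')
    = sum_Q A_Q u(Q)^(1/p) v(Q)^(1/q') <h>_Q^(1/r) <k>_Q^(1/s'),
where A_Q is at most [u,v] and the averages are taken with respect to u and v.  Replacing the averages
by their maxima Phi and Psi over the ancestors of Q makes them monotone along the tree of cubes, and
the sum can be rewritten by parts.

If p = q and alpha > 0, Carleson embedding in both factors gives the bound [u]^(1/p) [v]^(1/p'), which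
lies between the two terms of the claim.  Otherwise split the family according to A_Q ~ 2^(-j) [u,v].
On one piece the weights lambda_Q = u(Q)^(1/p) v(Q)^(1/q') satisfy
  sum_{Q <= R} lambda_Q <= C lambda_R,
since lambda_Q may be multiplied by A_Q^epsilon to create a positive power of |Q|; hence the sum is at
most C times the sum of lambda_Q times the increment at Q of Phi^(1/r) Psi^(1/s').  The increment of a
product has two terms; each of them uses the Carleson embedding in one factor only, which produces
[u]^(1/q) and [v]^(1/p'), while the other factor is controlled by the dyadic maximal theorem.

Conversely, a single cube is a sparse family, and the truncations of u^(1/r) and v^(1/s') to this cube
test the inequality.
*)
theory Submission
  imports Defs
begin

section \<open>Summation by parts in finite laminar families\<close>

text \<open>The two cases of the claim come from a count of exponents. With the \<epsilon>-th power
  of \<open>A_Q\<close> inserted, the total exponent is 1/p + 1/q' - \<epsilon> (a + \<beta> +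
  \<gamma>), where a + \<beta> + \<gamma> = \<alpha> - (1/p - 1/q); domination of a sum over a tree
  by its top term rests on a positive power of |Q| and a total of at least 1. For p < q there is
  room, since 1/p + 1/q' > 1; for p = q there is none, and \<alpha> > 0 pushes the total below 1.

  Two degenerate exponents shape the statements. For p = 1 the A-infinity constant of v has exponent
  0 and may be infinite; therefore the Carleson constants are free real parameters that enter
  through a power, and all sums run over finite subfamilies, with final bounds that do not depend on
  the subfamily. For q = 1 the exponent q' is infinite, the dual weight v becomes 1, and positivity
  of \<sigma> on the cubes of the family is extracted from finiteness of the best constant.\<close>

definition laminar :: "'a set set \<Rightarrow> bool" where
  "laminar S \<longleftrightarrow> finite S \<and> {} \<notin> S \<and> (\<forall>Q\<in>S. \<forall>R\<in>S. Q \<subseteq> R \<or> R \<subseteq> Q \<or> Q \<inter> R = {})"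

definition above :: "'a set set \<Rightarrow> 'a set \<Rightarrow> 'a set set" where
  "above S Q = {R \<in> S. Q \<subset> R}"

text \<open>The value of \<open>a\<close> at the parent of \<open>Q\<close>; at a maximal member it is \<open>0\<close>, so that increments
  telescope to \<open>a\<close> itself.\<close>

definition prev :: "'a set set \<Rightarrow> ('a set \<Rightarrow> real) \<Rightarrow> 'a set \<Rightarrow> real" where
  "prev S a Q = (if above S Q = {} then 0 else a (\<Inter>(above S Q)))"

definition incr :: "'a set set \<Rightarrow> ('a set \<Rightarrow> real) \<Rightarrow> 'a set \<Rightarrow> real" where
  "incr S a Q = a Q - prev S a Q"

lemma laminar_finite: "laminar S \<Longrightarrow> finite S"
  by (simp add: laminar_def)

lemma finite_above: "laminar S \<Longrightarrow> finite (above S Q)"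
  by (simp add: laminar_finite above_def)

lemma laminarD:
  "laminar S \<Longrightarrow> Q \<in> S \<Longrightarrow> R \<in> S \<Longrightarrow> x \<in> Q \<Longrightarrow> x \<in> R \<Longrightarrow> Q \<subseteq> R \<or> R \<subseteq> Q"
  unfolding laminar_def by blast

lemma laminar_ex: "laminar S \<Longrightarrow> Q \<in> S \<Longrightarrow> \<exists>x. x \<in> Q"
  unfolding laminar_def by (metis equals0I)

lemma laminar_subset: "laminar S \<Longrightarrow> S' \<subseteq> S \<Longrightarrow> laminar S'"
  unfolding laminar_def by (meson finite_subset subsetD)

text \<open>A finite chain has a least member, which is its intersection. This lets parents and
  smallest cubes be written as intersections instead of being chosen.\<close>

lemma Inter_chain_mem:
  assumes "finite C" "C \<noteq> {}" "\<And>Q R. Q \<in> C \<Longrightarrow> R \<in> C \<Longrightarrow> Q \<subseteq> R \<or> R \<subseteq> Q"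
  shows "\<Inter>C \<in> C"
  using assms
proof (induction C rule: finite_ne_induct)
  case (singleton x)
  then show ?case by simp
next
  case (insert x F)
  then have "\<Inter>F \<in> F" by blast
  moreover from this have "x \<subseteq> \<Inter>F \<or> \<Inter>F \<subseteq> x" using insert.prems by blast
  ultimately show ?case
    by (metis Inter_insert inf.absorb1 inf.absorb2 insert_iff)
qed

text \<open>The members through a point are pairwise comparable, and their least member has exactly
  these members as ancestors. Sums over the cubes at x thus become sums over the ancestors of one
  cube.\<close>

lemma laminar_point:
  assumes "laminar S" "{Q \<in> S. x \<in> Q} \<noteq> {}"
  shows "\<Inter>{Q \<in> S. x \<in> Q} \<in> S" "x \<in> \<Inter>{Q \<in> S. x \<in> Q}"
    "{Q \<in> S. x \<in> Q} = {Q \<in> S. \<Inter>{Q \<in> S. x \<in> Q} \<subseteq> Q}"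
proof -
  have "\<Inter>{Q \<in> S. x \<in> Q} \<in> {Q \<in> S. x \<in> Q}"
  proof (intro Inter_chain_mem)
    fix Q R assume "Q \<in> {Q \<in> S. x \<in> Q}" "R \<in> {Q \<in> S. x \<in> Q}"
    then show "Q \<subseteq> R \<or> R \<subseteq> Q" using laminarD[OF assms(1), of Q R x] by blast
  next
    show "finite {Q \<in> S. x \<in> Q}" using laminar_finite[OF assms(1)] by (rule rev_finite_subset) blast
  qed (fact assms(2))
  then show "\<Inter>{Q \<in> S. x \<in> Q} \<in> S" "x \<in> \<Inter>{Q \<in> S. x \<in> Q}"
    "{Q \<in> S. x \<in> Q} = {Q \<in> S. \<Inter>{Q \<in> S. x \<in> Q} \<subseteq> Q}"
    by blast+
qed

lemma laminar_parent:
  assumes S: "laminar S" and Q: "Q \<in> S" and ne: "above S Q \<noteq> {}"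
  defines "P \<equiv> \<Inter>(above S Q)"
  shows "P \<in> S" "Q \<subset> P" "above S Q = {R \<in> S. P \<subseteq> R}"
proof -
  have "R \<subseteq> R' \<or> R' \<subseteq> R" if "R \<in> above S Q" "R' \<in> above S Q" for R R'
  proof -
    obtain x where "x \<in> Q" using laminar_ex[OF S Q] by blast
    then have "x \<in> R" "x \<in> R'" "R \<in> S" "R' \<in> S" using that by (auto simp: above_def)
    then show ?thesis using laminarD[OF S] by blast
  qed
  then have "P \<in> above S Q"
    unfolding P_def using finite_above[OF S] ne by (intro Inter_chain_mem)
  then show "P \<in> S" "Q \<subset> P" "above S Q = {R \<in> S. P \<subseteq> R}"
    unfolding P_def above_def by blast+
qed

text \<open>Induction on the number of strict ancestors: those of \<open>Q\<close> are the parent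
  together with the strict ancestors of the parent.\<close>

lemma sum_incr_above:
  assumes S: "laminar S" and Q: "Q \<in> S"
  shows "(\<Sum>R | R \<in> S \<and> Q \<subseteq> R. incr S a R) = a Q"
  using Q
proof (induction "card (above S Q)" arbitrary: Q rule: less_induct)
  case less
  have fin: "finite (above S Q)" using finite_above[OF S] .
  have eq: "{R. R \<in> S \<and> Q \<subseteq> R} = insert Q (above S Q)" using less.prems by (auto simp: above_def)
  have *: "(\<Sum>R | R \<in> S \<and> Q \<subseteq> R. incr S a R) = incr S a Q + (\<Sum>R | R \<in> above S Q. incr S a R)"
    unfolding eq using fin by (subst sum.insert) (auto simp: above_def)
  show ?case
  proof (cases "above S Q = {}")
    case True
    then show ?thesis unfolding * by (simp add: incr_def prev_def)
  next
    case False
    define P where "P = \<Inter>(above S Q)"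
    note P = laminar_parent[OF S less.prems False, folded P_def]
    have "card (above S P) < card (above S Q)"
      using P fin by (intro psubset_card_mono) (auto simp: above_def)
    then have "(\<Sum>R | R \<in> S \<and> P \<subseteq> R. incr S a R) = a P"
      using less.hyps P by blast
    then have "(\<Sum>R | R \<in> above S Q. incr S a R) = a P" unfolding P(3) by simp
    moreover have "prev S a Q = a P" using False by (simp add: prev_def P_def)
    ultimately show ?thesis unfolding * by (simp add: incr_def)
  qed
qed

lemma sum_incr_point:
  assumes S: "laminar S" and ne: "{Q \<in> S. x \<in> Q} \<noteq> {}"
  shows "(\<Sum>R | R \<in> S \<and> x \<in> R. incr S a R) = a (\<Inter>{Q \<in> S. x \<in> Q})"
  using sum_incr_above[OF S laminar_point(1)[OF S ne], of a] laminar_point(3)[OF S ne] by simp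

section \<open>Functions that grow towards smaller sets, and Abel summation for them\<close>

definition decreasing :: "'a set set \<Rightarrow> ('a set \<Rightarrow> real) \<Rightarrow> bool" where
  "decreasing S a \<longleftrightarrow> (\<forall>Q\<in>S. 0 \<le> a Q) \<and> (\<forall>Q\<in>S. \<forall>R\<in>S. Q \<subseteq> R \<longrightarrow> a R \<le> a Q)"

lemma prev_bounds:
  assumes "laminar S" "decreasing S a" "Q \<in> S"
  shows "0 \<le> prev S a Q" "prev S a Q \<le> a Q"
proof -
  have "0 \<le> prev S a Q \<and> prev S a Q \<le> a Q"
  proof (cases "above S Q = {}")
    case True
    then show ?thesis using assms unfolding prev_def decreasing_def by simp
  next
    case False
    have "\<Inter>(above S Q) \<in> S" "Q \<subseteq> \<Inter>(above S Q)"
      using laminar_parent[OF assms(1,3) False] by blast+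
    moreover have "prev S a Q = a (\<Inter>(above S Q))" unfolding prev_def using False by simp
    ultimately show ?thesis using assms(2,3) unfolding decreasing_def by metis
  qed
  then show "0 \<le> prev S a Q" "prev S a Q \<le> a Q" by auto
qed

lemma incr_nonneg: "laminar S \<Longrightarrow> decreasing S a \<Longrightarrow> Q \<in> S \<Longrightarrow> 0 \<le> incr S a Q"
  using prev_bounds(2) by (auto simp: incr_def)

text \<open>The condition on \<open>f 0\<close> matches the value 0 of \<open>prev\<close> at
  maximal members.\<close>

lemma prev_cong: 
  assumes "f 0 = 0"
  shows "prev S (\<lambda>Q. f (a Q)) Q = f (prev S a Q)"
  using assms by (simp add: prev_def)

lemma prev_mult: "prev S (\<lambda>Q. a Q * b Q) Q = prev S a Q * prev S b Q"
  by (simp add: prev_def)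

lemma decreasing_powr:
  assumes "decreasing S a" "0 \<le> k"
  shows "decreasing S (\<lambda>Q. a Q powr k)"
  using assms by (auto simp: decreasing_def intro!: powr_mono2)

lemma decreasing_mult:
  assumes "decreasing S a" "decreasing S b"
  shows "decreasing S (\<lambda>Q. a Q * b Q)"
  using assms by (auto simp: decreasing_def intro!: mult_mono)

text \<open>Expand \<open>a Q\<close> into the increments at its ancestors and interchange the sums:
  the increment at R then meets the total of \<open>l\<close> below R. Increments of a decreasing
  function are non-negative, so the bound \<open>L\<close> may be inserted.\<close>

lemma laminar_Abel:
  assumes S: "laminar S" and a: "decreasing S a"
    and L: "\<And>R. R \<in> S \<Longrightarrow> (\<Sum>Q | Q \<in> S \<and> Q \<subseteq> R. l Q) \<le> L R"
  shows "(\<Sum>Q\<in>S. l Q * a Q) \<le> (\<Sum>R\<in>S. incr S a R * L R)"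
proof -
  have fin: "finite S" using laminar_finite[OF S] by simp
  have "(\<Sum>Q\<in>S. l Q * a Q) = (\<Sum>Q\<in>S. \<Sum>R | R \<in> S \<and> Q \<subseteq> R. l Q * incr S a R)"
    by (intro sum.cong refl) (simp only: sum_distrib_left[symmetric] sum_incr_above[OF S])
  also have "\<dots> = (\<Sum>R\<in>S. \<Sum>Q | Q \<in> S \<and> Q \<subseteq> R. l Q * incr S a R)"
    by (rule sum.swap_restrict) (use fin in auto)
  also have "\<dots> = (\<Sum>R\<in>S. incr S a R * (\<Sum>Q | Q \<in> S \<and> Q \<subseteq> R. l Q))"
    by (simp add: sum_distrib_left mult.commute)
  also have "\<dots> \<le> (\<Sum>R\<in>S. incr S a R * L R)"
    by (intro sum_mono mult_left_mono L incr_nonneg S a)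
  finally show ?thesis .
qed

text \<open>The maximal function belonging to the averages \<open>H\<close>, evaluated at a cube
  instead of a point. It depends on the family: passing to a subfamily removes ancestors.\<close>

definition smax :: "'a set set \<Rightarrow> ('a set \<Rightarrow> real) \<Rightarrow> 'a set \<Rightarrow> real" where
  "smax S H Q = Max (H ` {R \<in> S. Q \<subseteq> R})"

lemma smax_ge: "laminar S \<Longrightarrow> R \<in> S \<Longrightarrow> Q \<subseteq> R \<Longrightarrow> H R \<le> smax S H Q"
  unfolding smax_def by (rule Max_ge) (auto dest: laminar_finite)

lemma smax_decreasing:
  assumes S: "laminar S" and H: "\<And>Q. Q \<in> S \<Longrightarrow> 0 \<le> H Q"
  shows "decreasing S (smax S H)"
  unfolding decreasing_def
proof safe
  fix Q assume "Q \<in> S" then show "0 \<le> smax S H Q"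
    using smax_ge[OF S, of Q Q H] H[of Q] by auto
next
  fix Q R assume "Q \<in> S" "R \<in> S" "Q \<subseteq> R"
  then show "smax S H R \<le> smax S H Q"
    unfolding smax_def using S by (intro Max_mono) (auto dest: laminar_finite)
qed

text \<open>A nonzero increment forces the maximum to be attained at the cube itself. Wherever the
  maximal function moves, it may therefore be replaced by the average over that cube, which is what
  the maximal theorem exploits.\<close>

lemma smax_eq_or_prev:
  assumes S: "laminar S" and H: "\<And>Q. Q \<in> S \<Longrightarrow> 0 \<le> H Q" and Q: "Q \<in> S"
  shows "smax S H Q = H Q \<or> smax S H Q = prev S (smax S H) Q"
proof -
  have dec: "decreasing S (smax S H)" using S H by (intro smax_decreasing)
  have "smax S H Q \<in> H ` {R \<in> S. Q \<subseteq> R}"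
    unfolding smax_def using S Q by (intro Max_in) (auto dest: laminar_finite)
  then obtain R where R: "R \<in> S" "Q \<subseteq> R" "smax S H Q = H R" by auto
  show ?thesis
  proof (cases "R = Q")
    case False
    then have ne: "above S Q \<noteq> {}" using R by (auto simp: above_def)
    note P = laminar_parent[OF S Q ne]
    have "\<Inter>(above S Q) \<subseteq> R" using R False by (auto simp: above_def)
    then have "smax S H Q \<le> smax S H (\<Inter>(above S Q))"
      unfolding R(3) using R by (intro smax_ge S) auto
    moreover have "prev S (smax S H) Q = smax S H (\<Inter>(above S Q))"
      using ne by (simp add: prev_def)
    ultimately show ?thesis
      using prev_bounds(2)[OF S dec Q] by linarith
  qed (use R in auto)
qed

section \<open>The maximal theorem\<close>

text \<open>For t between y and x the derivative P t^(P-1) of the left-hand power is at most P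
  t^(P-2) x, the derivative of the right-hand side. The case y = 0 is separate because powers are
  differentiated at positive points.\<close>

lemma powr_diff_le:
  fixes x y P :: real
  assumes P: "1 < P" and y: "0 \<le> y" "y \<le> x"
  shows "x powr P - y powr P \<le> P / (P - 1) * (x powr (P - 1) - y powr (P - 1)) * x"
proof (cases "y = 0")
  case True
  have "x powr (P - 1) * x = x powr P" 
    using y True powr_mult_base[of x "P - 1"] by (simp add: mult.commute)
  moreover have "1 * x powr P \<le> P / (P - 1) * x powr P"
    using P by (intro mult_right_mono) (auto simp: field_simps)
  ultimately show ?thesis using True by (simp add: mult.assoc)
next
  case False
  define f where "f t = P / (P - 1) * t powr (P - 1) * x - t powr P" for t
  have "f y \<le> f x"
  proof (rule DERIV_nonneg_imp_nondecreasing[OF y(2)])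
    fix t assume t: "y \<le> t" "t \<le> x"
    then have t0: "t > 0" using y False by auto
    have "(f has_real_derivative (P / (P - 1) * ((P - 1) * t powr (P - 1 - 1)) * x - P * t powr (P - 1))) (at t)"
      unfolding f_def using t0 P by (auto intro!: derivative_eq_intros)
    moreover have "P / (P - 1) * ((P - 1) * t powr (P - 1 - 1)) * x - P * t powr (P - 1) \<ge> 0"
    proof -
      have "t powr (P - 1) = t * t powr (P - 1 - 1)"
        using powr_mult_base[of t "P - 1 - 1"] t0 by simp
      moreover have "t * t powr (P - 1 - 1) \<le> x * t powr (P - 1 - 1)"
        using t by (intro mult_right_mono) auto
      moreover have "P / (P - 1) * ((P - 1) * t powr (P - 1 - 1)) * x = P * (x * t powr (P - 1 - 1))"
        using P by simp
      ultimately show ?thesis using P by (simp add: mult_left_mono mult.commute)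
    qed
    ultimately show "\<exists>D. (f has_real_derivative D) (at t) \<and> 0 \<le> D" by blast
  qed
  moreover have "x powr (P - 1) * x = x powr P"
    using y powr_mult_base[of x "P - 1"] by (simp add: mult.commute)
  ultimately show ?thesis unfolding f_def by (simp add: algebra_simps)
qed

text \<open>Write z^m as z times z^(m-1) and bound the lower powers of both x - y and y by x^(m-1);
  the remaining factors add up to x.\<close>

lemma powr_diff_superadd:
  fixes x y m :: real
  assumes m: "1 \<le> m" and y: "0 \<le> y" "y \<le> x"
  shows "(x - y) powr m \<le> x powr m - y powr m"
proof -
  have *: "z powr m = z * z powr (m - 1)" if "0 \<le> z" for z
    using powr_mult_base[of z "m - 1"] that by simp
  have "(x - y) powr m \<le> (x - y) * x powr (m - 1)"
    using m y by (subst *) (auto intro!: mult_left_mono powr_mono2)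
  moreover have "y powr m \<le> y * x powr (m - 1)"
    using m y by (subst *) (auto intro!: mult_left_mono powr_mono2)
  ultimately show ?thesis using *[of x] y by (simp add: algebra_simps)
qed

text \<open>A form of Young's inequality with a parameter: if h is at most e m, the first term
  dominates, otherwise m is below h / e and the second one does.\<close>

lemma mult_powr_le_sum_powr:
  fixes h m e P :: real
  assumes "0 \<le> h" "0 \<le> m" "0 < e" "1 < P"
  shows "h * m powr (P - 1) \<le> e * m powr P + e powr (1 - P) * h powr P"
proof (cases "h \<le> e * m")
  case True
  have "h * m powr (P - 1) \<le> e * m * m powr (P - 1)"
    using True by (intro mult_right_mono) auto
  also have "\<dots> = e * m powr P" using powr_mult_base[of m "P - 1"] assms by simp
  finally show ?thesis by (simp add: add_increasing2)
next
  case False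
  then have "m \<le> h / e" using assms by (simp add: field_simps)
  then have "h * m powr (P - 1) \<le> h * (h / e) powr (P - 1)"
    using assms by (intro mult_left_mono powr_mono2) auto
  also have "\<dots> = e powr (1 - P) * h powr P"
    using powr_mult_base[of h "P - 1"] assms
    by (simp add: powr_divide field_simps powr_minus[symmetric] powr_diff)
  finally show ?thesis using assms by (simp add: add_increasing)
qed

text \<open>The left-hand side is the integral of the P-th power of the maximal function Mh, written
  as a sum over the tree. Where the increment is nonzero, \<open>a Q\<close> is the average of h, so
  \<open>powr_diff_le\<close> trades one factor \<open>a Q\<close> and the measure of Q for the
  integral of h over Q. This bounds the sum by c times the integral of h (Mh)^(P-1). Young's
  inequality with parameter 1/(2c) then gives half of the left-hand side back, and a finite sum can
  be absorbed.\<close>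

lemma laminar_Doob:
  fixes M :: "'a measure" and h :: "'a \<Rightarrow> real"
  assumes S: "laminar S" and SM: "\<And>Q. Q \<in> S \<Longrightarrow> Q \<in> sets M"
    and pos: "\<And>Q. Q \<in> S \<Longrightarrow> 0 < measure M Q"
    and h: "\<And>x. 0 \<le> h x" and int: "\<And>Q. Q \<in> S \<Longrightarrow> integrable M (\<lambda>x. indicator Q x * h x)"
    and P: "1 < P" and intP: "integrable M (\<lambda>x. h x powr P)"
  defines "a \<equiv> smax S (\<lambda>Q. (\<integral>x. indicator Q x * h x \<partial>M) / measure M Q)"
    and "c \<equiv> P / (P - 1)"
  shows "(\<Sum>Q\<in>S. incr S (\<lambda>Q. a Q powr P) Q * measure M Q)
           \<le> 2 * c * (1 / (2 * c)) powr (1 - P) * (\<integral>x. h x powr P \<partial>M)"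
proof -
  define H where "H Q = (\<integral>x. indicator Q x * h x \<partial>M) / measure M Q" for Q
  have aH: "a = smax S H" by (simp add: a_def H_def[abs_def])
  have H0: "0 \<le> H Q" for Q
    unfolding H_def using h by (intro divide_nonneg_nonneg integral_nonneg_AE) auto
  have dec: "decreasing S a"
    unfolding aH by (rule smax_decreasing[OF S]) (rule H0)
  have a0: "0 \<le> a Q" if "Q \<in> S" for Q using dec that by (auto simp: decreasing_def)
  have fin: "finite S" using S by (rule laminar_finite)
  have c: "c > 1" using P by (simp add: c_def)
  define e where "e = 1 / (2 * c)"
  have e: "e > 0" using c by (simp add: e_def)
  define i1 where "i1 Q = incr S (\<lambda>Q. a Q powr (P - 1)) Q" for Q
  define i2 where "i2 Q = incr S (\<lambda>Q. a Q powr P) Q" for Q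
  define Z where "Z = (\<Sum>Q\<in>S. i2 Q * measure M Q)"
  have step: "i2 Q * measure M Q \<le> c * (i1 Q * (\<integral>x. indicator Q x * h x \<partial>M))" if Q: "Q \<in> S" for Q
  proof -
    have i1: "i1 Q = a Q powr (P - 1) - prev S a Q powr (P - 1)"
      unfolding i1_def incr_def by (subst prev_cong[of "\<lambda>z. z powr (P - 1)"]) auto
    have i2: "i2 Q = a Q powr P - prev S a Q powr P"
      unfolding i2_def incr_def by (subst prev_cong[of "\<lambda>z. z powr P"]) auto
    consider "a Q = H Q" | "a Q = prev S a Q"
      using smax_eq_or_prev[OF S _ Q, of H] H0 unfolding aH by blast
    then show ?thesis
    proof cases
      case 1
      have "i2 Q \<le> c * i1 Q * a Q"
        unfolding i1 i2 c_def using prev_bounds[OF S dec Q] P by (intro powr_diff_le) auto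
      then have "i2 Q * measure M Q \<le> c * i1 Q * a Q * measure M Q"
        by (intro mult_right_mono) auto
      also have "\<dots> = c * (i1 Q * (a Q * measure M Q))" by simp
      also have "a Q * measure M Q = (\<integral>x. indicator Q x * h x \<partial>M)"
        using 1 pos[OF Q] by (simp add: H_def)
      finally show ?thesis .
    qed (simp add: i1 i2)
  qed
  \<comment> \<open>\<open>measure\<close> is 0 on sets of infinite measure, so its positivity
    forces finiteness.\<close>
  have fm: "emeasure M Q < \<infinity>" if "Q \<in> S" for Q
    using pos[OF that] by (metis less_irrefl measure_eq_emeasure_eq_ennreal measure_def enn2real_top infinity_ennreal_def less_top)
  have intQ: "integrable M (indicator Q :: 'a \<Rightarrow> real)" if "Q \<in> S" for Q
    using SM[OF that] fm[OF that] by (simp add: integrable_indicator_iff)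
  have "Z \<le> c * (\<Sum>Q\<in>S. i1 Q * (\<integral>x. indicator Q x * h x \<partial>M))"
    unfolding Z_def sum_distrib_left by (intro sum_mono step)
  also have "(\<Sum>Q\<in>S. i1 Q * (\<integral>x. indicator Q x * h x \<partial>M))
     = (\<integral>x. (\<Sum>Q\<in>S. i1 Q * (indicator Q x * h x)) \<partial>M)"
    using int by (subst Bochner_Integration.integral_sum) auto
  also have "\<dots> \<le> (\<integral>x. e * (\<Sum>Q\<in>S. i2 Q * indicator Q x) + e powr (1 - P) * h x powr P \<partial>M)"
  proof (intro integral_mono)
    fix x
    show "(\<Sum>Q\<in>S. i1 Q * (indicator Q x * h x))
        \<le> e * (\<Sum>Q\<in>S. i2 Q * indicator Q x) + e powr (1 - P) * h x powr P"
    proof (cases "{Q \<in> S. x \<in> Q} = {}")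
      case True
      then have "(\<Sum>Q\<in>S. i1 Q * (indicator Q x * h x)) = 0" "(\<Sum>Q\<in>S. i2 Q * indicator Q x) = (0::real)"
        by (auto intro!: sum.neutral simp: indicator_def)
      then show ?thesis by simp
    next
      case False
      \<comment> \<open>At x both sums telescope to a power of \<open>a\<close> at the smallest cube
        through x, that is, of the maximal function at x.\<close>
      define R where "R = \<Inter>{Q \<in> S. x \<in> Q}"
      have R: "R \<in> S" unfolding R_def by (rule laminar_point[OF S False])
      have "(\<Sum>Q\<in>S. i1 Q * (indicator Q x * h x)) = h x * (\<Sum>Q | Q \<in> S \<and> x \<in> Q. i1 Q)"
        unfolding sum_distrib_left using fin
        by (intro sum.mono_neutral_cong_right) (auto simp: indicator_def)
      also have "(\<Sum>Q | Q \<in> S \<and> x \<in> Q. i1 Q) = a R powr (P - 1)"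
        unfolding i1_def R_def by (rule sum_incr_point[OF S False])
      finally have 1: "(\<Sum>Q\<in>S. i1 Q * (indicator Q x * h x)) = h x * a R powr (P - 1)" .
      have "(\<Sum>Q\<in>S. i2 Q * indicator Q x) = (\<Sum>Q | Q \<in> S \<and> x \<in> Q. i2 Q)"
        using fin by (intro sum.mono_neutral_cong_right) (auto simp: indicator_def)
      also have "\<dots> = a R powr P"
        unfolding i2_def R_def by (rule sum_incr_point[OF S False])
      finally show ?thesis unfolding 1
        using mult_powr_le_sum_powr[OF h a0[OF R] e P] by simp
    qed
  qed (use int intQ intP in auto)
  also have "\<dots> = e * Z + e powr (1 - P) * (\<integral>x. h x powr P \<partial>M)"
    using intQ intP SM by (subst Bochner_Integration.integral_add)
      (auto simp: Z_def Bochner_Integration.integral_sum intro!: sum.cong)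
  finally have "Z \<le> c * e * Z + c * (e powr (1 - P) * (\<integral>x. h x powr P \<partial>M))"
    using c by (simp add: algebra_simps)
  moreover have "c * e = 1 / 2" using c by (simp add: e_def)
  ultimately have "Z \<le> 2 * (c * (e powr (1 - P) * (\<integral>x. h x powr P \<partial>M)))" by simp
  then show ?thesis by (simp add: Z_def i2_def e_def mult.assoc)
qed

text \<open>Once every factor is normalised to lie in \<open>[0, 1]\<close>, a product of powers with total
  exponent at least \<open>1\<close> is at most the largest factor.\<close>

lemma sum_powr_prod_le:
  fixes x y z :: "'i \<Rightarrow> real"
  assumes "finite I" and nn: "\<And>i. i \<in> I \<Longrightarrow> 0 \<le> x i \<and> 0 \<le> y i \<and> 0 \<le> z i"
    and X: "(\<Sum>i\<in>I. x i) \<le> X" and Y: "(\<Sum>i\<in>I. y i) \<le> Y" and Z: "(\<Sum>i\<in>I. z i) \<le> Z"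
    and abc: "0 \<le> a" "0 \<le> b" "0 \<le> c" "1 \<le> a + b + c"
  shows "(\<Sum>i\<in>I. x i powr a * y i powr b * z i powr c) \<le> 3 * (X powr a * Y powr b * Z powr c)"
proof -
  let ?N = "X powr a * Y powr b * Z powr c"
  have le: "x i \<le> X" "y i \<le> Y" "z i \<le> Z" if "i \<in> I" for i
    using member_le_sum[of i I x] member_le_sum[of i I y] member_le_sum[of i I z]
      that assms(1) nn X Y Z by (auto intro: order_trans)
  have step: "x i powr a * y i powr b * z i powr c \<le> ?N * (x i / X + y i / Y + z i / Z)"
    if i: "i \<in> I" for i
  proof (cases "x i = 0 \<or> y i = 0 \<or> z i = 0")
    \<comment> \<open>By the convention \<open>0 powr 0 = 0\<close> the product vanishes even when
      the exponent of the vanishing factor is 0.\<close>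
    case True
    have "0 \<le> X" "0 \<le> Y" "0 \<le> Z" using le[OF i] nn[OF i] by auto
    then show ?thesis using True nn[OF i] by auto
  next
    case False
    then have p: "x i > 0" "y i > 0" "z i > 0" using nn[OF i] by auto
    then have P: "X > 0" "Y > 0" "Z > 0" using le[OF i] by auto
    define s where "s = x i / X + y i / Y + z i / Z"
    define m where "m = max (x i / X) (max (y i / Y) (z i / Z))"
    have m: "0 < m" "m \<le> 1" "m \<le> s"
      unfolding m_def s_def using p P le[OF i] by (auto simp: less_max_iff_disj)
    have "(x i / X) powr a * (y i / Y) powr b * (z i / Z) powr c \<le> m powr a * m powr b * m powr c"
      unfolding m_def using p P abc by (intro mult_mono powr_mono2) auto
    also have "\<dots> = m powr (a + b + c)" by (simp add: powr_add)
    also have "\<dots> \<le> m powr 1" using m abc by (intro powr_mono') auto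
    also have "\<dots> \<le> s" using m by simp
    finally have "?N * ((x i / X) powr a * (y i / Y) powr b * (z i / Z) powr c) \<le> ?N * s"
      by (intro mult_left_mono) auto
    then show ?thesis using p P by (simp add: powr_divide s_def)
  qed
  have frac: "(\<Sum>i\<in>I. w i / W) \<le> 1" if "(\<Sum>i\<in>I. w i) \<le> W" "\<And>i. i \<in> I \<Longrightarrow> 0 \<le> w i"
    for w :: "'i \<Rightarrow> real" and W
  proof -
    have "0 \<le> (\<Sum>i\<in>I. w i)" using that by (intro sum_nonneg)
    then have "0 \<le> W" using that by linarith
    then show ?thesis
      using that by (cases "W = 0") (auto simp: sum_divide_distrib[symmetric])
  qed
  have "(\<Sum>i\<in>I. x i powr a * y i powr b * z i powr c)
      \<le> ?N * ((\<Sum>i\<in>I. x i / X) + (\<Sum>i\<in>I. y i / Y) + (\<Sum>i\<in>I. z i / Z))"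
    using sum_mono[OF step] by (simp add: sum_distrib_left sum.distrib distrib_left)
  also have "\<dots> \<le> ?N * 3"
  proof -
    have "(\<Sum>i\<in>I. x i / X) \<le> 1" "(\<Sum>i\<in>I. y i / Y) \<le> 1" "(\<Sum>i\<in>I. z i / Z) \<le> 1"
      using X Y Z nn by (auto intro!: frac)
    then show ?thesis by (intro mult_left_mono) auto
  qed
  finally show ?thesis by simp
qed

text \<open>Takes the place of Hoelder's inequality, with exponents that may add up to more than 1.
  The third factor of the previous bound is y again with exponent 0; next to y^b it changes nothing,
  because both vanish at y = 0.\<close>

lemma sum_powr_prod_le2:
  fixes x y :: "'i \<Rightarrow> real"
  assumes "finite I" and nn: "\<And>i. i \<in> I \<Longrightarrow> 0 \<le> x i \<and> 0 \<le> y i"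
    and X: "(\<Sum>i\<in>I. x i) \<le> X" and Y: "(\<Sum>i\<in>I. y i) \<le> Y"
    and ab: "0 \<le> a" "0 \<le> b" "1 \<le> a + b"
  shows "(\<Sum>i\<in>I. x i powr a * y i powr b) \<le> 3 * (X powr a * Y powr b)"
proof -
  have "w powr b * w powr 0 = w powr b" for w :: real by (cases "w = 0") auto
  moreover have "(\<Sum>i\<in>I. x i powr a * y i powr b * y i powr 0) \<le> 3 * (X powr a * Y powr b * Y powr 0)"
    using nn ab by (intro sum_powr_prod_le assms(1) X Y) auto
  ultimately show ?thesis by (simp only: mult.assoc)
qed

section \<open>Carleson families\<close>

text \<open>The properties of a measure on which the tree arguments rest. Lebesgue measure and the
  measures with densities u and v are treated alike through this abstraction.\<close>

definition superadd :: "'a set set \<Rightarrow> ('a set \<Rightarrow> real) \<Rightarrow> bool" where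
  "superadd S U \<longleftrightarrow> (\<forall>Q\<in>S. 0 < U Q) \<and>
     (\<forall>R\<in>S. \<forall>D\<subseteq>S. disjoint D \<and> (\<forall>Q\<in>D. Q \<subseteq> R) \<longrightarrow> (\<Sum>Q\<in>D. U Q) \<le> U R)"

text \<open>Nothing additive is asked of \<open>U\<close>: the condition is also applied to products
  of powers of two masses.\<close>

definition carleson :: "'a set set \<Rightarrow> ('a set \<Rightarrow> real) \<Rightarrow> real \<Rightarrow> bool" where
  "carleson S U B \<longleftrightarrow> (\<forall>R\<in>S. (\<Sum>Q | Q \<in> S \<and> Q \<subseteq> R. U Q) \<le> B * U R)"

lemma superadd_pos: "superadd S U \<Longrightarrow> Q \<in> S \<Longrightarrow> 0 < U Q"
  by (simp add: superadd_def)

lemma superaddD: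
  "superadd S U \<Longrightarrow> R \<in> S \<Longrightarrow> D \<subseteq> S \<Longrightarrow> disjoint D \<Longrightarrow> \<forall>Q\<in>D. Q \<subseteq> R \<Longrightarrow> (\<Sum>Q\<in>D. U Q) \<le> U R"
  by (simp add: superadd_def)

lemma superadd_mono: "superadd S U \<Longrightarrow> Q \<in> S \<Longrightarrow> R \<in> S \<Longrightarrow> Q \<subseteq> R \<Longrightarrow> U Q \<le> U R"
  using superaddD[of S U R "{Q}"] by simp

lemma superadd_subset: "superadd S U \<Longrightarrow> S' \<subseteq> S \<Longrightarrow> superadd S' U"
  unfolding superadd_def by (meson subset_iff)

lemma carleson_subset:
  assumes "carleson S U B" "S' \<subseteq> S" "superadd S U" "finite S"
  shows "carleson S' U B"
  unfolding carleson_def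
proof
  fix R assume R: "R \<in> S'"
  have "(\<Sum>Q | Q \<in> S' \<and> Q \<subseteq> R. U Q) \<le> (\<Sum>Q | Q \<in> S \<and> Q \<subseteq> R. U Q)"
    using assms superadd_pos[OF assms(3)] by (intro sum_mono2) (auto intro: less_imp_le)
  also have "\<dots> \<le> B * U R" using assms R by (auto simp: carleson_def)
  finally show "(\<Sum>Q | Q \<in> S' \<and> Q \<subseteq> R. U Q) \<le> B * U R" .
qed

section \<open>Generations of a tree: geometric and exponential sums\<close>

definition depth :: "'a set set \<Rightarrow> 'a set \<Rightarrow> nat" where
  "depth S Q = card (above S Q)"

lemma depth_less:
  assumes "laminar S" "Q \<subset> R" "R \<in> S"
  shows "depth S R < depth S Q"
  unfolding depth_def
  by (intro psubset_card_mono finite_above assms) (use assms in \<open>auto simp: above_def\<close>)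

lemma depth_Suc:
  assumes S: "laminar S" and Q: "Q \<in> S" and ne: "above S Q \<noteq> {}"
  shows "depth S Q = Suc (depth S (\<Inter>(above S Q)))"
proof -
  let ?P = "\<Inter>(above S Q)"
  note P = laminar_parent[OF S Q ne]
  have "above S Q = insert ?P (above S ?P)" using P(1) by (subst P(3)) (auto simp: above_def)
  moreover have "?P \<notin> above S ?P" by (simp add: above_def)
  ultimately show ?thesis
    unfolding depth_def using finite_above[OF S] by (metis card_insert_disjoint)
qed

text \<open>The members of one generation are pairwise disjoint, so superadditivity bounds their
  total by \<open>U R\<close>; the generations then form a geometric series.\<close>

lemma sum_depth_geometric:
  assumes S: "laminar S" and U: "superadd S U" and R: "R \<in> S" "S \<subseteq> Pow R"
    and k: "0 < k" "k < 1"
  shows "(\<Sum>Q\<in>S. U Q * k ^ depth S Q) \<le> U R / (1 - k)"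
proof -
  have fin: "finite S" by (rule laminar_finite[OF S])
  define n where "n = Suc (Max (depth S ` S))"
  have less: "depth S Q < n" if "Q \<in> S" for Q
    unfolding n_def using that fin by (simp add: less_Suc_eq_le)
  have "(\<Sum>Q\<in>S. U Q * k ^ depth S Q) = (\<Sum>j<n. \<Sum>Q | Q \<in> S \<and> depth S Q = j. U Q * k ^ depth S Q)"
    using fin less by (intro sum.group[symmetric]) auto
  also have "\<dots> = (\<Sum>j<n. (\<Sum>Q | Q \<in> S \<and> depth S Q = j. U Q) * k ^ j)"
    by (simp add: sum_distrib_right)
  also have "\<dots> \<le> (\<Sum>j<n. U R * k ^ j)"
  proof (rule sum_mono)
    fix j assume "j \<in> {..<n}"
    have "Q \<inter> Q' = {}" if "Q \<in> S" "Q' \<in> S" "depth S Q = depth S Q'" "Q \<noteq> Q'" for Q Q'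
    proof (rule ccontr)
      assume "Q \<inter> Q' \<noteq> {}"
      then have "Q \<subset> Q' \<or> Q' \<subset> Q" using laminarD[OF S that(1,2)] that(4) by auto
      then show False using depth_less[OF S] that by (metis less_irrefl)
    qed
    then have "disjoint {Q \<in> S. depth S Q = j}"
      unfolding disjoint_def by auto
    moreover have "{Q \<in> S. depth S Q = j} \<subseteq> S" "\<forall>Q\<in>{Q \<in> S. depth S Q = j}. Q \<subseteq> R"
      using R by auto
    ultimately have "(\<Sum>Q | Q \<in> S \<and> depth S Q = j. U Q) \<le> U R"
      by (intro superaddD[OF U R(1)])
    then show "(\<Sum>Q | Q \<in> S \<and> depth S Q = j. U Q) * k ^ j \<le> U R * k ^ j"
      using k by (intro mult_right_mono) auto
  qed
  also have "\<dots> = U R * ((1 - k ^ n) / (1 - k))"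
    using k by (simp add: sum_distrib_left[symmetric] sum_gp_strict)
  also have "\<dots> \<le> U R * (1 / (1 - k))"
    using k superadd_pos[OF U R(1)] by (intro mult_left_mono divide_right_mono) auto
  finally show ?thesis by simp
qed

text \<open>Exponential integrability of the counting function of a Carleson family: summation by parts
  bounds the sum by a constant plus half of itself.\<close>

lemma sum_depth_exponential:
  assumes S: "laminar S" and W: "superadd S W" and L: "carleson S W L" and R: "R \<in> S" "S \<subseteq> Pow R"
    and th: "1 < \<theta>" "L * (1 - 1 / \<theta>) \<le> 1 / 2" and L0: "0 \<le> L"
  shows "(\<Sum>Q\<in>S. W Q * \<theta> ^ depth S Q) \<le> 2 * L * W R"
proof -
  have fin: "finite S" by (rule laminar_finite[OF S])
  define T where "T = (\<Sum>Q\<in>S. W Q * \<theta> ^ depth S Q)"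
  have dec: "decreasing S (\<lambda>Q. \<theta> ^ depth S Q)"
    unfolding decreasing_def
  proof (intro conjI ballI impI)
    fix Q R assume "Q \<in> S" "R \<in> S" "Q \<subseteq> R"
    then have "depth S R \<le> depth S Q"
      using depth_less[OF S, of Q R] by (cases "Q = R") (auto simp: psubset_eq)
    then show "\<theta> ^ depth S R \<le> \<theta> ^ depth S Q" using th by (intro power_increasing) auto
  qed (use th in auto)
  \<comment> \<open>Below the top the parent has depth one less, so the increment is the fraction 1
    - 1/\<theta> of the value; at the top cube, where \<open>prev\<close> is 0, it is 1.\<close>
  have inc: "incr S (\<lambda>Q. \<theta> ^ depth S Q) Q \<le> (if Q = R then 1 else 0) + (1 - 1 / \<theta>) * \<theta> ^ depth S Q"
    if Q: "Q \<in> S" for Q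
  proof (cases "above S Q = {}")
    case True
    then have "Q = R" using R Q by (auto simp: above_def)
    moreover have "depth S Q = 0" using True by (simp add: depth_def)
    ultimately show ?thesis using True th by (simp add: incr_def prev_def)
  next
    case False
    have "incr S (\<lambda>Q. \<theta> ^ depth S Q) Q = (1 - 1 / \<theta>) * \<theta> ^ depth S Q"
      using False th by (simp add: incr_def prev_def depth_Suc[OF S Q False] field_simps)
    then show ?thesis by simp
  qed
  have "T \<le> (\<Sum>Q\<in>S. incr S (\<lambda>Q. \<theta> ^ depth S Q) Q * (L * W Q))"
    unfolding T_def using L by (intro laminar_Abel[OF S dec]) (auto simp: carleson_def)
  also have "\<dots> \<le> (\<Sum>Q\<in>S. ((if Q = R then 1 else 0) + (1 - 1 / \<theta>) * \<theta> ^ depth S Q) * (L * W Q))"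
    using L0 superadd_pos[OF W]
    by (intro sum_mono mult_right_mono inc) (simp_all add: less_imp_le)
  also have "\<dots> = (\<Sum>Q\<in>S. (if Q = R then L * W Q else 0)) + (\<Sum>Q\<in>S. (L * (1 - 1 / \<theta>)) * (W Q * \<theta> ^ depth S Q))"
    unfolding sum.distrib[symmetric] by (intro sum.cong) (auto simp: algebra_simps)
  also have "\<dots> = L * W R + (L * (1 - 1 / \<theta>)) * T"
    using fin R by (simp add: T_def sum_distrib_left)
  also have "\<dots> \<le> L * W R + 1 / 2 * T"
    using th superadd_pos[OF W] unfolding T_def
    by (intro add_left_mono mult_right_mono sum_nonneg) (auto intro!: mult_nonneg_nonneg less_imp_le)
  finally show ?thesis unfolding T_def by simp
qed

text \<open>The base 1 / (1 - 1/(2L)) is the growth rate \<theta> for which L (1 - 1/\<theta>)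
  equals 1/2. The decay rate k is a negative power of \<theta>, mild enough that \<theta>^b1 k^(b2 +
  b3) = \<theta>^(b1 / (b2 + b3 + 1)) stays above 1. Only the exponents and L enter, not the
  family.\<close>

definition three_powers_const :: "real \<Rightarrow> real \<Rightarrow> real \<Rightarrow> real \<Rightarrow> real" where
  "three_powers_const b1 b2 b3 L =
     (let k = (1 / (1 - 1 / (2 * L))) powr (- (b1 / (b2 + b3 + 1)))
      in 3 * ((2 * L) powr b1 * (1 / (1 - k)) powr b2 * (1 / (1 - k)) powr b3))"

lemma three_powers_const_nonneg: "0 \<le> three_powers_const b1 b2 b3 L"
  by (simp add: three_powers_const_def Let_def)

text \<open>A Carleson function tolerates a weight growing exponentially with the depth, while a
  merely superadditive one asks for a decaying weight. The growth granted to \<open>W\<close> pays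
  for the decay imposed on \<open>U\<close> and \<open>V\<close>: the product of the three weights
  is at least 1, so they may be inserted, and every single sum is then controlled by the value at
  the top.\<close>

lemma sum_three_powers_top:
  fixes b1 b2 b3 L :: real
  assumes b: "0 < b1" "0 \<le> b2" "0 \<le> b3" "1 \<le> b1 + b2 + b3" and L: "1 \<le> L"
    and S: "laminar S" and R: "R \<in> S" "S \<subseteq> Pow R" and U: "superadd S U" and V: "superadd S V"
    and W: "superadd S W" and cl: "carleson S W L"
  shows "(\<Sum>Q\<in>S. W Q powr b1 * U Q powr b2 * V Q powr b3)
    \<le> three_powers_const b1 b2 b3 L * (W R powr b1 * U R powr b2 * V R powr b3)"
proof -
  define \<theta> where "\<theta> = 1 / (1 - 1 / (2 * L))"
  have th: "1 < \<theta>" "L * (1 - 1 / \<theta>) \<le> 1 / 2" using L by (auto simp: \<theta>_def field_simps)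
  define k where "k = \<theta> powr (- (b1 / (b2 + b3 + 1)))"
  have k: "0 < k" "k < 1" unfolding k_def using th b
    by (auto intro!: powr_less_one divide_pos_pos)
  have C_def: "three_powers_const b1 b2 b3 L = 3 * ((2 * L) powr b1 * (1 / (1 - k)) powr b2 * (1 / (1 - k)) powr b3)"
    unfolding three_powers_const_def Let_def k_def \<theta>_def ..
  define m where "m Q = depth S Q" for Q
  note pos = superadd_pos[OF U] superadd_pos[OF V] superadd_pos[OF W]
  have "(\<Sum>Q\<in>S. W Q powr b1 * U Q powr b2 * V Q powr b3)
    \<le> (\<Sum>Q\<in>S. (W Q * \<theta> ^ m Q) powr b1 * (U Q * k ^ m Q) powr b2 * (V Q * k ^ m Q) powr b3)"
  proof (rule sum_mono)
    fix Q assume Q: "Q \<in> S"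
    have t: "\<theta> ^ m Q = \<theta> powr m Q" using th by (simp add: powr_realpow)
    have kk: "k ^ m Q = \<theta> powr (- (b1 / (b2 + b3 + 1)) * m Q)"
      using k by (simp add: powr_realpow[symmetric] k_def powr_powr)
    have "(\<theta> ^ m Q) powr b1 * ((k ^ m Q) powr b2 * (k ^ m Q) powr b3)
      = \<theta> powr (m Q * b1 - (b1 / (b2 + b3 + 1)) * m Q * (b2 + b3))"
      unfolding t kk powr_powr powr_add[symmetric] by (simp add: algebra_simps add_divide_distrib)
    also have "m Q * b1 - (b1 / (b2 + b3 + 1)) * m Q * (b2 + b3) = m Q * (b1 / (b2 + b3 + 1))"
      using b by (simp add: field_simps)
    finally have ge: "1 \<le> (\<theta> ^ m Q) powr b1 * ((k ^ m Q) powr b2 * (k ^ m Q) powr b3)"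
      using th b by (auto intro!: ge_one_powr_ge_zero)
    have "(W Q powr b1 * U Q powr b2 * V Q powr b3) * 1 \<le> (W Q powr b1 * U Q powr b2 * V Q powr b3) *
        ((\<theta> ^ m Q) powr b1 * ((k ^ m Q) powr b2 * (k ^ m Q) powr b3))"
      by (intro mult_left_mono ge) auto
    also have "\<dots> = (W Q * \<theta> ^ m Q) powr b1 * (U Q * k ^ m Q) powr b2 * (V Q * k ^ m Q) powr b3"
      using pos[OF Q] th k by (simp add: powr_mult)
    finally show "W Q powr b1 * U Q powr b2 * V Q powr b3 \<le>
      (W Q * \<theta> ^ m Q) powr b1 * (U Q * k ^ m Q) powr b2 * (V Q * k ^ m Q) powr b3" by simp
  qed
  also have "\<dots> \<le> 3 * ((2 * L * W R) powr b1 * (U R / (1 - k)) powr b2 * (V R / (1 - k)) powr b3)"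
  proof (rule sum_powr_prod_le)
    show "finite S" by (rule laminar_finite[OF S])
    show "(\<Sum>Q\<in>S. W Q * \<theta> ^ m Q) \<le> 2 * L * W R"
      unfolding m_def using L by (intro sum_depth_exponential S W cl R th) auto
    show "(\<Sum>Q\<in>S. U Q * k ^ m Q) \<le> U R / (1 - k)" "(\<Sum>Q\<in>S. V Q * k ^ m Q) \<le> V R / (1 - k)"
      unfolding m_def by (intro sum_depth_geometric S U V R k)+
    fix Q assume "Q \<in> S"
    then show "0 \<le> W Q * \<theta> ^ m Q \<and> 0 \<le> U Q * k ^ m Q \<and> 0 \<le> V Q * k ^ m Q"
      using pos th k by (auto intro!: mult_nonneg_nonneg less_imp_le)
  qed (use b in auto)
  also have "\<dots> = three_powers_const b1 b2 b3 L * (W R powr b1 * U R powr b2 * V R powr b3)"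
    using pos[OF R(1)] L k by (simp add: C_def powr_mult powr_divide less_imp_le mult_ac)
  finally show ?thesis .
qed

lemma sum_three_powers:
  fixes b1 b2 b3 L :: real
  assumes b: "0 < b1" "0 \<le> b2" "0 \<le> b3" "1 \<le> b1 + b2 + b3" and L: "1 \<le> L"
    and S: "laminar S" and U: "superadd S U" and V: "superadd S V" and W: "superadd S W"
    and cl: "carleson S W L" and R: "R \<in> S"
  shows "(\<Sum>Q | Q \<in> S \<and> Q \<subseteq> R. W Q powr b1 * U Q powr b2 * V Q powr b3)
    \<le> three_powers_const b1 b2 b3 L * (W R powr b1 * U R powr b2 * V R powr b3)"
proof -
  have sub: "{Q \<in> S. Q \<subseteq> R} \<subseteq> S" by blast
  show ?thesis
    using R by (intro sum_three_powers_top b L laminar_subset[OF S sub] superadd_subset[OF _ sub] U V W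
        carleson_subset[OF cl sub W laminar_finite[OF S]]) auto
qed

section \<open>Estimates for sums over a laminar family\<close>

lemma sum_incr_powr_nonneg:
  assumes "laminar S" "superadd S U" "decreasing S f" "0 \<le> p"
  shows "0 \<le> (\<Sum>Q\<in>S. incr S (\<lambda>Q. f Q powr p) Q * U Q)"
  using assms superadd_pos[OF assms(2)]
  by (intro sum_nonneg mult_nonneg_nonneg incr_nonneg decreasing_powr) (auto intro: less_imp_le)

text \<open>Telescope f(Q)^p over the ancestors R of Q and enlarge \<open>U Q\<close> to
  \<open>U R\<close>. A single term is thus bounded without a Carleson constant, in contrast to the
  sum of all terms.\<close>

lemma powr_mult_le_sum_incr:
  assumes S: "laminar S" and U: "superadd S U" and f: "decreasing S f" and p: "0 \<le> p" and Q: "Q \<in> S"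
  shows "f Q powr p * U Q \<le> (\<Sum>R\<in>S. incr S (\<lambda>Q. f Q powr p) R * U R)"
proof -
  have inc: "0 \<le> incr S (\<lambda>Q. f Q powr p) R" if "R \<in> S" for R
    by (intro incr_nonneg S decreasing_powr f p that)
  have "f Q powr p * U Q = (\<Sum>R | R \<in> S \<and> Q \<subseteq> R. incr S (\<lambda>Q. f Q powr p) R * U Q)"
    by (simp only: sum_distrib_right[symmetric] sum_incr_above[OF S Q])
  also have "\<dots> \<le> (\<Sum>R | R \<in> S \<and> Q \<subseteq> R. incr S (\<lambda>Q. f Q powr p) R * U R)"
    using inc superadd_mono[OF U Q] by (intro sum_mono mult_left_mono) auto
  also have "\<dots> \<le> (\<Sum>R\<in>S. incr S (\<lambda>Q. f Q powr p) R * U R)"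
    using inc superadd_pos[OF U] laminar_finite[OF S]
    by (intro sum_mono2) (auto intro!: mult_nonneg_nonneg intro: less_imp_le)
  finally show ?thesis .
qed

text \<open>Abel summation against \<open>U\<close>: the Carleson condition is the bound on partial
  sums that it asks for.\<close>

lemma carleson_embedding:
  assumes S: "laminar S" and U: "superadd S U" and f: "decreasing S f" and p: "0 \<le> p"
    and B: "carleson S U B"
  shows "(\<Sum>Q\<in>S. f Q powr p * U Q) \<le> B * (\<Sum>R\<in>S. incr S (\<lambda>Q. f Q powr p) R * U R)"
proof -
  have "(\<Sum>Q\<in>S. U Q * f Q powr p) \<le> (\<Sum>R\<in>S. incr S (\<lambda>Q. f Q powr p) R * (B * U R))"
    using B by (intro laminar_Abel S decreasing_powr f p) (auto simp: carleson_def)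
  then show ?thesis by (simp add: sum_distrib_left mult_ac)
qed

text \<open>By superadditivity of powers (incr g)^d is at most the increment of g^d, so the g-factor
  is summable with exponent 1/d at no cost. Only the missing exponent e = 1 - 1/d is taken from the
  Carleson embedding of f, which costs B^e. The surplus 1/p - e is spent on the bound of a single
  term by X.\<close>

lemma sum_incr_term:
  fixes p d :: real
  assumes S: "laminar S" and U: "superadd S U" and V: "superadd S V"
    and f: "decreasing S f" and g: "decreasing S g"
    and p: "1 \<le> p" and d: "1 \<le> d" and pd: "1 \<le> 1 / p + 1 / d"
    and B: "carleson S U B" "0 \<le> B"
    and X: "(\<Sum>Q\<in>S. incr S (\<lambda>Q. f Q powr p) Q * U Q) \<le> X"
    and Y: "(\<Sum>Q\<in>S. incr S (\<lambda>Q. g Q powr d) Q * V Q) \<le> Y"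
  shows "(\<Sum>Q\<in>S. U Q powr (1 / p) * V Q powr (1 / d) * f Q * incr S g Q)
    \<le> 3 * (B powr (1 - 1 / d) * (X powr (1 / p) * Y powr (1 / d)))"
proof -
  define e where "e = 1 - 1 / d"
  have e: "0 \<le> e" "e \<le> 1 / p" using d pd by (auto simp: e_def)
  define x where "x Q = f Q powr p * U Q" for Q
  define y where "y Q = incr S (\<lambda>Q. g Q powr d) Q * V Q" for Q
  have f0: "0 \<le> f Q" if "Q \<in> S" for Q using f that by (simp add: decreasing_def)
  have x0: "0 \<le> x Q" "x Q \<le> X" if "Q \<in> S" for Q
    unfolding x_def using superadd_pos[OF U that] powr_mult_le_sum_incr[OF S U f _ that, of p] p X by auto
  have y0: "0 \<le> y Q" if "Q \<in> S" for Q
    unfolding y_def using superadd_pos[OF V that] incr_nonneg[OF S decreasing_powr[OF g] that, of d] d by auto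
  have X0: "0 \<le> X" using sum_incr_powr_nonneg[OF S U f, of p] p X by simp
  have "(\<Sum>Q\<in>S. U Q powr (1 / p) * V Q powr (1 / d) * f Q * incr S g Q)
    \<le> (\<Sum>Q\<in>S. X powr (1 / p - e) * (x Q powr e * y Q powr (1 / d)))"
  proof (rule sum_mono)
    fix Q assume Q: "Q \<in> S"
    have 1: "f Q * U Q powr (1 / p) = x Q powr (1 / p)"
      unfolding x_def using superadd_pos[OF U Q] p f0[OF Q]
      by (simp add: powr_mult powr_powr)
    have ig: "0 \<le> incr S g Q" by (rule incr_nonneg[OF S g Q])
    have "incr S g Q powr d \<le> incr S (\<lambda>Q. g Q powr d) Q"
      unfolding incr_def using prev_bounds[OF S g Q] d
      by (subst prev_cong[of "\<lambda>z. z powr d"]) (auto intro!: powr_diff_superadd)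
    then have "incr S g Q powr d * V Q \<le> y Q"
      unfolding y_def using superadd_pos[OF V Q] by (intro mult_right_mono) auto
    then have "(incr S g Q powr d * V Q) powr (1 / d) \<le> y Q powr (1 / d)"
      using superadd_pos[OF V Q] d by (intro powr_mono2) auto
    moreover have "(incr S g Q powr d * V Q) powr (1 / d) = incr S g Q * V Q powr (1 / d)"
      using superadd_pos[OF V Q] d ig by (simp add: powr_mult powr_powr)
    ultimately have 2: "incr S g Q * V Q powr (1 / d) \<le> y Q powr (1 / d)" by simp
    have 3: "x Q powr (1 / p) \<le> X powr (1 / p - e) * x Q powr e"
    proof -
      have "x Q powr (1 / p) = x Q powr (1 / p - e) * x Q powr e" by (simp add: powr_add[symmetric])
      also have "\<dots> \<le> X powr (1 / p - e) * x Q powr e"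
        using x0[OF Q] e by (intro mult_right_mono powr_mono2) auto
      finally show ?thesis .
    qed
    have "U Q powr (1 / p) * V Q powr (1 / d) * f Q * incr S g Q
      = (f Q * U Q powr (1 / p)) * (incr S g Q * V Q powr (1 / d))" by simp
    also have "\<dots> \<le> (X powr (1 / p - e) * x Q powr e) * y Q powr (1 / d)"
      unfolding 1 using 2 3 ig by (intro mult_mono) auto
    finally show "U Q powr (1 / p) * V Q powr (1 / d) * f Q * incr S g Q
      \<le> X powr (1 / p - e) * (x Q powr e * y Q powr (1 / d))" by (simp add: mult.assoc)
  qed
  also have "\<dots> \<le> X powr (1 / p - e) * (3 * ((B * X) powr e * Y powr (1 / d)))"
    unfolding sum_distrib_left[symmetric]
  proof (intro mult_left_mono sum_powr_prod_le2)
    show "finite S" by (rule laminar_finite[OF S])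
    have "(\<Sum>Q\<in>S. x Q) \<le> B * (\<Sum>R\<in>S. incr S (\<lambda>Q. f Q powr p) R * U R)"
      unfolding x_def using p by (intro carleson_embedding S U f B) auto
    also have "\<dots> \<le> B * X" using B X by (intro mult_left_mono)
    finally show "(\<Sum>Q\<in>S. x Q) \<le> B * X" .
    show "(\<Sum>Q\<in>S. y Q) \<le> Y" using Y by (simp add: y_def)
  qed (use x0 y0 e d in \<open>auto simp: e_def\<close>)
  also have "\<dots> = 3 * (B powr e * ((X powr (1 / p - e) * X powr e) * Y powr (1 / d)))"
    using X0 B by (simp add: powr_mult)
  also have "X powr (1 / p - e) * X powr e = X powr (1 / p)"
    by (simp add: powr_add[symmetric])
  finally show ?thesis by (simp add: e_def)
qed

text \<open>Discrete Leibniz rule: with primes for the values at the parent, fg - f'g' = f (g - g')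
  + g' (f - f'), and g' is at most g.\<close>

lemma incr_mult_le:
  assumes S: "laminar S" and f: "decreasing S f" and g: "decreasing S g" and Q: "Q \<in> S"
  shows "incr S (\<lambda>Q. f Q * g Q) Q \<le> f Q * incr S g Q + g Q * incr S f Q"
proof -
  note b = prev_bounds[OF S f Q] prev_bounds[OF S g Q]
  have "prev S g Q * (f Q - prev S f Q) \<le> g Q * (f Q - prev S f Q)"
    using b by (intro mult_right_mono) auto
  then show ?thesis by (simp add: incr_def prev_mult algebra_simps)
qed

lemma sum_piece_le:
  fixes p d :: real
  assumes S: "laminar S" and U: "superadd S U" and V: "superadd S V"
    and f: "decreasing S f" and g: "decreasing S g"
    and p: "1 \<le> p" and d: "1 \<le> d" and pd: "1 \<le> 1 / p + 1 / d"
    and BU: "carleson S U BU" "0 \<le> BU" and BV: "carleson S V BV" "0 \<le> BV"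
    and X: "(\<Sum>Q\<in>S. incr S (\<lambda>Q. f Q powr p) Q * U Q) \<le> X"
    and Y: "(\<Sum>Q\<in>S. incr S (\<lambda>Q. g Q powr d) Q * V Q) \<le> Y"
    and K: "carleson S (\<lambda>Q. U Q powr (1 / p) * V Q powr (1 / d)) K" "0 \<le> K"
  shows "(\<Sum>Q\<in>S. U Q powr (1 / p) * V Q powr (1 / d) * (f Q * g Q))
    \<le> 3 * K * ((BU powr (1 - 1 / d) + BV powr (1 - 1 / p)) * (X powr (1 / p) * Y powr (1 / d)))"
proof -
  let ?w = "\<lambda>Q. U Q powr (1 / p) * V Q powr (1 / d)"
  have "(\<Sum>Q\<in>S. ?w Q * (f Q * g Q)) \<le> (\<Sum>Q\<in>S. incr S (\<lambda>Q. f Q * g Q) Q * (K * ?w Q))"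
    using K by (intro laminar_Abel S decreasing_mult f g) (auto simp: carleson_def)
  also have "\<dots> \<le> (\<Sum>Q\<in>S. (f Q * incr S g Q + g Q * incr S f Q) * (K * ?w Q))"
    using K by (intro sum_mono mult_right_mono incr_mult_le S f g) auto
  also have "\<dots> = K * ((\<Sum>Q\<in>S. U Q powr (1 / p) * V Q powr (1 / d) * f Q * incr S g Q)
     + (\<Sum>Q\<in>S. V Q powr (1 / d) * U Q powr (1 / p) * g Q * incr S f Q))"
    by (simp add: sum_distrib_left sum.distrib[symmetric] algebra_simps)
  also have "\<dots> \<le> K * (3 * (BU powr (1 - 1 / d) * (X powr (1 / p) * Y powr (1 / d)))
     + 3 * (BV powr (1 - 1 / p) * (Y powr (1 / d) * X powr (1 / p))))"
    using pd by (intro mult_left_mono add_mono sum_incr_term S U V f g p d BU BV X Y K)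
      (auto simp: add.commute)
  finally show ?thesis by (simp add: algebra_simps)
qed

lemma sum_simple_le:
  fixes p d :: real
  assumes S: "laminar S" and U: "superadd S U" and V: "superadd S V"
    and f: "decreasing S f" and g: "decreasing S g"
    and p: "1 \<le> p" and d: "1 \<le> d" and pd: "1 \<le> 1 / p + 1 / d"
    and BU: "carleson S U BU" "0 \<le> BU" and BV: "carleson S V BV" "0 \<le> BV"
    and X: "(\<Sum>Q\<in>S. incr S (\<lambda>Q. f Q powr p) Q * U Q) \<le> X"
    and Y: "(\<Sum>Q\<in>S. incr S (\<lambda>Q. g Q powr d) Q * V Q) \<le> Y"
  shows "(\<Sum>Q\<in>S. U Q powr (1 / p) * V Q powr (1 / d) * (f Q * g Q))
    \<le> 3 * (BU powr (1 / p) * BV powr (1 / d) * (X powr (1 / p) * Y powr (1 / d)))"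
proof -
  have X0: "0 \<le> X" using sum_incr_powr_nonneg[OF S U f, of p] p X by simp
  have Y0: "0 \<le> Y" using sum_incr_powr_nonneg[OF S V g, of d] d Y by simp
  have "(\<Sum>Q\<in>S. U Q powr (1 / p) * V Q powr (1 / d) * (f Q * g Q))
    = (\<Sum>Q\<in>S. (f Q powr p * U Q) powr (1 / p) * (g Q powr d * V Q) powr (1 / d))"
    using superadd_pos[OF U] superadd_pos[OF V] f g p d
    by (intro sum.cong refl) (simp add: powr_mult powr_powr decreasing_def less_imp_le)
  also have "\<dots> \<le> 3 * ((BU * X) powr (1 / p) * (BV * Y) powr (1 / d))"
  proof (rule sum_powr_prod_le2)
    show "finite S" by (rule laminar_finite[OF S])
    have "(\<Sum>Q\<in>S. f Q powr p * U Q) \<le> BU * (\<Sum>R\<in>S. incr S (\<lambda>Q. f Q powr p) R * U R)"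
      using p by (intro carleson_embedding S U f BU) auto
    also have "\<dots> \<le> BU * X" using BU X by (intro mult_left_mono)
    finally show "(\<Sum>Q\<in>S. f Q powr p * U Q) \<le> BU * X" .
    have "(\<Sum>Q\<in>S. g Q powr d * V Q) \<le> BV * (\<Sum>R\<in>S. incr S (\<lambda>Q. g Q powr d) R * V R)"
      using d by (intro carleson_embedding S V g BV) auto
    also have "\<dots> \<le> BV * Y" using BV Y by (intro mult_left_mono)
    finally show "(\<Sum>Q\<in>S. g Q powr d * V Q) \<le> BV * Y" .
  qed (use superadd_pos[OF U] superadd_pos[OF V] p d pd in \<open>auto simp: less_imp_le\<close>)
  also have "\<dots> = 3 * (BU powr (1 / p) * BV powr (1 / d) * (X powr (1 / p) * Y powr (1 / d)))"
    using X0 Y0 BU BV by (simp add: powr_mult)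
  finally show ?thesis .
qed

section \<open>Splitting the family by the size of the A-quantity\<close>

lemma ex_small_exponent:
  fixes a \<beta> \<gamma> p d :: real
  assumes bg: "0 \<le> \<beta>" "0 \<le> \<gamma>" and p: "1 \<le> p" and d: "1 \<le> d"
    and pd: "1 < 1 / p + 1 / d \<or> (1 \<le> 1 / p + 1 / d \<and> a + \<beta> + \<gamma> \<le> 0)"
  obtains \<epsilon> where "0 < \<epsilon>" "\<epsilon> * \<beta> \<le> 1 / p" "\<epsilon> * \<gamma> \<le> 1 / d"
    "1 \<le> - (\<epsilon> * a) + (1 / p - \<epsilon> * \<beta>) + (1 / d - \<epsilon> * \<gamma>)"
proof -
  \<comment> \<open>The \<open>+ 1\<close> keeps the denominators positive when \<beta> or \<gamma>
    is 0. The extra bound in \<open>e1\<close> uses |a| so that a may have either sign.\<close>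
  define e0 where "e0 = min (1 / p / (\<beta> + 1)) (1 / d / (\<gamma> + 1))"
  define e1 where "e1 = (if 1 < 1 / p + 1 / d then min e0 ((1 / p + 1 / d - 1) / (\<bar>a\<bar> + \<beta> + \<gamma> + 1)) else e0)"
  have pos: "e1 > 0" unfolding e1_def e0_def using p d bg by auto
  have "e1 \<le> 1 / p / (\<beta> + 1)" "e1 \<le> 1 / d / (\<gamma> + 1)" by (auto simp: e1_def e0_def)
  then have le: "e1 * (\<beta> + 1) \<le> 1 / p" "e1 * (\<gamma> + 1) \<le> 1 / d"
    using bg pos_le_divide_eq[of "\<beta> + 1" e1 "1 / p"] pos_le_divide_eq[of "\<gamma> + 1" e1 "1 / d"]
    by linarith+
  have c: "1 \<le> - (e1 * a) + (1 / p - e1 * \<beta>) + (1 / d - e1 * \<gamma>)"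
  proof (cases "1 < 1 / p + 1 / d")
    case True
    then have "e1 \<le> (1 / p + 1 / d - 1) / (\<bar>a\<bar> + \<beta> + \<gamma> + 1)" by (simp add: e1_def)
    then have "e1 * (\<bar>a\<bar> + \<beta> + \<gamma> + 1) \<le> 1 / p + 1 / d - 1"
      using bg by (auto simp: pos_le_divide_eq)
    moreover have "e1 * (a + \<beta> + \<gamma>) \<le> e1 * (\<bar>a\<bar> + \<beta> + \<gamma> + 1)"
      using pos by (intro mult_left_mono) auto
    ultimately show ?thesis by (simp add: algebra_simps)
  next
    case False
    then have "1 \<le> 1 / p + 1 / d" "a + \<beta> + \<gamma> \<le> 0" using pd by auto
    moreover have "e1 * (a + \<beta> + \<gamma>) \<le> 0" using pos calculation by (simp add: mult_nonneg_nonpos)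
    ultimately show ?thesis by (simp add: algebra_simps)
  qed
  show thesis
    using that[OF pos _ _ c] le pos by (simp add: algebra_simps)
qed

text \<open>The factor \<open>(W\<^sup>a U\<^sup>\<beta> V\<^sup>\<gamma>)\<^sup>\<epsilon>\<close> is comparable to a constant, so it can be inserted to trade a bit of
  the powers of \<open>U\<close> and \<open>V\<close> for a positive power of \<open>W\<close>.\<close>

definition piece_const :: "real \<Rightarrow> real \<Rightarrow> real \<Rightarrow> real \<Rightarrow> real \<Rightarrow> real \<Rightarrow> real \<Rightarrow> real" where
  "piece_const \<epsilon> a \<beta> \<gamma> p d L =
     2 powr \<epsilon> * three_powers_const (- (\<epsilon> * a)) (1 / p - \<epsilon> * \<beta>) (1 / d - \<epsilon> * \<gamma>) L"

lemma piece_const_nonneg: "0 \<le> piece_const \<epsilon> a \<beta> \<gamma> p d L"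
  by (simp add: piece_const_def three_powers_const_nonneg)

text \<open>The two-sided bound is used once in each direction: the upper bound takes the
  \<epsilon>-th power out of the sum over Q, the lower bound at R puts it back and costs
  2^\<epsilon>. Since a < 0, the exponent -\<epsilon> a gained by \<open>W\<close> is
  positive.\<close>

lemma carleson_piece:
  fixes a \<beta> \<gamma> p d L :: real
  assumes a: "a < 0" and e: "0 < \<epsilon>" "\<epsilon> * \<beta> \<le> 1 / p" "\<epsilon> * \<gamma> \<le> 1 / d"
      "1 \<le> - (\<epsilon> * a) + (1 / p - \<epsilon> * \<beta>) + (1 / d - \<epsilon> * \<gamma>)"
    and L: "1 \<le> L"
    and S: "laminar S" and U: "superadd S U" and V: "superadd S V" and W: "superadd S W"
    and cl: "carleson S W L" and A: "0 < A"
    and lo: "\<And>Q. Q \<in> S \<Longrightarrow> A / 2 \<le> W Q powr a * U Q powr \<beta> * V Q powr \<gamma>"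
    and hi: "\<And>Q. Q \<in> S \<Longrightarrow> W Q powr a * U Q powr \<beta> * V Q powr \<gamma> \<le> A"
  shows "carleson S (\<lambda>Q. U Q powr (1 / p) * V Q powr (1 / d)) (piece_const \<epsilon> a \<beta> \<gamma> p d L)"
proof -
  define b1 b2 b3 where "b1 = - (\<epsilon> * a)" and "b2 = 1 / p - \<epsilon> * \<beta>" and "b3 = 1 / d - \<epsilon> * \<gamma>"
  have b: "0 < b1" "0 \<le> b2" "0 \<le> b3" "1 \<le> b1 + b2 + b3"
    using e a unfolding b1_def b2_def b3_def by (auto simp: mult_pos_neg)
  define C where "C = three_powers_const b1 b2 b3 L"
  have C: "0 \<le> C" by (simp add: C_def three_powers_const_nonneg)
  have K_def: "piece_const \<epsilon> a \<beta> \<gamma> p d L = 2 powr \<epsilon> * C"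
    by (simp add: piece_const_def C_def b1_def b2_def b3_def)
  show ?thesis
    unfolding K_def carleson_def
  proof
    fix R assume R: "R \<in> S"
    define N where "N Q = W Q powr a * U Q powr \<beta> * V Q powr \<gamma>" for Q
    define w where "w Q = U Q powr (1 / p) * V Q powr (1 / d)" for Q
    define z where "z Q = W Q powr b1 * U Q powr b2 * V Q powr b3" for Q
    have wz: "w Q = N Q powr \<epsilon> * z Q" if Q: "Q \<in> S" for Q
    proof -
      have pos: "0 < U Q" "0 < V Q" "0 < W Q" using superadd_pos U V W Q by blast+
      have "N Q powr \<epsilon> * z Q = (W Q powr (a * \<epsilon>) * W Q powr b1) * (U Q powr (\<beta> * \<epsilon>) * U Q powr b2)
          * (V Q powr (\<gamma> * \<epsilon>) * V Q powr b3)"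
        by (simp add: N_def z_def powr_mult powr_powr)
      also have "\<dots> = w Q"
        using pos by (simp add: powr_add[symmetric] b1_def b2_def b3_def w_def mult.commute)
      finally show ?thesis ..
    qed
    have "(\<Sum>Q | Q \<in> S \<and> Q \<subseteq> R. w Q) \<le> (\<Sum>Q | Q \<in> S \<and> Q \<subseteq> R. A powr \<epsilon> * z Q)"
    proof (rule sum_mono)
      fix Q assume "Q \<in> {Q. Q \<in> S \<and> Q \<subseteq> R}"
      then have Q: "Q \<in> S" by auto
      have "N Q \<ge> A / 2" "N Q \<le> A" using lo[OF Q] hi[OF Q] by (auto simp: N_def)
      then show "w Q \<le> A powr \<epsilon> * z Q"
        unfolding wz[OF Q] using A e by (intro mult_right_mono powr_mono2) (auto simp: z_def)
    qed
    also have "\<dots> \<le> A powr \<epsilon> * (C * z R)"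
      unfolding sum_distrib_left[symmetric] z_def C_def
      by (intro mult_left_mono sum_three_powers b L S U V W cl R) auto
    also have "\<dots> \<le> (2 * N R) powr \<epsilon> * (C * z R)"
      using lo[OF R] C A e by (intro mult_right_mono powr_mono2) (auto simp: N_def z_def)
    also have "\<dots> = 2 powr \<epsilon> * C * w R"
      unfolding wz[OF R] by (simp add: powr_mult N_def)
    finally show "(\<Sum>Q | Q \<in> S \<and> Q \<subseteq> R. U Q powr (1 / p) * V Q powr (1 / d))
      \<le> 2 powr \<epsilon> * C * (U R powr (1 / p) * V R powr (1 / d))" by (simp add: w_def)
  qed
qed

text \<open>Take the least n with A / 2^(n+1) < x; minimality gives the upper bound, and for n = 0
  it is the hypothesis.\<close>

lemma dyadic_scale:
  fixes x A :: real
  assumes "0 < x" "x \<le> A"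
  obtains j :: nat where "A / 2 ^ j / 2 \<le> x" "x \<le> A / 2 ^ j"
proof -
  have "\<exists>n. A / 2 ^ Suc n < x"
  proof -
    obtain n where "(1 / 2) ^ n < x / A"
      using real_arch_pow_inv[of "x / A" "1 / 2"] assms by auto
    then have "A / 2 ^ n < x" using assms by (simp add: field_simps power_one_over)
    moreover have "A / 2 ^ Suc n \<le> A / 2 ^ n" using assms by (intro divide_left_mono) auto
    ultimately show ?thesis by (intro exI[of _ n]) linarith
  qed
  define j where "j = (LEAST n. A / 2 ^ Suc n < x)"
  have 1: "A / 2 ^ Suc j < x" unfolding j_def by (rule LeastI_ex) fact
  have 2: "x \<le> A / 2 ^ j"
  proof (cases j)
    case 0
    then show ?thesis using assms by simp
  next
    case (Suc i)
    then have "\<not> A / 2 ^ Suc i < x" using not_less_Least[of i "\<lambda>n. A / 2 ^ Suc n < x"] j_def by auto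
    then show ?thesis using Suc by simp
  qed
  show thesis using 1 2 by (intro that[of j]) auto
qed

text \<open>Parents and maximal functions are recomputed inside each piece, which is why X and Y are
  to bound the increments of every subfamily. Piece number i contributes at most 2^(-i) times a
  fixed quantity, so all pieces together cost a factor 2. The summand 1 in the constant makes it
  strictly positive.\<close>

lemma sum_form_le:
  fixes a \<beta> \<gamma> p d \<rho> \<tau> L :: real
  assumes a: "a < 0" and e: "0 < \<epsilon>" "\<epsilon> * \<beta> \<le> 1 / p" "\<epsilon> * \<gamma> \<le> 1 / d"
      "1 \<le> - (\<epsilon> * a) + (1 / p - \<epsilon> * \<beta>) + (1 / d - \<epsilon> * \<gamma>)"
    and p: "1 \<le> p" and d: "1 \<le> d" and pd1: "1 \<le> 1 / p + 1 / d" and rt: "0 < \<rho>" "0 < \<tau>" and L: "1 \<le> L"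
    and S: "laminar S" and U: "superadd S U" and V: "superadd S V" and W: "superadd S W"
    and cl: "carleson S W L" and BU: "carleson S U BU" "0 \<le> BU" and BV: "carleson S V BV" "0 \<le> BV"
    and A: "0 < A" and hi: "\<And>Q. Q \<in> S \<Longrightarrow> W Q powr a * U Q powr \<beta> * V Q powr \<gamma> \<le> A"
    and H: "\<And>Q. Q \<in> S \<Longrightarrow> 0 \<le> H Q" and K: "\<And>Q. Q \<in> S \<Longrightarrow> 0 \<le> K Q"
    and X: "\<And>S'. S' \<subseteq> S \<Longrightarrow> (\<Sum>Q\<in>S'. incr S' (\<lambda>Q. smax S' H Q powr (\<rho> * p)) Q * U Q) \<le> X"
    and Y: "\<And>S'. S' \<subseteq> S \<Longrightarrow> (\<Sum>Q\<in>S'. incr S' (\<lambda>Q. smax S' K Q powr (\<tau> * d)) Q * V Q) \<le> Y"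
  shows "(\<Sum>Q\<in>S. W Q powr a * U Q powr \<beta> * V Q powr \<gamma> *
            (U Q powr (1 / p) * V Q powr (1 / d) * (H Q powr \<rho> * K Q powr \<tau>)))
      \<le> (1 + 6 * piece_const \<epsilon> a \<beta> \<gamma> p d L) * A
        * ((BU powr (1 - 1 / d) + BV powr (1 - 1 / p)) * (X powr (1 / p) * Y powr (1 / d)))"
proof -
  define K0 where "K0 = piece_const \<epsilon> a \<beta> \<gamma> p d L"
  have K0: "0 \<le> K0" by (simp add: K0_def piece_const_nonneg)
  define N where "N Q = W Q powr a * U Q powr \<beta> * V Q powr \<gamma>" for Q
  define w where "w Q = U Q powr (1 / p) * V Q powr (1 / d)" for Q
  define Z where "Z = (BU powr (1 - 1 / d) + BV powr (1 - 1 / p)) * (X powr (1 / p) * Y powr (1 / d))"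
  have Z0: "0 \<le> Z" by (simp add: Z_def)
  have fin: "finite S" by (rule laminar_finite[OF S])
  have "\<exists>j. A / 2 ^ j / 2 \<le> N Q \<and> N Q \<le> A / 2 ^ j" if Q: "Q \<in> S" for Q
  proof -
    have "0 < N Q" using superadd_pos[OF U Q] superadd_pos[OF V Q] superadd_pos[OF W Q] by (simp add: N_def)
    then show ?thesis using dyadic_scale[of "N Q" A] hi[OF Q] by (metis N_def)
  qed
  then obtain j where j: "\<And>Q. Q \<in> S \<Longrightarrow> A / 2 ^ j Q / 2 \<le> N Q \<and> N Q \<le> A / 2 ^ j Q" by metis
  define n where "n = Suc (Max (j ` S))"
  have jn: "j Q < n" if "Q \<in> S" for Q unfolding n_def using that fin by (simp add: less_Suc_eq_le)
  have piece: "(\<Sum>Q | Q \<in> S \<and> j Q = i. N Q * (w Q * (H Q powr \<rho> * K Q powr \<tau>)))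
      \<le> (1 / 2) ^ i * (3 * K0 * A * Z)" for i
  proof -
    define S' where "S' = {Q \<in> S. j Q = i}"
    have sub: "S' \<subseteq> S" by (auto simp: S'_def)
    note S1 = laminar_subset[OF S sub] and U1 = superadd_subset[OF U sub]
      and V1 = superadd_subset[OF V sub] and W1 = superadd_subset[OF W sub]
    have HK: "0 \<le> H Q \<and> 0 \<le> K Q" if "Q \<in> S'" for Q using H K that sub by auto
    have dec: "decreasing S' (smax S' H)" "decreasing S' (smax S' K)"
      using HK by (auto intro!: smax_decreasing S1)
    have "(\<Sum>Q\<in>S'. N Q * (w Q * (H Q powr \<rho> * K Q powr \<tau>)))
      \<le> (\<Sum>Q\<in>S'. A / 2 ^ i * (w Q * (smax S' H Q powr \<rho> * smax S' K Q powr \<tau>)))"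
    proof (intro sum_mono)
      fix Q assume Q: "Q \<in> S'"
      have "N Q \<le> A / 2 ^ i" using j[of Q] Q by (auto simp: S'_def)
      moreover have "H Q powr \<rho> \<le> smax S' H Q powr \<rho>" "K Q powr \<tau> \<le> smax S' K Q powr \<tau>"
        using smax_ge[OF S1 Q] HK[OF Q] rt by (auto intro!: powr_mono2)
      ultimately show "N Q * (w Q * (H Q powr \<rho> * K Q powr \<tau>))
        \<le> A / 2 ^ i * (w Q * (smax S' H Q powr \<rho> * smax S' K Q powr \<tau>))"
        using A by (intro mult_mono) (auto simp: w_def)
    qed
    also have "\<dots> = A / 2 ^ i * (\<Sum>Q\<in>S'. U Q powr (1 / p) * V Q powr (1 / d) *
        (smax S' H Q powr \<rho> * smax S' K Q powr \<tau>))"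
      by (simp add: sum_distrib_left w_def)
    also have "\<dots> \<le> A / 2 ^ i * (3 * K0 * Z)"
      unfolding Z_def
    proof (intro mult_left_mono sum_piece_le)
      show "decreasing S' (\<lambda>Q. smax S' H Q powr \<rho>)" "decreasing S' (\<lambda>Q. smax S' K Q powr \<tau>)"
        using rt dec by (auto intro: decreasing_powr)
      show "(\<Sum>Q\<in>S'. incr S' (\<lambda>Q. (smax S' H Q powr \<rho>) powr p) Q * U Q) \<le> X"
        "(\<Sum>Q\<in>S'. incr S' (\<lambda>Q. (smax S' K Q powr \<tau>) powr d) Q * V Q) \<le> Y"
        unfolding powr_powr using X[OF sub] Y[OF sub] by auto
      show "carleson S' U BU" "carleson S' V BV"
        by (intro carleson_subset[OF _ sub _ fin] BU BV U V)+
      have clW: "carleson S' W L" by (intro carleson_subset[OF _ sub _ fin] cl W)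
      have "\<forall>Q\<in>S'. A / 2 ^ i / 2 \<le> N Q \<and> N Q \<le> A / 2 ^ i" using j by (auto simp: S'_def)
      then show "carleson S' (\<lambda>Q. U Q powr (1 / p) * V Q powr (1 / d)) K0"
        using A unfolding N_def K0_def
        by (intro carleson_piece[OF a e L S1 U1 V1 W1 clW, of "A / 2 ^ i"]) auto
    qed (use S1 U1 V1 p d pd1 BU BV K0 A in auto)
    also have "\<dots> = (1 / 2) ^ i * (3 * K0 * A * Z)" by (simp add: power_one_over)
    finally show ?thesis by (simp add: S'_def)
  qed
  have "(\<Sum>Q\<in>S. N Q * (w Q * (H Q powr \<rho> * K Q powr \<tau>)))
    = (\<Sum>i<n. \<Sum>Q | Q \<in> S \<and> j Q = i. N Q * (w Q * (H Q powr \<rho> * K Q powr \<tau>)))"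
    using fin jn by (intro sum.group[symmetric]) auto
  also have "\<dots> \<le> (\<Sum>i<n. (1 / 2) ^ i * (3 * K0 * A * Z))" by (intro sum_mono piece)
  also have "\<dots> = (\<Sum>i<n. (1 / 2) ^ i) * (3 * K0 * A * Z)" by (simp add: sum_distrib_right)
  also have "\<dots> \<le> 2 * (3 * K0 * A * Z)"
    using K0 A Z0 by (intro mult_right_mono) (auto simp: sum_gp_strict)
  also have "\<dots> = 6 * K0 * A * Z" by simp
  also have "\<dots> \<le> (1 + 6 * K0) * A * Z" using A Z0 by (simp add: distrib_right)
  finally show ?thesis unfolding N_def w_def Z_def K0_def .
qed

lemma sum_form_simple_le:
  fixes a \<beta> \<gamma> p d \<rho> \<tau> :: real
  assumes p: "1 \<le> p" and d: "1 \<le> d" and rt: "0 < \<rho>" "0 < \<tau>" and pd: "1 \<le> 1 / p + 1 / d"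
    and S: "laminar S" and U: "superadd S U" and V: "superadd S V"
    and BU: "carleson S U BU" "0 \<le> BU" and BV: "carleson S V BV" "0 \<le> BV"
    and A: "0 < A" and hi: "\<And>Q. Q \<in> S \<Longrightarrow> W Q powr a * U Q powr \<beta> * V Q powr \<gamma> \<le> A"
    and H: "\<And>Q. Q \<in> S \<Longrightarrow> 0 \<le> H Q" and K: "\<And>Q. Q \<in> S \<Longrightarrow> 0 \<le> K Q"
    and X: "(\<Sum>Q\<in>S. incr S (\<lambda>Q. smax S H Q powr (\<rho> * p)) Q * U Q) \<le> X"
    and Y: "(\<Sum>Q\<in>S. incr S (\<lambda>Q. smax S K Q powr (\<tau> * d)) Q * V Q) \<le> Y"
  shows "(\<Sum>Q\<in>S. W Q powr a * U Q powr \<beta> * V Q powr \<gamma> *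
            (U Q powr (1 / p) * V Q powr (1 / d) * (H Q powr \<rho> * K Q powr \<tau>)))
      \<le> 3 * A * (BU powr (1 / p) * BV powr (1 / d) * (X powr (1 / p) * Y powr (1 / d)))"
proof -
  have dec: "decreasing S (smax S H)" "decreasing S (smax S K)"
    using H K by (auto intro!: smax_decreasing S)
  have "(\<Sum>Q\<in>S. W Q powr a * U Q powr \<beta> * V Q powr \<gamma> *
            (U Q powr (1 / p) * V Q powr (1 / d) * (H Q powr \<rho> * K Q powr \<tau>)))
    \<le> (\<Sum>Q\<in>S. A * (U Q powr (1 / p) * V Q powr (1 / d) * (smax S H Q powr \<rho> * smax S K Q powr \<tau>)))"
  proof (intro sum_mono mult_mono hi)
    fix Q assume Q: "Q \<in> S"
    show "H Q powr \<rho> \<le> smax S H Q powr \<rho>" "K Q powr \<tau> \<le> smax S K Q powr \<tau>"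
      using smax_ge[OF S Q] H[OF Q] K[OF Q] rt by (auto intro!: powr_mono2)
  qed (use A in auto)
  also have "\<dots> = A * (\<Sum>Q\<in>S. U Q powr (1 / p) * V Q powr (1 / d) * (smax S H Q powr \<rho> * smax S K Q powr \<tau>))"
    by (simp add: sum_distrib_left)
  also have "\<dots> \<le> A * (3 * (BU powr (1 / p) * BV powr (1 / d) * (X powr (1 / p) * Y powr (1 / d))))"
  proof (intro mult_left_mono sum_simple_le)
    show "decreasing S (\<lambda>Q. smax S H Q powr \<rho>)" "decreasing S (\<lambda>Q. smax S K Q powr \<tau>)"
      using rt dec by (auto intro: decreasing_powr)
    show "(\<Sum>Q\<in>S. incr S (\<lambda>Q. (smax S H Q powr \<rho>) powr p) Q * U Q) \<le> X"
      "(\<Sum>Q\<in>S. incr S (\<lambda>Q. (smax S K Q powr \<tau>) powr d) Q * V Q) \<le> Y"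
      unfolding powr_powr using X Y by auto
  qed (use assms in auto)
  finally show ?thesis by (simp add: mult_ac)
qed

section \<open>Cubes and dyadic lattices\<close>

lemma mem_cube: "x \<in> cube a l \<longleftrightarrow> (\<forall>i. a $ i \<le> x $ i \<and> x $ i < a $ i + l)"
  by (simp add: cube_def)

lemma sets_cube: "cube a l \<in> sets lebesgue"
proof -
  have "cube a l = (\<Inter>i\<in>UNIV. {x. a $ i \<le> x $ i} \<inter> {x. x $ i < a $ i + l})"
    by (auto simp: cube_def)
  also have "\<dots> \<in> sets borel"
    by (intro sets.finite_INT sets.Int borel_closed borel_open closed_Collect_le open_Collect_less
        continuous_intros) auto
  finally show ?thesis by (auto intro: lborelD)
qed

lemma emeasure_cube:
  fixes a :: "real ^ 'n"
  assumes "l > 0"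
  shows "0 < emeasure lebesgue (cube a l)" "emeasure lebesgue (cube a l) < \<infinity>"
proof -
  let ?b = "a + (\<chi> i. l)"
  have "box a ?b \<subseteq> cube a l" "cube a l \<subseteq> cbox a ?b"
    by (auto simp: mem_box_cart cube_def less_imp_le)
  moreover have "box a ?b \<in> sets lebesgue" "cbox a ?b \<in> sets lebesgue" by auto
  ultimately have *: "emeasure lebesgue (box a ?b) \<le> emeasure lebesgue (cube a l)"
    "emeasure lebesgue (cube a l) \<le> emeasure lebesgue (cbox a ?b)"
    using emeasure_mono sets_cube by blast+
  have ip: "(?b - a) \<bullet> b = l" if "b \<in> Basis" for b
    using that by (auto simp: Basis_vec_def inner_axis)
  have "emeasure lborel (box a ?b) = ennreal (\<Prod>b\<in>Basis. (?b - a) \<bullet> b)"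
  proof (rule emeasure_lborel_box)
    fix b :: "real ^ 'n" assume "b \<in> Basis"
    from ip[OF this] show "a \<bullet> b \<le> ?b \<bullet> b" using assms by (simp only: inner_diff_left)
  qed
  moreover have "(\<Prod>b\<in>Basis. (?b - a) \<bullet> b) > 0"
    using ip assms by (intro prod_pos) (simp only:)
  ultimately have "0 < emeasure lebesgue (box a ?b)" by simp
  then show "0 < emeasure lebesgue (cube a l)" using * by order
  have "emeasure lebesgue (cbox a ?b) < \<infinity>"
    using emeasure_lborel_cbox_finite[of a ?b] by simp
  then show "emeasure lebesgue (cube a l) < \<infinity>" using * by order
qed

lemma cubesE:
  assumes "Q \<in> cubes" obtains a l where "l > 0" "Q = cube a l"
  using assms by (auto simp: cubes_def)

lemma cubes_sets: "Q \<in> cubes \<Longrightarrow> Q \<in> sets lebesgue"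
  by (auto elim!: cubesE intro: sets_cube)

lemma cubes_emeasure:
  assumes "Q \<in> cubes"
  shows "0 < emeasure lebesgue Q" "emeasure lebesgue Q < \<infinity>"
  using assms emeasure_cube by (auto elim!: cubesE)

lemma cubes_nonempty: "Q \<in> cubes \<Longrightarrow> Q \<noteq> {}"
  using cubes_emeasure(1) by fastforce

text \<open>A half-open cube contains its corner a, which is its least point, and a + (l,...,l)
  distinguishes the side lengths. Since children are defined through some representation of the
  cube, its uniqueness is the basis of every induction over subdivisions.\<close>

lemma cube_inject:
  assumes "l > 0" "l' > 0" "cube a l = cube a' l'"
  shows "a = a' \<and> l = l'"
proof -
  have "a \<in> cube a l" "a' \<in> cube a' l'" using assms(1,2) by (auto simp: mem_cube)
  then have "a \<in> cube a' l'" "a' \<in> cube a l" by (simp_all only: assms(3))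
  then have aa: "a = a'" by (auto simp: mem_cube vec_eq_iff intro: antisym)
  have "\<not> l < l'" if "l > 0" "cube a l = cube a l'" for l l'
  proof
    assume "l < l'"
    then have "a + (\<chi> i. l) \<in> cube a l'" using that by (auto simp: mem_cube)
    then have "a + (\<chi> i. l) \<in> cube a l" using that by simp
    then show False by (simp add: mem_cube)
  qed
  then have "l = l'" using assms aa by (metis linorder_neqE)
  then show ?thesis using aa by simp
qed

lemma dyadic_childrenI:
  assumes "l > 0" "\<forall>i. e $ i \<in> {0, 1}"
  shows "cube (a + (l / 2) *\<^sub>R e) (l / 2) \<in> dyadic_children (cube a l)"
  using assms unfolding dyadic_children_def by blast

lemma dyadic_children_cubes: "P \<in> dyadic_children Q \<Longrightarrow> P \<in> cubes"
  unfolding dyadic_children_def cubes_def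
  by (auto intro!: exI[of _ "_ / 2"])

lemma dyadic_cubes: "P \<in> dyadic Q \<Longrightarrow> Q \<in> cubes \<Longrightarrow> P \<in> cubes"
  by (induction rule: dyadic.induct) (auto dest: dyadic_children_cubes)

lemma dyadic_trans: "P \<in> dyadic Q \<Longrightarrow> Q \<in> dyadic R \<Longrightarrow> P \<in> dyadic R"
  by (induction rule: dyadic.induct) (auto intro: dyadic.child)

text \<open>After k subdivisions all corners lie on the grid of mesh l / 2^k anchored at a; a child
  doubles the integer coordinates and adds 0 or 1.\<close>

lemma dyadic_grid:
  assumes "P \<in> dyadic (cube a l)" "l > 0"
  shows "\<exists>k (m :: 'n::finite \<Rightarrow> int). P = cube (\<chi> i. a $ i + l / 2 ^ k * m i) (l / 2 ^ k)"
  using assms(1)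
proof (induction rule: dyadic.induct)
  case self
  show ?case by (intro exI[of _ 0] exI[of _ "\<lambda>_. 0"]) (simp add: vec_eq_iff)
next
  case (child P P')
  then obtain k and m :: "'n::finite \<Rightarrow> int" where P: "P = cube (\<chi> i. a $ i + l / 2 ^ k * m i) (l / 2 ^ k)"
    by blast
  obtain b l' e where P': "P' = cube (b + (l' / 2) *\<^sub>R e) (l' / 2)" "l' > 0" "P = cube b l'"
     "\<forall>i. e $ i \<in> {0, 1}"
    using child(2) by (auto simp: dyadic_children_def)
  have bl: "b = (\<chi> i. a $ i + l / 2 ^ k * m i)" "l' = l / 2 ^ k"
    using cube_inject[of l' "l / 2 ^ k" b "\<chi> i. a $ i + l / 2 ^ k * m i"] P P' assms(2) by auto
  define m' where "m' i = 2 * m i + (if e $ i = 0 then 0 else 1)" for i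
  have "P' = cube (\<chi> i. a $ i + l / 2 ^ Suc k * m' i) (l / 2 ^ Suc k)"
  proof -
    have "b + (l' / 2) *\<^sub>R e = (\<chi> i. a $ i + l / 2 ^ Suc k * m' i)"
    proof -
      have "(b + (l' / 2) *\<^sub>R e) $ i = a $ i + l / 2 ^ Suc k * m' i" for i
        using P'(4)[rule_format, of i] by (auto simp: bl m'_def field_simps)
      then show ?thesis by (simp add: vec_eq_iff)
    qed
    moreover have "l' / 2 = l / 2 ^ Suc k" by (simp add: bl)
    ultimately show ?thesis unfolding P'(1) by (simp only:)
  qed
  then show ?case by blast
qed

text \<open>In units of the coarse mesh the cubes are [m, m+1) and [m'/c, (m'+1)/c) in each
  coordinate, with an integer c. A common point gives c m < m' + 1 and m' < c (m + 1); being
  inequalities between integers, they sharpen to c m \<le> m' and m' + 1 \<le> c (m + 1), which is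
  inclusion.\<close>

lemma grid_nested:
  fixes m m' :: "'n::finite \<Rightarrow> int"
  assumes l: "l > 0" and k: "k \<le> k'"
    and x: "x \<in> cube (\<chi> i. a $ i + l / 2 ^ k * m i) (l / 2 ^ k)"
      "x \<in> cube (\<chi> i. a $ i + l / 2 ^ k' * m' i) (l / 2 ^ k')"
  shows "cube (\<chi> i. a $ i + l / 2 ^ k' * m' i) (l / 2 ^ k') \<subseteq> cube (\<chi> i. a $ i + l / 2 ^ k * m i) (l / 2 ^ k)"
proof -
  define t where "t y i = (y $ i - a $ i) * 2 ^ k / l" for y :: "real ^ 'n" and i
  define c :: int where "c = 2 ^ (k' - k)"
  have c0: "c > 0" by (simp add: c_def)
  have ck: "2 ^ k' = 2 ^ k * real_of_int c"
    using k by (simp add: c_def power_add[symmetric])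
  have mem: "y \<in> cube (\<chi> i. a $ i + l / 2 ^ j * n i) (l / 2 ^ j) \<longleftrightarrow>
     (\<forall>i. n i \<le> (y $ i - a $ i) * 2 ^ j / l \<and> (y $ i - a $ i) * 2 ^ j / l < n i + 1)"
    for y j and n :: "'n::finite \<Rightarrow> int"
    using l by (simp add: mem_cube field_simps)
  have mem1: "y \<in> cube (\<chi> i. a $ i + l / 2 ^ k * m i) (l / 2 ^ k) \<longleftrightarrow> (\<forall>i. m i \<le> t y i \<and> t y i < m i + 1)" for y
    unfolding mem t_def ..
  have mem2: "y \<in> cube (\<chi> i. a $ i + l / 2 ^ k' * m' i) (l / 2 ^ k') \<longleftrightarrow>
     (\<forall>i. m' i \<le> c * t y i \<and> c * t y i < m' i + 1)" for y
  proof -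
    have "(y $ i - a $ i) * 2 ^ k' / l = c * t y i" for i by (simp add: t_def ck)
    then show ?thesis unfolding mem by simp
  qed
  show ?thesis
  proof
    fix y assume y: "y \<in> cube (\<chi> i. a $ i + l / 2 ^ k' * m' i) (l / 2 ^ k')"
    show "y \<in> cube (\<chi> i. a $ i + l / 2 ^ k * m i) (l / 2 ^ k)"
      unfolding mem1
    proof
      fix i
      have x1: "m i \<le> t x i" "t x i < m i + 1" and x2: "m' i \<le> c * t x i" "c * t x i < m' i + 1"
        using x unfolding mem1 mem2 by auto
      have "c * real_of_int (m i) \<le> c * t x i" using x1 c0 by (intro mult_left_mono) auto
      then have "real_of_int (c * m i) < real_of_int (m' i + 1)" using x2 by simp
      then have i1: "c * m i \<le> m' i" unfolding of_int_less_iff by simp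
      have "c * t x i < c * real_of_int (m i + 1)" using x1 c0 by (intro mult_strict_left_mono) auto
      then have "real_of_int (m' i) < real_of_int (c * (m i + 1))" using x2 by simp
      then have i2: "m' i + 1 \<le> c * (m i + 1)" unfolding of_int_less_iff by simp
      have y2: "m' i \<le> c * t y i" "c * t y i < m' i + 1" using y unfolding mem2 by auto
      have "real_of_int (c * m i) \<le> real_of_int (m' i)" "real_of_int (m' i + 1) \<le> real_of_int (c * (m i + 1))"
        using i1 i2 by (simp_all only: of_int_le_iff)
      then have "real_of_int c * m i \<le> real_of_int c * t y i" "real_of_int c * t y i < real_of_int c * (m i + 1)"
        using y2 by (simp_all only: of_int_mult of_int_add of_int_1)
      moreover have "0 < real_of_int c" using c0 by simp
      ultimately show "m i \<le> t y i \<and> t y i < m i + 1"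
        by (simp only: mult_le_cancel_left_pos mult_less_cancel_left_pos)
    qed
  qed
qed

lemma dyadic_lattice_nested:
  fixes Q Q' :: "(real ^ 'n) set"
  assumes D: "dyadic_lattice D" and Q: "Q \<in> D" "Q' \<in> D" and x: "x \<in> Q" "x \<in> Q'"
  shows "Q \<subseteq> Q' \<or> Q' \<subseteq> Q"
proof -
  obtain R where R: "R \<in> D" "Q \<in> dyadic R" "Q' \<in> dyadic R"
    using D Q unfolding dyadic_lattice_def by blast
  obtain a l where al: "l > 0" "R = cube a l"
    using D R(1) unfolding dyadic_lattice_def by (meson cubesE subsetD)
  obtain k and m :: "'n \<Rightarrow> int" where 1: "Q = cube (\<chi> i. a $ i + l / 2 ^ k * m i) (l / 2 ^ k)"
    using dyadic_grid R al by blast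
  obtain k' and m' :: "'n \<Rightarrow> int" where 2: "Q' = cube (\<chi> i. a $ i + l / 2 ^ k' * m' i) (l / 2 ^ k')"
    using dyadic_grid R al by blast
  show ?thesis
    using grid_nested[OF al(1), of k k' x a m m'] grid_nested[OF al(1), of k' k x a m' m] x
    unfolding 1 2 by linarith
qed

lemma dyadic_lattice_laminar:
  assumes D: "dyadic_lattice D" and S: "S \<subseteq> D" "finite S"
  shows "laminar S"
  unfolding laminar_def
proof (intro conjI ballI)
  have "D \<subseteq> cubes" using D by (simp add: dyadic_lattice_def)
  then show "{} \<notin> S" using S cubes_nonempty by blast
  fix Q R assume "Q \<in> S" "R \<in> S"
  then show "Q \<subseteq> R \<or> R \<subseteq> Q \<or> Q \<inter> R = {}"
    using dyadic_lattice_nested[OF D, of Q R] S by blast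
qed (use S in simp)

text \<open>Starting from the given cube, two successive doublings, the first to the right and the second
  to the left, extend it in every direction.\<close>

lemma ex_dyadic_lattice:
  fixes Q :: "(real ^ 'n) set"
  assumes "Q \<in> cubes"
  shows "\<exists>D. dyadic_lattice D \<and> Q \<in> D"
proof -
  obtain a l where l: "l > 0" and Q: "Q = cube a l" using assms by (rule cubesE)
  \<comment> \<open>The leftward doubling at stage j moves the lower corner by 2 * 4^j * l;
    \<open>t j\<close> is the sum of these shifts.\<close>
  define t where "t j = 2 * l * (4 ^ j - 1) / 3" for j :: nat
  define C where "C j = cube (a - (\<chi> i. t j)) (4 ^ j * l)" for j
  have step: "C j \<in> dyadic (C (Suc j))" for j
  proof -
    let ?b = "a - (\<chi> i. t (Suc j))"
    \<comment> \<open>Read downwards: the upper corner child undoes the doubling to the left, and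
      the lower corner child of that cube undoes the doubling to the right.\<close>
    have "cube (?b + (4 ^ Suc j * l / 2) *\<^sub>R (\<chi> i. 1)) (4 ^ Suc j * l / 2) \<in> dyadic_children (C (Suc j))"
      unfolding C_def using l by (intro dyadic_childrenI) auto
    moreover have "?b + (4 ^ Suc j * l / 2) *\<^sub>R (\<chi> i. 1) = a - (\<chi> i. t j)"
      by (simp add: vec_eq_iff t_def field_simps)
    ultimately have 1: "cube (a - (\<chi> i. t j)) (4 ^ Suc j * l / 2) \<in> dyadic_children (C (Suc j))"
      by (simp only:)
    have "cube (a - (\<chi> i. t j) + (4 ^ Suc j * l / 2 / 2) *\<^sub>R 0) (4 ^ Suc j * l / 2 / 2)
       \<in> dyadic_children (cube (a - (\<chi> i. t j)) (4 ^ Suc j * l / 2))"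
      using l by (intro dyadic_childrenI) auto
    moreover have "4 ^ Suc j * l / 2 / 2 = 4 ^ j * l" by simp
    ultimately have "C j \<in> dyadic_children (cube (a - (\<chi> i. t j)) (4 ^ Suc j * l / 2))"
      by (simp only: C_def scaleR_zero_right add_0_right)
    then show ?thesis using 1 by (meson dyadic.self dyadic.child)
  qed
  have mono: "C j \<in> dyadic (C k)" if "j \<le> k" for j k
    using that by (induction rule: dec_induct) (auto intro: dyadic.self dyadic_trans step)
  have Cc: "C j \<in> cubes" for j unfolding C_def cubes_def using l by force
  define D where "D = (\<Union>j. dyadic (C j))"
  have "dyadic_lattice D"
    unfolding dyadic_lattice_def
  proof (intro conjI ballI allI impI)
    show "D \<subseteq> cubes" using dyadic_cubes[OF _ Cc] by (auto simp: D_def)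
    fix P assume "P \<in> D"
    then obtain j where j: "P \<in> dyadic (C j)" by (auto simp: D_def)
    then show "dyadic P \<subseteq> D" using dyadic_trans by (auto simp: D_def)
    fix P' assume "P' \<in> D"
    then obtain j' where j': "P' \<in> dyadic (C j')" by (auto simp: D_def)
    have "C (max j j') \<in> D" by (auto simp: D_def intro: dyadic.self)
    moreover have "P \<in> dyadic (C (max j j'))" "P' \<in> dyadic (C (max j j'))"
      using dyadic_trans[OF j mono] dyadic_trans[OF j' mono] by auto
    ultimately show "\<exists>R\<in>D. P \<in> dyadic R \<and> P' \<in> dyadic R" by blast
  next
    fix K :: "(real ^ 'n) set" assume "compact K"
    then have "bounded ((\<lambda>x. x - a) ` K)" by (intro compact_imp_bounded compact_continuous_image continuous_intros)
    then obtain B where B: "\<And>x. x \<in> K \<Longrightarrow> norm (x - a) \<le> B" unfolding bounded_iff by blast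
    \<comment> \<open>To the right of a the cube extends by (4^j + 2) l / 3, about a third of its
      side; hence the factor 3.\<close>
    obtain j where j: "3 * (\<bar>B\<bar> + l) / l < 4 ^ j" using real_arch_pow[of 4] by auto
    then have j': "3 * (\<bar>B\<bar> + l) < 4 ^ j * l" using l by (simp add: field_simps)
    have "K \<subseteq> C j"
    proof
      fix x assume "x \<in> K"
      have t: "t j \<ge> \<bar>B\<bar>" "\<bar>B\<bar> < 4 ^ j * l - t j"
        using j' l by (auto simp: t_def field_simps)
      have "a $ i - t j \<le> x $ i \<and> x $ i < a $ i - t j + 4 ^ j * l" for i
        using component_le_norm_cart[of "x - a" i] B[OF \<open>x \<in> K\<close>] t
        by (simp only: vector_minus_component) linarith
      then show "x \<in> C j" unfolding C_def mem_cube by simp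
    qed
    moreover have "C j \<in> D" by (auto simp: D_def intro: dyadic.self)
    ultimately show "\<exists>Q\<in>D. K \<subseteq> Q" by blast
  qed
  moreover have "Q \<in> D"
  proof -
    have "C 0 = Q" by (simp add: C_def t_def Q zero_vec_def[symmetric])
    then show ?thesis unfolding D_def using dyadic.self by blast
  qed
  ultimately show ?thesis by blast
qed

lemma compact_subset_cube:
  fixes K :: "(real ^ 'n) set"
  assumes "compact K" shows "\<exists>Q\<in>cubes. K \<subseteq> Q"
proof -
  have "cube (0 :: real ^ 'n) 1 \<in> cubes" unfolding cubes_def using zero_less_one by blast
  then obtain D where D: "dyadic_lattice (D :: (real ^ 'n) set set)" using ex_dyadic_lattice by blast
  then obtain Q where "Q \<in> D" "K \<subseteq> Q" using assms unfolding dyadic_lattice_def by metis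
  moreover have "D \<subseteq> cubes" using D by (simp add: dyadic_lattice_def)
  ultimately show ?thesis by blast
qed

lemma singleton_sparse_families:
  fixes Q :: "(real ^ 'n) set"
  assumes "Q \<in> cubes" "0 < \<eta>" "\<eta> < 1"
  shows "{Q} \<in> sparse_families \<eta>"
proof -
  have "ennreal \<eta> * emeasure lebesgue Q \<le> 1 * emeasure lebesgue Q"
    using assms by (intro mult_right_mono) (auto simp: ennreal_le_1)
  then have "sparse_family \<eta> {Q}"
    unfolding sparse_family_def
    using cubes_sets[OF assms(1)] by (intro exI[of _ "\<lambda>_. Q"]) (auto simp: disjoint_family_on_def)
  then show ?thesis
    using ex_dyadic_lattice[OF assms(1)] by (auto simp: sparse_families_def)
qed

section \<open>Weights\<close>

abbreviation vol :: "(real ^ 'n) set \<Rightarrow> real" where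
  "vol Q \<equiv> enn2real (emeasure lebesgue Q)"

abbreviation rmass :: "(real ^ 'n \<Rightarrow> ennreal) \<Rightarrow> (real ^ 'n) set \<Rightarrow> real" where
  "rmass w Q \<equiv> enn2real (mass w Q)"

abbreviation avg :: "real \<Rightarrow> (real ^ 'n \<Rightarrow> real) \<Rightarrow> (real ^ 'n) set \<Rightarrow> ennreal" where
  "avg r f Q \<equiv> average r (\<lambda>x. \<bar>f x\<bar>) Q"

abbreviation pint :: "real \<Rightarrow> (real ^ 'n \<Rightarrow> real) \<Rightarrow> (real ^ 'n) set \<Rightarrow> ennreal" where
  "pint r f Q \<equiv> \<integral>\<^sup>+x\<in>Q. ennreal (\<bar>f x\<bar> powr r) \<partial>lebesgue"

section \<open>Powers on [0, \<infinity>], weights and their masses\<close>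

lemma epow_ennreal: "0 < x \<Longrightarrow> epow (ennreal x) a = ennreal (x powr a)"
  by (auto simp: epow_def)

lemma epow_ennreal_nonneg: "0 \<le> x \<Longrightarrow> 0 < a \<Longrightarrow> epow (ennreal x) a = ennreal (x powr a)"
  by (cases "x = 0") (auto simp: epow_def)

lemma epow_0_right [simp]: "epow x 0 = 1"
  by (simp add: epow_def)

lemma epow_1_left [simp]: "epow 1 a = 1"
  by (simp add: epow_def)

lemma epow_top: "0 < a \<Longrightarrow> epow \<infinity> a = \<infinity>" "0 < a \<Longrightarrow> epow top a = \<infinity>"
  by (simp_all add: epow_def)

lemma epow_mono:
  assumes "x \<le> y" "0 \<le> a" shows "epow x a \<le> epow y a"
proof (cases "a = 0 \<or> y = \<infinity>")
  case True
  then show ?thesis using assms epow_top by (cases "a = 0") auto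
next
  case False
  then obtain x' y' where "x = ennreal x'" "y = ennreal y'" "0 \<le> x'" "0 \<le> y'"
    using assms by (cases x; cases y) (auto simp: top_unique)
  then show ?thesis
    using False assms by (auto simp: epow_ennreal_nonneg intro!: ennreal_leI powr_mono2)
qed

lemma epow_ge_1: "1 \<le> x \<Longrightarrow> 0 \<le> a \<Longrightarrow> 1 \<le> epow x a"
  using epow_mono[of 1 x a] by simp

lemma epow_finite: "x < \<infinity> \<Longrightarrow> 0 \<le> a \<Longrightarrow> epow x a < \<infinity>"
  by (auto simp: epow_def)

lemma epow_pos: "0 < x \<Longrightarrow> 0 \<le> a \<Longrightarrow> 0 < epow x a"
  by (cases x) (auto simp: epow_def)

lemma epow_epow_inverse:
  assumes "0 < b" shows "epow (epow x b) (1 / b) = x"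
proof (cases x)
  case (real r)
  then show ?thesis using assms by (simp add: epow_ennreal_nonneg powr_powr)
qed (use assms in \<open>simp add: epow_top\<close>)

lemma epow_le_iff:
  assumes "0 < b" shows "epow x b \<le> c \<longleftrightarrow> x \<le> epow c (1 / b)"
proof
  assume "epow x b \<le> c"
  then have "epow (epow x b) (1 / b) \<le> epow c (1 / b)" using assms by (intro epow_mono) auto
  then show "x \<le> epow c (1 / b)" using assms by (simp add: epow_epow_inverse)
next
  assume "x \<le> epow c (1 / b)"
  then have "epow x b \<le> epow (epow c (1 / b)) b" using assms by (intro epow_mono) auto
  then show "epow x b \<le> c" using epow_epow_inverse[of "1 / b" c] assms by simp
qed

text \<open>A positive power is an order isomorphism of [0, \<infinity>], by the preceding
  equivalence, and so commutes with suprema.\<close>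

lemma epow_SUP:
  assumes "0 < b" shows "epow (SUP i. m i) b = (SUP i. epow (m i) b)"
proof (rule antisym)
  show "epow (SUP i. m i) b \<le> (SUP i. epow (m i) b)"
    unfolding epow_le_iff[OF assms]
    by (intro SUP_least, subst epow_le_iff[OF assms, symmetric]) (auto intro: SUP_upper)
  show "(SUP i. epow (m i) b) \<le> epow (SUP i. m i) b"
    using assms by (intro SUP_least epow_mono SUP_upper) auto
qed

lemma measurable_epow [measurable]:
  assumes [measurable]: "f \<in> borel_measurable M"
  shows "(\<lambda>x. epow (f x) a) \<in> borel_measurable M"
  unfolding epow_def by measurable

lemma weight_AE_finite:
  fixes w :: "real ^ 'n \<Rightarrow> ennreal"
  assumes "weight w" shows "AE x in lebesgue. w x < \<infinity>"
proof -
  have "AE x in lebesgue. w x * indicator (cball 0 (real n)) x \<noteq> \<infinity>" for n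
  proof (rule nn_integral_PInf_AE)
    show "(\<lambda>x. w x * indicator (cball 0 (real n)) x) \<in> borel_measurable lebesgue"
    proof -
      have [measurable]: "cball (0 :: real ^ 'n) (real n) \<in> sets lebesgue" by auto
      have [measurable]: "w \<in> borel_measurable lebesgue" using assms by (simp add: weight_def)
      show ?thesis by measurable
    qed
    show "(\<integral>\<^sup>+ x. w x * indicator (cball 0 (real n)) x \<partial>lebesgue) \<noteq> \<infinity>"
      using assms compact_cball unfolding weight_def by (metis less_irrefl)
  qed
  then have "AE x in lebesgue. \<forall>n. w x * indicator (cball 0 (real n)) x \<noteq> \<infinity>"
    by (simp add: AE_all_countable)
  then show ?thesis
  proof eventually_elim
    case (elim x)
    obtain n where "norm x \<le> real n" using real_arch_simple by blast
    then show ?case using elim[rule_format, of n] by (simp add: less_top)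
  qed
qed

text \<open>The A-constant controls masses of cubes; this passes from cubes to compact sets.\<close>

lemma weightI_cubes:
  fixes w :: "real ^ 'n \<Rightarrow> ennreal"
  assumes "w \<in> borel_measurable lebesgue" "\<And>Q. Q \<in> cubes \<Longrightarrow> mass w Q < \<infinity>"
  shows "weight w"
  unfolding weight_def
proof (intro conjI allI impI assms(1))
  fix K :: "(real ^ 'n) set" assume "compact K"
  then obtain Q where Q: "Q \<in> cubes" "K \<subseteq> Q" using compact_subset_cube by blast
  have "(\<integral>\<^sup>+x\<in>K. w x \<partial>lebesgue) \<le> mass w Q"
    unfolding mass_def using Q by (intro nn_integral_mono) (auto simp: indicator_def)
  then show "(\<integral>\<^sup>+x\<in>K. w x \<partial>lebesgue) < \<infinity>" using assms(2)[OF Q(1)] by order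
qed

lemma weight_mass_finite:
  fixes w :: "real ^ 'n \<Rightarrow> ennreal"
  assumes "weight w" "Q \<in> cubes" shows "mass w Q < \<infinity>"
proof -
  obtain a l where al: "l > 0" "Q = cube a l" using assms by (auto elim: cubesE)
  have sub: "Q \<subseteq> cbox a (a + (\<chi> i. l))" unfolding al by (auto simp: mem_box_cart cube_def less_imp_le)
  have "mass w Q \<le> (\<integral>\<^sup>+x\<in>cbox a (a + (\<chi> i. l)). w x \<partial>lebesgue)"
    unfolding mass_def using sub by (intro nn_integral_mono) (auto simp: indicator_def)
  also have "\<dots> < \<infinity>" using assms(1) compact_cbox unfolding weight_def by blast
  finally show ?thesis .
qed

lemma mass_pos:
  assumes "w \<in> borel_measurable lebesgue" "AE x in lebesgue. 0 < w x" "Q \<in> cubes"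
  shows "0 < mass w Q"
proof (rule ccontr)
  assume "\<not> 0 < mass w Q"
  then have "(\<integral>\<^sup>+x. w x * indicator Q x \<partial>lebesgue) = 0" by (simp add: mass_def)
  then have "AE x in lebesgue. w x * indicator Q x = 0"
    using assms(1) cubes_sets[OF assms(3)] by (subst (asm) nn_integral_0_iff_AE) auto
  then have "AE x in lebesgue. x \<notin> Q"
    using assms(2) by eventually_elim (auto simp: indicator_def split: if_splits)
  then have "emeasure lebesgue Q = 0"
    using cubes_sets[OF assms(3)] by (subst (asm) AE_iff_measurable[of Q]) auto
  then show False using cubes_emeasure[OF assms(3)] by simp
qed

lemma emeasure_density_mass:
  "w \<in> borel_measurable lebesgue \<Longrightarrow> Q \<in> sets lebesgue \<Longrightarrow> emeasure (density lebesgue w) Q = mass w Q"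
  by (simp add: emeasure_density mass_def)

text \<open>A non-positive power can vanish only at the value \<infinity>, which a weight takes on a
  null set.\<close>

lemma dual_weight_AE_pos:
  assumes "weight \<omega>" "\<kappa> \<le> 0" shows "AE x in lebesgue. 0 < epow (\<omega> x) \<kappa>"
  using weight_AE_finite[OF assms(1)]
proof eventually_elim
  case (elim x)
  then show ?case using assms(2) by (cases "\<omega> x") (auto simp: epow_def)
qed

lemma superadd_measure:
  assumes "finite S" "S \<subseteq> sets M" "\<And>Q. Q \<in> S \<Longrightarrow> 0 < emeasure M Q \<and> emeasure M Q < \<infinity>"
  shows "superadd S (measure M)"
  unfolding superadd_def
proof (intro conjI ballI allI impI)
  fix Q assume "Q \<in> S"
  then show "0 < measure M Q" using assms(3)[of Q] by (simp add: measure_def enn2real_positive_iff)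
next
  fix R D assume R: "R \<in> S" and D: "D \<subseteq> S" "disjoint D \<and> (\<forall>Q\<in>D. Q \<subseteq> R)"
  have "(\<Sum>Q\<in>D. measure M Q) = measure M (\<Union>Q\<in>D. Q)"
    using D assms finite_subset[OF D(1)]
    by (intro measure_finite_Union[symmetric]) (force simp: disjoint_def disjoint_family_on_def)+
  also have "\<dots> \<le> measure M R"
    using D R assms by (intro measure_mono_fmeasurable fmeasurableI) (auto intro!: sets.finite_UN finite_subset[OF D(1)])
  finally show "(\<Sum>Q\<in>D. measure M Q) \<le> measure M R" .
qed

definition doob_const :: "real \<Rightarrow> real" where
  "doob_const P = 2 * (P / (P - 1)) * (1 / (2 * (P / (P - 1)))) powr (1 - P)"

lemma doob_const_pos: "1 < P \<Longrightarrow> 0 < doob_const P"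
  by (simp add: doob_const_def)

text \<open>The exponent r / (r - p) is the one for which u^(1 - p/r) gives back the weight. The
  substitution h = |f|^r / u therefore turns the L^p norm of f into an L^(p/r) norm of h with
  respect to u.\<close>

lemma dual_weight_identity:
  fixes x r p :: real
  assumes rp: "0 < r" "r < p" and w: "0 < w" "w < \<infinity>" and x: "0 \<le> x"
  defines "u \<equiv> epow w (r / (r - p))"
  shows "0 < u" "u < \<infinity>" "u * ennreal (x powr r / enn2real u) = ennreal (x powr r)"
    "u * ennreal ((x powr r / enn2real u) powr (p / r)) = ennreal (x powr p) * w"
proof -
  obtain y where y: "w = ennreal y" "0 < y" using w by (cases w) auto
  define z where "z = y powr (r / (r - p))"
  have uz: "u = ennreal z" "0 < z" using y by (auto simp: u_def z_def epow_ennreal)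
  then show "0 < u" "u < \<infinity>" by auto
  show "u * ennreal (x powr r / enn2real u) = ennreal (x powr r)"
    using uz by (simp add: ennreal_mult[symmetric])
  have "z * (x powr r / z) powr (p / r) = x powr p * z powr (1 - p / r)"
    using uz rp x by (simp add: powr_divide powr_powr powr_diff)
  also have "z powr (1 - p / r) = y"
  proof -
    have "r / (r - p) * (1 - p / r) = 1" 
    proof -
      have "1 - p / r = (r - p) / r" using rp by (simp add: diff_divide_distrib)
      then show ?thesis using rp by simp
    qed
    then show ?thesis unfolding z_def powr_powr using y by (simp only: powr_one less_imp_le)
  qed
  finally show "u * ennreal ((x powr r / enn2real u) powr (p / r)) = ennreal (x powr p) * w"
    using uz y by (simp add: ennreal_mult[symmetric])
qed

text \<open>The average of h = |f|^r / u over Q with respect to u dx: almost everywhere u h = |f|^r,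
  so u h integrates to \<open>pint r f Q\<close>.\<close>

definition local_quotient :: "real \<Rightarrow> (real ^ 'n \<Rightarrow> ennreal) \<Rightarrow> (real ^ 'n \<Rightarrow> real) \<Rightarrow> (real ^ 'n) set \<Rightarrow> real" where
  "local_quotient r u f Q = enn2real (pint r f Q) / rmass u Q"

lemma local_quotient_nonneg: "0 \<le> local_quotient r u f Q"
  by (simp add: local_quotient_def)

lemma weighted_Doob:
  fixes \<omega> :: "real ^ 'n \<Rightarrow> ennreal" and f :: "real ^ 'n \<Rightarrow> real"
  assumes rp: "0 < r" "r < p" and om: "weight \<omega>"
    and u_def: "u = (\<lambda>x. epow (\<omega> x) (r / (r - p)))" and u: "weight u"
    and f: "f \<in> borel_measurable lebesgue"
    and X: "(\<integral>\<^sup>+x. ennreal (\<bar>f x\<bar> powr p) * \<omega> x \<partial>lebesgue) = ennreal X" "0 \<le> X"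
  defines "F \<equiv> \<lambda>Q. pint r f Q"
  shows "Q \<in> cubes \<Longrightarrow> F Q < \<infinity>"
    and "laminar S \<Longrightarrow> S \<subseteq> cubes \<Longrightarrow>
      (\<Sum>Q\<in>S. incr S (\<lambda>Q. smax S (local_quotient r u f) Q powr (p / r)) Q
        * rmass u Q) \<le> doob_const (p / r) * X"
proof -
  define M where "M = density lebesgue u"
  define h where "h x = \<bar>f x\<bar> powr r / enn2real (u x)" for x
  have P: "1 < p / r" using rp by simp
  have [measurable]: "u \<in> borel_measurable lebesgue" "\<omega> \<in> borel_measurable lebesgue"
    using u om by (auto simp: weight_def)
  note [measurable] = f
  have h0: "0 \<le> h x" for x by (simp add: h_def)
  have hm [measurable]: "h \<in> borel_measurable lebesgue" unfolding h_def by measurable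
  \<comment> \<open>At a zero of \<omega> the negative exponent makes u infinite, which happens only
    on a null set because u is a weight.\<close>
  have good: "AE x in lebesgue. 0 < \<omega> x \<and> \<omega> x < \<infinity>"
    using weight_AE_finite[OF om] weight_AE_finite[OF u]
  proof eventually_elim
    case (elim x)
    have k: "r / (r - p) \<noteq> 0" "\<not> 0 < r / (r - p)" using rp by (auto simp: zero_less_divide_iff)
    have "u x = \<infinity>" if "\<omega> x = 0" unfolding u_def epow_def using k that by (simp only: if_False if_True refl)
    then show ?case using elim by (auto simp: zero_less_iff_neq_zero)
  qed
  have eP: "(\<integral>\<^sup>+x. ennreal (h x powr (p / r)) \<partial>M) = ennreal X"
    unfolding M_def X(1)[symmetric]
    by (subst nn_integral_density, measurable, intro nn_integral_cong_AE, use good in eventually_elim)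
      (use rp in \<open>simp add: h_def u_def dual_weight_identity\<close>)
  have eQ: "(\<integral>\<^sup>+x. ennreal (indicator Q x * h x) \<partial>M) = F Q" if "Q \<in> cubes" for Q
  proof -
    have [measurable]: "Q \<in> sets lebesgue" by (rule cubes_sets[OF that])
    show ?thesis
      unfolding M_def F_def
      by (subst nn_integral_density, measurable, intro nn_integral_cong_AE, use good in eventually_elim)
        (use rp in \<open>auto simp: h_def u_def dual_weight_identity indicator_def\<close>)
  qed
  have mQ: "emeasure M Q = mass u Q" if "Q \<in> cubes" for Q
    unfolding M_def using cubes_sets[OF that] by (intro emeasure_density_mass) auto
  have pm: "0 < mass u Q" "mass u Q < \<infinity>" if "Q \<in> cubes" for Q
    using weight_mass_finite[OF u that] mass_pos[OF _ _ that, of u] dual_weight_AE_pos[OF om, of "r / (r - p)"] rp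
    unfolding u_def by (auto simp: divide_le_0_iff)
  show fin: "F Q < \<infinity>" if Q: "Q \<in> cubes" for Q
  proof -
    have [measurable]: "Q \<in> sets lebesgue" "Q \<in> sets M" using cubes_sets[OF Q] by (auto simp: M_def)
    \<comment> \<open>On Q, h is at most 1 or at most h^(p/r); this gives integrability of h over
      cubes.\<close>
    have "F Q \<le> (\<integral>\<^sup>+x. indicator Q x + ennreal (h x powr (p / r)) \<partial>M)"
      unfolding eQ[OF Q, symmetric]
    proof (intro nn_integral_mono)
      fix x
      show "ennreal (indicator Q x * h x) \<le> indicator Q x + ennreal (h x powr (p / r))"
      proof (cases "x \<in> Q \<and> 1 < h x")
        case True
        then have "h x powr 1 \<le> h x powr (p / r)" using P by (intro powr_mono) auto
        then show ?thesis using True by (auto simp: intro!: add_increasing ennreal_leI)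
      next
        case False
        then show ?thesis by (auto simp: indicator_def ennreal_le_1 intro!: add_increasing2)
      qed
    qed
    also have "\<dots> = mass u Q + ennreal X"
      using eP mQ[OF Q] by (subst nn_integral_add) (auto simp: M_def)
    also have "\<dots> < \<infinity>" using pm[OF Q] by (simp add: ennreal_add_less_top)
    finally show ?thesis .
  qed
  show "(\<Sum>Q\<in>S. incr S (\<lambda>Q. smax S (local_quotient r u f) Q powr (p / r)) Q
        * rmass u Q) \<le> doob_const (p / r) * X"
    if S: "laminar S" and Sc: "S \<subseteq> cubes"
  proof -
    have Hi: "(\<integral>x. indicator Q x * h x \<partial>M) = enn2real (F Q)" if "Q \<in> S" for Q
    proof -
      have [measurable]: "Q \<in> sets lebesgue" using cubes_sets Sc that by auto
      show ?thesis
        using eQ[of Q] that Sc h0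
        by (subst integral_eq_nn_integral) (auto simp: M_def)
    qed
    have mQ': "measure M Q = rmass u Q" if "Q \<in> S" for Q
      using mQ that Sc by (auto simp: measure_def)
    have iP: "integrable M (\<lambda>x. h x powr (p / r))"
      using eP by (intro integrableI_nonneg) (auto simp: M_def)
    have XP: "(\<integral>x. h x powr (p / r) \<partial>M) = X"
      using eP X(2) by (subst integral_eq_nn_integral) (auto simp: M_def)
    have sm: "smax S (\<lambda>Q. (\<integral>x. indicator Q x * h x \<partial>M) / measure M Q) = smax S (local_quotient r u f)"
      unfolding smax_def using Hi mQ'
      by (intro ext arg_cong[of _ _ Max] image_cong) (auto simp: local_quotient_def F_def)
    have "(\<Sum>Q\<in>S. incr S (\<lambda>Q. smax S (local_quotient r u f) Q powr (p / r)) Q * measure M Q)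
      \<le> 2 * (p / r / (p / r - 1)) * (1 / (2 * (p / r / (p / r - 1)))) powr (1 - p / r) * (\<integral>x. h x powr (p / r) \<partial>M)"
      unfolding sm[symmetric]
    proof (rule laminar_Doob[OF S _ _ h0 _ P iP])
      fix Q assume Q: "Q \<in> S"
      then have Qc: "Q \<in> cubes" using Sc by auto
      have [measurable]: "Q \<in> sets lebesgue" by (rule cubes_sets[OF Qc])
      show "Q \<in> sets M" by (simp add: M_def)
      show "0 < measure M Q" using pm[OF Qc] by (simp add: mQ'[OF Q] enn2real_positive_iff)
      show "integrable M (\<lambda>x. indicator Q x * h x)"
        using eQ[OF Qc] fin[OF Qc] h0 by (intro integrableI_nonneg) (auto simp: M_def)
    qed
    then show ?thesis using mQ' by (simp add: XP doob_const_def)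
  qed
qed

section \<open>Test functions and the \<open>A\<^sub>\<infinity>\<close> constant\<close>

lemma summable_on_ennreal: "(f :: 'a \<Rightarrow> ennreal) summable_on A"
  by (rule nonneg_summable_on_complete) simp

lemma sparse_form_mono:
  assumes "S' \<subseteq> S" shows "sparse_form r t \<alpha> S' f g \<le> sparse_form r t \<alpha> S f g"
  unfolding sparse_form_def using assms
  by (intro infsum_mono_neutral summable_on_ennreal) auto

text \<open>Reduces every upper estimate to finite subfamilies, the setting of
  \<open>laminar\<close>.\<close>

lemma sparse_form_le:
  assumes "\<And>F. finite F \<Longrightarrow> F \<subseteq> S \<Longrightarrow> sparse_form r t \<alpha> F f g \<le> c"
  shows "sparse_form r t \<alpha> S f g \<le> c"
  unfolding sparse_form_def
  by (rule infsum_le_finite_sums[OF summable_on_ennreal]) (use assms in \<open>simp add: sparse_form_def\<close>)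

lemma sparse_form_singleton:
  "sparse_form r t \<alpha> {Q} f g = avg r f Q * avg t g Q
               * epow (emeasure lebesgue Q) (1 + \<alpha>)"
  by (simp add: sparse_form_def)

text \<open>The truncation makes the mass finite before u is known to be locally integrable. For y =
  min(u, k) the norm is controlled by y^(p/r) \<omega> \<le> y, which follows from y \<le> u and
  u^(p/r - 1) \<omega> = 1.\<close>

lemma test_function:
  fixes \<omega> :: "real ^ 'n \<Rightarrow> ennreal"
  assumes rp: "0 < r" "r < p" and om: "weight \<omega>" and u_def: "u = (\<lambda>x. epow (\<omega> x) (r / (r - p)))"
    and Q: "Q \<in> cubes" and k: "0 < k"
  defines "m \<equiv> mass (\<lambda>x. min (u x) (ennreal k)) Q"
  shows "0 < m" "m < \<infinity>"
    "\<exists>f\<in>Lp (ereal p) \<omega>. Lp_norm (ereal p) \<omega> f \<le> epow m (1 / p) \<and>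
       avg r f Q = epow (m / emeasure lebesgue Q) (1 / r)"
proof -
  have [measurable]: "\<omega> \<in> borel_measurable lebesgue" "Q \<in> sets lebesgue"
    using om cubes_sets[OF Q] by (auto simp: weight_def)
  have [measurable]: "u \<in> borel_measurable lebesgue" unfolding u_def by measurable
  have \<kappa>: "r / (r - p) < 0" using rp by (simp add: divide_pos_neg)
  define y where "y x = enn2real (min (u x) (ennreal k))" for x
  have y: "ennreal (y x) = min (u x) (ennreal k)" "0 \<le> y x" for x
  proof -
    have "min (u x) (ennreal k) < top" by (simp add: min_less_iff_disj)
    then show "ennreal (y x) = min (u x) (ennreal k)" unfolding y_def by (rule ennreal_enn2real)
  qed (simp add: y_def)
  have [measurable]: "y \<in> borel_measurable lebesgue" unfolding y_def by measurable
  have "AE x in lebesgue. 0 < min (u x) (ennreal k)"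
    using dual_weight_AE_pos[OF om, of "r / (r - p)"] \<kappa> k unfolding u_def by auto
  then show m0: "0 < m" unfolding m_def by (intro mass_pos Q) auto
  have "m \<le> (\<integral>\<^sup>+x\<in>Q. ennreal k \<partial>lebesgue)"
    unfolding m_def mass_def by (intro nn_integral_mono mult_right_mono) auto
  also have "\<dots> < \<infinity>"
    using cubes_emeasure(2)[OF Q] by (simp add: nn_integral_cmult_indicator ennreal_mult_less_top)
  finally show m1: "m < \<infinity>" .
  define f where "f x = y x powr (1 / r) * indicator Q x" for x
  have fm [measurable]: "f \<in> borel_measurable lebesgue" unfolding f_def by measurable
  have f0: "\<bar>f x\<bar> powr b = y x powr (b / r) * indicator Q x" for x b
    using y(2)[of x] by (simp add: f_def indicator_def powr_powr)
  have "(\<integral>\<^sup>+x. ennreal (\<bar>f x\<bar> powr p) * \<omega> x \<partial>lebesgue) \<le> m"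
    unfolding m_def mass_def
  proof (intro nn_integral_mono_AE, use weight_AE_finite[OF om] in eventually_elim)
    fix x assume fin: "\<omega> x < \<infinity>"
    show "ennreal (\<bar>f x\<bar> powr p) * \<omega> x \<le> min (u x) (ennreal k) * indicator Q x"
    proof (cases "x \<in> Q \<and> \<omega> x \<noteq> 0")
      case False
      then show ?thesis by (auto simp: f0)
    next
      case True
      obtain z where z: "\<omega> x = ennreal z" "0 < z" using True fin by (cases "\<omega> x") auto
      define c where "c = z powr (r / (r - p))"
      have c: "u x = ennreal c" "0 < c" using z by (auto simp: u_def c_def epow_ennreal)
      have yc: "y x \<le> c" unfolding y_def c(1) using c k by (auto simp: min_def)
      have "y x powr (p / r) = y x powr (p / r - 1) * y x"
        using powr_mult_base[OF y(2)[of x], of "p / r - 1"] by (simp add: mult.commute)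
      also have "\<dots> \<le> c powr (p / r - 1) * y x"
        using yc y(2) rp by (intro mult_right_mono powr_mono2) auto
      also have "c powr (p / r - 1) = z powr (- 1)"
      proof -
        have "p / r - 1 = (p - r) / r" using rp by (simp add: diff_divide_distrib)
        then have "r / (r - p) * (p / r - 1) = - 1" using rp by (simp add: field_simps)
        then show ?thesis unfolding c_def powr_powr by (simp only:)
      qed
      finally have "y x powr (p / r) * z \<le> z powr (- 1) * y x * z"
        using z by (intro mult_right_mono) auto
      also have "\<dots> = y x" using z by (simp add: powr_minus field_simps)
      finally have "ennreal (y x powr (p / r) * z) \<le> ennreal (y x)" by (rule ennreal_leI)
      then show ?thesis using True z by (simp add: f0 y(1)[symmetric] ennreal_mult)
    qed
  qed
  then have norm: "Lp_norm (ereal p) \<omega> f \<le> epow m (1 / p)"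
    using rp by (auto simp: Lp_norm_def intro!: epow_mono)
  also have "\<dots> < \<infinity>" using m1 rp by (intro epow_finite) auto
  finally have "f \<in> Lp (ereal p) \<omega>" by (simp add: Lp_def)
  moreover have "avg r f Q = epow (m / emeasure lebesgue Q) (1 / r)"
  proof -
    have "(pint r f Q) = m"
      unfolding m_def mass_def
      using rp y by (intro nn_integral_cong) (auto simp: f0 indicator_def)
    then show ?thesis by (simp add: average_def)
  qed
  ultimately show "\<exists>f\<in>Lp (ereal p) \<omega>. Lp_norm (ereal p) \<omega> f \<le> epow m (1 / p) \<and>
       avg r f Q = epow (m / emeasure lebesgue Q) (1 / r)" using norm by blast
qed

text \<open>Monotone convergence. The levels start at 1 because the test functions ask for a
  positive level.\<close>

lemma SUP_mass_min:
  assumes "u \<in> borel_measurable lebesgue" "Q \<in> sets lebesgue"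
  shows "(SUP k. mass (\<lambda>x. min (u x) (ennreal (real (Suc k)))) Q) = mass u Q"
proof -
  note [measurable] = assms
  have "(SUP k. min z (ennreal (real (Suc k)))) = z" for z
  proof (rule antisym)
    show "z \<le> (SUP k. min z (ennreal (real (Suc k))))"
    proof (cases z)
      case (real x)
      obtain k where "x \<le> real k" using real_arch_simple by blast
      then have "ennreal x \<le> ennreal (real (Suc k))" by (intro ennreal_leI) auto
      then have "z \<le> min z (ennreal (real (Suc k)))" using real by (simp only: min.absorb1 order_refl)
      then show ?thesis by (rule SUP_upper2[OF UNIV_I])
    next
      case top
      have "top = (SUP k. of_nat k :: ennreal)" by (rule ennreal_SUP_of_nat_eq_top[symmetric])
      also have "\<dots> \<le> (SUP k. min z (ennreal (real (Suc k))))"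
      proof (rule SUP_mono)
        fix k :: nat
        have "(of_nat k :: ennreal) \<le> min z (ennreal (real (Suc k)))"
          unfolding top ennreal_of_nat_eq_real_of_nat by (auto intro: ennreal_leI)
        then show "\<exists>j\<in>UNIV. (of_nat k :: ennreal) \<le> min z (ennreal (real (Suc j)))" by blast
      qed
      finally show ?thesis using top by simp
    qed
  qed (auto intro: SUP_least)
  then have "mass u Q = (\<integral>\<^sup>+x. (SUP k. min (u x) (ennreal (real (Suc k))) * indicator Q x) \<partial>lebesgue)"
    unfolding mass_def by (simp add: SUP_mult_right_ennreal[symmetric])
  also have "\<dots> = (SUP k. \<integral>\<^sup>+x. min (u x) (ennreal (real (Suc k))) * indicator Q x \<partial>lebesgue)"
    by (intro nn_integral_monotone_convergence_SUP)
      (auto simp: incseq_def le_fun_def intro!: mult_right_mono min.mono ennreal_leI)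
  finally show ?thesis by (simp add: mass_def)
qed

text \<open>Counterpart for the exponent \<infinity>, where the indicator of Q is the test function.
  The quotient of equal volumes is left unsimplified to keep the shape m / |Q| of the finite case,
  with m = |Q|.\<close>

lemma test_function_infinity:
  fixes \<sigma> :: "real ^ 'n \<Rightarrow> ennreal"
  assumes [measurable]: "\<sigma> \<in> borel_measurable lebesgue" and Q: "Q \<in> cubes" and t: "0 < t"
  shows "\<exists>g\<in>Lp \<infinity> \<sigma>. Lp_norm \<infinity> \<sigma> g \<le> 1 \<and>
    avg t g Q = epow (emeasure lebesgue Q / emeasure lebesgue Q) (1 / t)"
proof -
  have [measurable]: "Q \<in> sets lebesgue" by (rule cubes_sets[OF Q])
  let ?g = "indicator Q :: real ^ 'n \<Rightarrow> real"
  have le: "Lp_norm \<infinity> \<sigma> ?g \<le> 1"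
    unfolding Lp_norm_def by (auto intro!: esssup_I simp: indicator_def)
  moreover have "?g \<in> Lp \<infinity> \<sigma>"
    using le by (auto simp: Lp_def intro: le_less_trans)
  moreover have "(pint t ?g Q) = (\<integral>\<^sup>+x. indicator Q x \<partial>lebesgue)"
    using t by (intro nn_integral_cong) (auto simp: indicator_def)
  then have "avg t ?g Q = epow (emeasure lebesgue Q / emeasure lebesgue Q) (1 / t)"
    by (simp add: average_def)
  ultimately show ?thesis by blast
qed

text \<open>The norms are moved to the left-hand side, and the suprema over the two independent
  truncation levels are taken afterwards, through positive powers. The exponents \<open>P1\<close>,
  \<open>P2\<close> and \<open>e1\<close>, \<open>e2\<close> are kept abstract so that q' =
  \<infinity>, with \<open>e2\<close> = 0, is included.\<close>

lemma test_value_le: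
  fixes Q :: "(real ^ 'n) set" and m1 m2 :: "nat \<Rightarrow> ennreal"
  assumes Q: "Q \<in> cubes" and rt: "0 < r" "0 < t"
    and m1: "\<And>k. 0 < m1 k" "\<And>k. m1 k < \<infinity>"
      "\<And>k. \<exists>f\<in>Lp P1 \<omega>. Lp_norm P1 \<omega> f \<le> epow (m1 k) e1 \<and>
         avg r f Q = epow (m1 k / emeasure lebesgue Q) (1 / r)"
    and m2: "\<And>k. 0 < m2 k" "\<And>k. m2 k < \<infinity>"
      "\<And>k. \<exists>g\<in>Lp P2 \<sigma>. Lp_norm P2 \<sigma> g \<le> epow (m2 k) e2 \<and>
         avg t g Q = epow (m2 k / emeasure lebesgue Q) (1 / t)"
    and N: "\<forall>f\<in>Lp P1 \<omega>. \<forall>g\<in>Lp P2 \<sigma>. sparse_form r t \<alpha> {Q} f g \<le> N * Lp_norm P1 \<omega> f * Lp_norm P2 \<sigma> g"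
    and e: "e1 < 1 / r" "e2 < 1 / t"
  shows "epow (emeasure lebesgue Q) (1 + \<alpha> - 1 / r - 1 / t) * epow (SUP k. m1 k) (1 / r - e1)
     * epow (SUP k. m2 k) (1 / t - e2) \<le> N"
proof -
  obtain w where w: "emeasure lebesgue Q = ennreal w" "0 < w"
    using cubes_emeasure[OF Q] by (cases "emeasure lebesgue Q") auto
  have kj: "epow (emeasure lebesgue Q) (1 + \<alpha> - 1 / r - 1 / t) * epow (m1 k) (1 / r - e1)
     * epow (m2 j) (1 / t - e2) \<le> N" for k j
  proof (cases N)
    case (real n)
    obtain x where x: "m1 k = ennreal x" "0 < x" using m1(1,2)[of k] by (cases "m1 k") auto
    obtain y where y: "m2 j = ennreal y" "0 < y" using m2(1,2)[of j] by (cases "m2 j") auto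
    obtain f where f: "f \<in> Lp P1 \<omega>" "Lp_norm P1 \<omega> f \<le> epow (m1 k) e1"
      "avg r f Q = epow (m1 k / emeasure lebesgue Q) (1 / r)" using m1(3) by blast
    obtain g where g: "g \<in> Lp P2 \<sigma>" "Lp_norm P2 \<sigma> g \<le> epow (m2 j) e2"
      "avg t g Q = epow (m2 j / emeasure lebesgue Q) (1 / t)" using m2(3) by blast
    have "sparse_form r t \<alpha> {Q} f g \<le> N * Lp_norm P1 \<omega> f * Lp_norm P2 \<sigma> g" using N f(1) g(1) by blast
    also have "\<dots> \<le> N * epow (m1 k) e1 * epow (m2 j) e2"
      using f(2) g(2) by (intro mult_mono) auto
    finally have *: "ennreal ((x / w) powr (1 / r) * (y / w) powr (1 / t) * w powr (1 + \<alpha>))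
       \<le> ennreal n * ennreal (x powr e1) * ennreal (y powr e2)"
      unfolding sparse_form_singleton f(3) g(3) x(1) y(1) w(1) real(2)
      using x(2) y(2) w(2) real(1) by (simp add: divide_ennreal epow_ennreal ennreal_mult)
    have le: "(x / w) powr (1 / r) * (y / w) powr (1 / t) * w powr (1 + \<alpha>) \<le> n * x powr e1 * y powr e2"
    proof -
      have "ennreal n * ennreal (x powr e1) * ennreal (y powr e2) = ennreal (n * x powr e1 * y powr e2)"
        using real(1) by (simp add: ennreal_mult)
      moreover have "0 \<le> n * x powr e1 * y powr e2" using real(1) by simp
      ultimately show ?thesis using * by (metis ennreal_le_iff)
    qed
    have "w powr (1 + \<alpha> - 1 / r - 1 / t) * x powr (1 / r - e1) * y powr (1 / t - e2)
       = (x / w) powr (1 / r) * (y / w) powr (1 / t) * w powr (1 + \<alpha>) / (x powr e1 * y powr e2)"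
      using x(2) y(2) w(2) by (simp add: powr_diff powr_divide mult_ac)
    also have "\<dots> \<le> n"
      using le x(2) y(2) by (subst pos_divide_le_eq) (auto simp: mult_ac)
    finally show ?thesis
      unfolding x(1) y(1) w(1) real(2) using x(2) y(2) w(2)
      by (simp add: epow_ennreal ennreal_mult[symmetric] ennreal_leI)
  qed simp
  have "epow (emeasure lebesgue Q) (1 + \<alpha> - 1 / r - 1 / t) * epow (SUP k. m1 k) (1 / r - e1)
     * epow (SUP k. m2 k) (1 / t - e2)
    = (SUP j. SUP k. epow (emeasure lebesgue Q) (1 + \<alpha> - 1 / r - 1 / t) * epow (m1 k) (1 / r - e1)
     * epow (m2 j) (1 / t - e2))"
    using e by (simp add: epow_SUP SUP_mult_left_ennreal SUP_mult_right_ennreal)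
  also have "\<dots> \<le> N" by (intro SUP_least kj)
  finally show ?thesis .
qed

text \<open>On Q the maximal function of w restricted to Q is at least the average of w over
  Q.\<close>

lemma A_infty_const_ge_1:
  fixes w :: "real ^ 'n \<Rightarrow> ennreal"
  assumes Q: "Q \<in> cubes" and m: "0 < mass w Q" "mass w Q < \<infinity>"
  shows "1 \<le> A_infty_const w"
proof -
  have Qs: "Q \<in> sets lebesgue" by (rule cubes_sets[OF Q])
  note em = cubes_emeasure[OF Q]
  have ge: "mass w Q / emeasure lebesgue Q \<le> maximal_fun (\<lambda>x. w x * indicator Q x) x" if "x \<in> Q" for x
  proof -
    have "mass (\<lambda>x. w x * indicator Q x) Q = mass w Q"
      unfolding mass_def by (intro nn_integral_cong) (auto simp: indicator_def)
    then show ?thesis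
      unfolding maximal_fun_def using that Q by (metis (mono_tags, lifting) SUP_upper mem_Collect_eq)
  qed
  have "mass w Q = mass w Q / emeasure lebesgue Q * emeasure lebesgue Q"
    using em by (simp add: ennreal_divide_times ennreal_mult_divide_eq)
  also have "\<dots> = (\<integral>\<^sup>+x\<in>Q. (mass w Q / emeasure lebesgue Q) \<partial>lebesgue)"
    using Qs by (simp add: nn_integral_cmult_indicator)
  also have "\<dots> \<le> mass (maximal_fun (\<lambda>x. w x * indicator Q x)) Q"
    unfolding mass_def using ge[unfolded mass_def]
    by (intro nn_integral_mono) (auto simp: indicator_def)
  finally have "mass w Q / mass w Q \<le> mass (maximal_fun (\<lambda>x. w x * indicator Q x)) Q / mass w Q"
    by (rule divide_right_mono_ennreal)
  also have "\<dots> \<le> A_infty_const w" unfolding A_infty_const_def using Q by (rule SUP_upper)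
  finally show ?thesis using m by simp
qed

text \<open>Sparseness replaces |Q| by |E_Q| / \<eta>, and on E_Q the average of w over Q is below
  the maximal function of w restricted to R. The sets E_Q are disjoint, so the sum becomes one
  integral over R.\<close>

lemma sparse_carleson_maximal:
  fixes w :: "real ^ 'n \<Rightarrow> ennreal"
  assumes sp: "sparse_family \<eta> S" and eta: "0 < \<eta>" and F: "finite F" "F \<subseteq> S" "F \<subseteq> cubes"
    and R: "\<And>Q. Q \<in> F \<Longrightarrow> Q \<subseteq> R"
  shows "(\<Sum>Q\<in>F. mass w Q) \<le> ennreal (1 / \<eta>) * mass (maximal_fun (\<lambda>x. w x * indicator R x)) R"
proof -
  obtain E where E: "disjoint_family_on E S"
    "\<And>Q. Q \<in> S \<Longrightarrow> E Q \<subseteq> Q \<and> E Q \<in> sets lebesgue \<and> ennreal \<eta> * emeasure lebesgue Q \<le> emeasure lebesgue (E Q)"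
    using sp unfolding sparse_family_def by blast
  define c where "c Q = mass w Q / emeasure lebesgue Q" for Q
  have one: "ennreal (1 / \<eta>) * ennreal \<eta> = 1" using eta by (simp add: ennreal_mult[symmetric])
  have step: "mass w Q \<le> ennreal (1 / \<eta>) * (\<integral>\<^sup>+x. c Q * indicator (E Q) x \<partial>lebesgue)" if Q: "Q \<in> F" for Q
  proof -
    have QS: "Q \<in> S" and Qc: "Q \<in> cubes" using Q F by auto
    have "mass w Q = c Q * emeasure lebesgue Q"
      using cubes_emeasure[OF Qc] by (simp add: c_def ennreal_divide_times ennreal_mult_divide_eq)
    also have "\<dots> = (ennreal (1 / \<eta>) * ennreal \<eta>) * (c Q * emeasure lebesgue Q)" by (simp only: one mult_1)
    also have "\<dots> = ennreal (1 / \<eta>) * (c Q * (ennreal \<eta> * emeasure lebesgue Q))" by (simp only: mult_ac)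
    also have "\<dots> \<le> ennreal (1 / \<eta>) * (c Q * emeasure lebesgue (E Q))"
      using E(2)[OF QS] by (intro mult_left_mono) auto
    finally show ?thesis using E(2)[OF QS] by (simp add: nn_integral_cmult_indicator)
  qed
  have "(\<Sum>Q\<in>F. mass w Q) \<le> ennreal (1 / \<eta>) * (\<Sum>Q\<in>F. \<integral>\<^sup>+x. c Q * indicator (E Q) x \<partial>lebesgue)"
    unfolding sum_distrib_left by (intro sum_mono step)
  also have "(\<Sum>Q\<in>F. \<integral>\<^sup>+x. c Q * indicator (E Q) x \<partial>lebesgue) = (\<integral>\<^sup>+x. (\<Sum>Q\<in>F. c Q * indicator (E Q) x) \<partial>lebesgue)"
  proof (rule nn_integral_sum[symmetric])
    fix Q assume "Q \<in> F"
    then have [measurable]: "E Q \<in> sets lebesgue" using E(2) F by blast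
    show "(\<lambda>x. c Q * indicator (E Q) x) \<in> borel_measurable lebesgue" by measurable
  qed
  also have "\<dots> \<le> mass (maximal_fun (\<lambda>x. w x * indicator R x)) R"
    unfolding mass_def
  proof (rule nn_integral_mono)
    fix x
    show "(\<Sum>Q\<in>F. c Q * indicator (E Q) x) \<le> maximal_fun (\<lambda>x. w x * indicator R x) x * indicator R x"
    proof (cases "\<exists>Q\<in>F. x \<in> E Q")
      case False
      then have "(\<Sum>Q\<in>F. c Q * indicator (E Q) x) = 0" by (auto intro!: sum.neutral)
      then show ?thesis by simp
    next
      case True
      then obtain Q where Q: "Q \<in> F" "x \<in> E Q" by blast
      have QS: "Q \<in> S" and Qc: "Q \<in> cubes" using Q F by auto
      have xQ: "x \<in> Q" "Q \<subseteq> R" using E(2)[OF QS] Q R by auto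
      have "x \<notin> E Q'" if "Q' \<in> F - {Q}" for Q'
        using E(1) that Q F unfolding disjoint_family_on_def by blast
      then have "(\<Sum>Q\<in>F. c Q * indicator (E Q) x) = c Q"
        using Q F by (subst sum.remove[of F Q]) (auto intro!: sum.neutral)
      also have "c Q = mass (\<lambda>x. w x * indicator R x) Q / emeasure lebesgue Q"
        unfolding c_def mass_def using xQ(2) by (intro arg_cong2[of _ _ _ _ "(/)"] nn_integral_cong refl) (auto simp: indicator_def)
      also have "\<dots> \<le> maximal_fun (\<lambda>x. w x * indicator R x) x"
        unfolding maximal_fun_def using Qc xQ by (intro SUP_upper) auto
      finally show ?thesis using xQ by auto
    qed
  qed
  finally show ?thesis by (simp add: mult_left_mono)
qed

lemma maximal_le_A_infty:
  assumes R: "R \<in> cubes" and m: "0 < mass w R" "mass w R < \<infinity>"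
  shows "mass (maximal_fun (\<lambda>x. w x * indicator R x)) R \<le> A_infty_const w * mass w R"
proof -
  have "mass (maximal_fun (\<lambda>x. w x * indicator R x)) R / mass w R \<le> A_infty_const w"
    unfolding A_infty_const_def using R by (rule SUP_upper)
  then have "mass (maximal_fun (\<lambda>x. w x * indicator R x)) R / mass w R * mass w R \<le> A_infty_const w * mass w R"
    by (rule mult_right_mono) simp
  then show ?thesis using m by (simp add: ennreal_divide_times ennreal_mult_divide_eq)
qed

text \<open>The weighted estimate for the weight 1, whose maximal function is at most 1.\<close>

lemma sparse_carleson_measure:
  assumes sp: "sparse_family \<eta> S" and eta: "0 < \<eta>" and F: "finite F" "F \<subseteq> S" "F \<subseteq> cubes"
    and R: "R \<in> cubes" "\<And>Q. Q \<in> F \<Longrightarrow> Q \<subseteq> R"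
  shows "(\<Sum>Q\<in>F. emeasure lebesgue Q) \<le> ennreal (1 / \<eta>) * emeasure lebesgue R"
proof -
  have m1: "mass (\<lambda>x. 1) Q = emeasure lebesgue Q" if "Q \<in> cubes" for Q :: "(real ^ 'a) set"
    using cubes_sets[OF that] by (simp add: mass_def)
  have M1: "maximal_fun (\<lambda>x. 1 * indicator R x) x \<le> 1" for x
    unfolding maximal_fun_def
  proof (intro SUP_least)
    fix Q assume "Q \<in> {Q \<in> cubes. x \<in> Q}"
    then have Q: "Q \<in> cubes" by simp
    have "mass (\<lambda>x. 1 * indicator R x) Q \<le> mass (\<lambda>x. 1) Q"
      unfolding mass_def by (intro nn_integral_mono) (auto simp: indicator_def)
    also have "\<dots> = emeasure lebesgue Q" by (rule m1[OF Q])
    finally have "mass (\<lambda>x. 1 * indicator R x) Q / emeasure lebesgue Q \<le> emeasure lebesgue Q / emeasure lebesgue Q"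
      by (rule divide_right_mono_ennreal)
    then show "mass (\<lambda>x. 1 * indicator R x) Q / emeasure lebesgue Q \<le> 1"
      using cubes_emeasure[OF Q] by simp
  qed
  have "(\<Sum>Q\<in>F. emeasure lebesgue Q) = (\<Sum>Q\<in>F. mass (\<lambda>x. 1) Q)"
    using F m1 by (intro sum.cong) auto
  also have "\<dots> \<le> ennreal (1 / \<eta>) * mass (maximal_fun (\<lambda>x. 1 * indicator R x)) R"
    by (rule sparse_carleson_maximal[OF sp eta F R(2)])
  also have "mass (maximal_fun (\<lambda>x. 1 * indicator R x)) R \<le> mass (\<lambda>x. 1) R"
    unfolding mass_def by (intro nn_integral_mono mult_right_mono M1) auto
  also have "\<dots> = emeasure lebesgue R" by (rule m1[OF R(1)])
  finally show ?thesis by (simp add: mult_left_mono)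
qed

section \<open>From the sparse form to discrete sums\<close>

lemma superadd_mass:
  fixes u :: "real ^ 'n \<Rightarrow> ennreal"
  assumes F: "finite F" "F \<subseteq> cubes" and u: "weight u" and pos: "\<And>Q. Q \<in> F \<Longrightarrow> 0 < mass u Q"
  shows "superadd F (\<lambda>Q. rmass u Q)"
proof -
  let ?M = "density lebesgue u"
  have um: "u \<in> borel_measurable lebesgue" using u by (simp add: weight_def)
  have em: "emeasure ?M Q = mass u Q" if "Q \<in> F" for Q
    using that F cubes_sets by (intro emeasure_density_mass um) auto
  have "superadd F (measure ?M)"
    using F em pos weight_mass_finite[OF u]
    by (intro superadd_measure) (auto simp: subset_iff intro!: cubes_sets)
  moreover have "measure ?M Q = rmass u Q" if "Q \<in> F" for Q
    using em[OF that] by (simp add: measure_def)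
  moreover have "(\<Sum>Q\<in>D. measure ?M Q) = (\<Sum>Q\<in>D. rmass u Q)" if "D \<subseteq> F" for D
    using that em by (intro sum.cong) (auto simp: measure_def)
  ultimately show ?thesis unfolding superadd_def by simp
qed

lemma superadd_volume:
  assumes F: "finite F" "F \<subseteq> cubes"
  shows "superadd F (\<lambda>Q. vol Q)"
proof -
  have "superadd F (measure lebesgue)"
    by (intro superadd_measure) (use F cubes_sets cubes_emeasure in blast)+
  then show ?thesis by (simp only: measure_def[abs_def])
qed

lemma carleson_volume:
  assumes sp: "sparse_family \<eta> S" and eta: "0 < \<eta>" and F: "finite F" "F \<subseteq> S" "F \<subseteq> cubes"
  shows "carleson F (\<lambda>Q. vol Q) (1 / \<eta>)"
  unfolding carleson_def
proof
  fix R assume R: "R \<in> F"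
  have fin: "emeasure lebesgue Q < top" if "Q \<in> F" for Q using cubes_emeasure F that by fastforce
  have "(\<Sum>Q | Q \<in> F \<and> Q \<subseteq> R. emeasure lebesgue Q) \<le> ennreal (1 / \<eta>) * emeasure lebesgue R"
    using F R by (intro sparse_carleson_measure[OF sp eta]) auto
  moreover have "(\<Sum>Q | Q \<in> F \<and> Q \<subseteq> R. emeasure lebesgue Q)
      = ennreal (\<Sum>Q | Q \<in> F \<and> Q \<subseteq> R. vol Q)"
    using fin by (subst sum_ennreal[symmetric]) auto
  moreover have "ennreal (1 / \<eta>) * emeasure lebesgue R = ennreal (1 / \<eta> * vol R)"
    using fin[OF R] eta by (subst ennreal_mult) auto
  ultimately have "ennreal (\<Sum>Q | Q \<in> F \<and> Q \<subseteq> R. vol Q)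
      \<le> ennreal (1 / \<eta> * vol R)" by (simp only:)
  then show "(\<Sum>Q | Q \<in> F \<and> Q \<subseteq> R. vol Q) \<le> 1 / \<eta> * vol R"
    using eta by (subst (asm) ennreal_le_iff) auto
qed

lemma carleson_mass:
  fixes u :: "real ^ 'n \<Rightarrow> ennreal"
  assumes sp: "sparse_family \<eta> S" and eta: "0 < \<eta>" and F: "finite F" "F \<subseteq> S" "F \<subseteq> cubes"
    and u: "weight u" and pos: "\<And>Q. Q \<in> F \<Longrightarrow> 0 < mass u Q" and B: "A_infty_const u = ennreal B" "0 \<le> B"
  shows "carleson F (\<lambda>Q. rmass u Q) (1 / \<eta> * B)"
  unfolding carleson_def
proof
  fix R assume R: "R \<in> F"
  have fin: "mass u Q < top" if "Q \<in> F" for Q using weight_mass_finite[OF u] F that by fastforce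
  have "(\<Sum>Q | Q \<in> F \<and> Q \<subseteq> R. mass u Q) \<le> ennreal (1 / \<eta>) * mass (maximal_fun (\<lambda>x. u x * indicator R x)) R"
    using F R by (intro sparse_carleson_maximal[OF sp eta]) auto
  also have "\<dots> \<le> ennreal (1 / \<eta>) * (ennreal B * mass u R)"
    unfolding B(1)[symmetric] using R F fin pos by (intro mult_left_mono maximal_le_A_infty) auto
  also have "\<dots> = ennreal (1 / \<eta> * B * rmass u R)"
  proof -
    have "ennreal (1 / \<eta> * (B * rmass u R)) = ennreal (1 / \<eta>) * (ennreal B * mass u R)"
      using fin[OF R] eta B by (subst ennreal_mult, simp, simp, subst ennreal_mult) auto
    then show ?thesis by (simp only: mult.assoc)
  qed
  also have "(\<Sum>Q | Q \<in> F \<and> Q \<subseteq> R. mass u Q) = ennreal (\<Sum>Q | Q \<in> F \<and> Q \<subseteq> R. rmass u Q)"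
    using fin by (subst sum_ennreal[symmetric]) auto
  finally show "(\<Sum>Q | Q \<in> F \<and> Q \<subseteq> R. rmass u Q) \<le> 1 / \<eta> * B * rmass u R"
    using eta B by (subst (asm) ennreal_le_iff) auto
qed

text \<open>When the exponent \<open>e\<close> vanishes, the \<open>A\<^sub>\<infinity>\<close> constant may be infinite, and the
  cardinality of the finite family serves as a Carleson constant.\<close>

lemma carleson_mass_powr:
  fixes u :: "real ^ 'n \<Rightarrow> ennreal"
  assumes sp: "sparse_family \<eta> S" and eta: "0 < \<eta>" "\<eta> < 1" and F: "finite F" "F \<subseteq> S" "F \<subseteq> cubes"
    and u: "weight u" and pos: "\<And>Q. Q \<in> F \<Longrightarrow> 0 < mass u Q"
    and e: "0 \<le> e" "e \<le> 1" "0 < e \<Longrightarrow> A_infty_const u < \<infinity>" and ge1: "1 \<le> A_infty_const u"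
  shows "\<exists>B\<ge>0. carleson F (\<lambda>Q. rmass u Q) B
    \<and> ennreal (B powr e) \<le> ennreal (1 / \<eta>) * epow (A_infty_const u) e"
proof (cases "A_infty_const u")
  case (real B)
  \<comment> \<open>As e \<le> 1 \<le> 1/\<eta>, the power of 1/\<eta> is replaced by 1/\<eta>, so
    the final constant is free of e.\<close>
  have "(1 / \<eta>) powr e \<le> (1 / \<eta>) powr 1" using eta e by (intro powr_mono) auto
  then have "(1 / \<eta>) powr e * B powr e \<le> 1 / \<eta> * B powr e"
    by (intro mult_right_mono) (use eta in auto)
  moreover have "(1 / \<eta> * B) powr e = (1 / \<eta>) powr e * B powr e"
    using eta real by (intro powr_mult)
  ultimately have "(1 / \<eta> * B) powr e \<le> 1 / \<eta> * B powr e" by (simp only:)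
  moreover have "ennreal (1 / \<eta> * B powr e) = ennreal (1 / \<eta>) * epow (A_infty_const u) e"
  proof -
    have "B \<ge> 1" using ge1 real by (simp add: ennreal_1[symmetric] del: ennreal_1)
    then show ?thesis using real eta by (subst ennreal_mult) (auto simp: epow_ennreal)
  qed
  ultimately have "ennreal ((1 / \<eta> * B) powr e) \<le> ennreal (1 / \<eta>) * epow (A_infty_const u) e"
    by (metis ennreal_leI)
  moreover have "carleson F (\<lambda>Q. rmass u Q) (1 / \<eta> * B)"
    using real by (intro carleson_mass[OF sp eta(1) F u pos]) auto
  ultimately show ?thesis using eta real by (intro exI[of _ "1 / \<eta> * B"]) auto
next
  case top
  have "\<not> 0 < e"
  proof
    assume "0 < e"
    from e(3)[OF this] show False using top by simp
  qed
  then have e0: "e = 0" using e by linarith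
  note U = superadd_mass[OF F(1,3) u pos]
  have "carleson F (\<lambda>Q. rmass u Q) (real (card F))"
    unfolding carleson_def
  proof
    fix R assume R: "R \<in> F"
    have "(\<Sum>Q | Q \<in> F \<and> Q \<subseteq> R. rmass u Q) \<le> (\<Sum>Q | Q \<in> F \<and> Q \<subseteq> R. rmass u R)"
      using superadd_mono[OF U _ R] by (intro sum_mono) auto
    also have "\<dots> \<le> real (card F) * rmass u R"
      using F(1) by (simp add: card_mono mult_right_mono)
    finally show "(\<Sum>Q | Q \<in> F \<and> Q \<subseteq> R. rmass u Q) \<le> real (card F) * rmass u R" .
  qed
  moreover have "ennreal (real (card F) powr e) \<le> ennreal (1 / \<eta>) * epow (A_infty_const u) e"
  proof -
    \<comment> \<open>For e = 0 the power is 1, or 0 for the empty family; the cardinality leaves no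
      trace.\<close>
    have "real (card F) powr e \<le> 1 / \<eta>" using e0 eta by auto
    then show ?thesis using e0 by (simp add: ennreal_leI)
  qed
  ultimately show ?thesis by (intro exI[of _ "real (card F)"]) auto
qed

lemma average_eq:
  assumes Q: "Q \<in> cubes" and r: "0 < r" and fin: "(pint r f Q) < \<infinity>"
  shows "avg r f Q = ennreal ((enn2real (pint r f Q)
      / vol Q) powr (1 / r))"
proof -
  obtain w where w: "emeasure lebesgue Q = ennreal w" "0 < w"
    using cubes_emeasure[OF Q] by (cases "emeasure lebesgue Q") auto
  obtain y where y: "(pint r f Q) = ennreal y" "0 \<le> y"
    using fin by (cases "pint r f Q") auto
  show ?thesis
    unfolding average_def y(1) w(1) using y w r by (simp add: divide_ennreal epow_ennreal_nonneg)
qed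

lemma average_local_quotient:
  assumes Q: "Q \<in> cubes" and r: "0 < r" and fin: "(pint r f Q) < \<infinity>"
    and u: "0 < mass u Q" "mass u Q < \<infinity>"
  shows "avg r f Q = ennreal (vol Q powr (- (1 / r))
    * rmass u Q powr (1 / r) * local_quotient r u f Q powr (1 / r))"
proof -
  have "0 < rmass u Q" "0 < vol Q"
    using u cubes_emeasure[OF Q] by (auto simp: enn2real_positive_iff)
  then show ?thesis
    unfolding average_eq[OF Q r fin] local_quotient_def
    by (simp add: powr_divide powr_minus field_simps)
qed

text \<open>\<open>e1\<close> and \<open>e2\<close> are the parts of the exponents reserved for the
  embeddings, 1/p and 1/q' in the application; the complementary parts and the power of the volume
  make up the quantity bounded by [u,v].\<close>

lemma sparse_form_eq:
  assumes F: "finite F" "F \<subseteq> cubes" and rt: "0 < r" "0 < t"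
    and fin: "\<And>Q. Q \<in> cubes \<Longrightarrow> (pint r f Q) < \<infinity>"
      "\<And>Q. Q \<in> cubes \<Longrightarrow> (pint t g Q) < \<infinity>"
    and u: "\<And>Q. Q \<in> cubes \<Longrightarrow> 0 < mass u Q \<and> mass u Q < \<infinity>"
    and v: "\<And>Q. Q \<in> cubes \<Longrightarrow> 0 < mass v Q \<and> mass v Q < \<infinity>"
  shows "sparse_form r t \<alpha> F f g = ennreal (\<Sum>Q\<in>F. vol Q powr (1 + \<alpha> - 1 / r - 1 / t)
     * rmass u Q powr (1 / r - e1) * rmass v Q powr (1 / t - e2) *
      (rmass u Q powr e1 * rmass v Q powr e2 *
       (local_quotient r u f Q powr (1 / r) * local_quotient t v g Q powr (1 / t))))"
proof -
  have "sparse_form r t \<alpha> F f g = (\<Sum>Q\<in>F. ennreal (vol Q powr (1 + \<alpha> - 1 / r - 1 / t)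
     * rmass u Q powr (1 / r - e1) * rmass v Q powr (1 / t - e2) *
      (rmass u Q powr e1 * rmass v Q powr e2 *
       (local_quotient r u f Q powr (1 / r) * local_quotient t v g Q powr (1 / t)))))"
    unfolding sparse_form_def infsum_finite[OF F(1)]
  proof (rule sum.cong[OF refl])
    fix Q assume "Q \<in> F"
    then have Q: "Q \<in> cubes" using F by auto
    define w where "w = vol Q"
    have w: "emeasure lebesgue Q = ennreal w" "0 < w"
      using cubes_emeasure[OF Q] by (auto simp: w_def enn2real_positive_iff)
    have x: "0 < rmass u Q" "0 < rmass v Q"
      using u[OF Q] v[OF Q] by (auto simp: enn2real_positive_iff)
    note avg = average_local_quotient[OF Q rt(1) fin(1)[OF Q] conjunct1[OF u[OF Q]] conjunct2[OF u[OF Q]], folded w_def]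
      average_local_quotient[OF Q rt(2) fin(2)[OF Q] conjunct1[OF v[OF Q]] conjunct2[OF v[OF Q]], folded w_def]
    have vol: "epow (emeasure lebesgue Q) (1 + \<alpha>) = ennreal (w powr (1 + \<alpha>))"
      unfolding w(1) using w(2) by (rule epow_ennreal)
    have "avg r f Q * avg t g Q * epow (emeasure lebesgue Q) (1 + \<alpha>)
      = ennreal (w powr (- (1 / r)) * rmass u Q powr (1 / r) * local_quotient r u f Q powr (1 / r)
        * (w powr (- (1 / t)) * rmass v Q powr (1 / t) * local_quotient t v g Q powr (1 / t))
        * w powr (1 + \<alpha>))"
      unfolding avg vol by (simp add: ennreal_mult)
    also have "rmass u Q powr (1 / r) = rmass u Q powr (1 / r - e1) * rmass u Q powr e1"
      by (simp add: powr_add[symmetric])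
    also have "rmass v Q powr (1 / t) = rmass v Q powr (1 / t - e2) * rmass v Q powr e2"
      by (simp add: powr_add[symmetric])
    also have "w powr (- (1 / r)) * (rmass u Q powr (1 / r - e1) * rmass u Q powr e1) * local_quotient r u f Q powr (1 / r)
        * (w powr (- (1 / t)) * (rmass v Q powr (1 / t - e2) * rmass v Q powr e2) * local_quotient t v g Q powr (1 / t))
        * w powr (1 + \<alpha>)
       = (w powr (1 + \<alpha>) * w powr (- (1 / r)) * w powr (- (1 / t)))
         * (rmass u Q powr (1 / r - e1) * rmass u Q powr e1)
         * (rmass v Q powr (1 / t - e2) * rmass v Q powr e2)
         * (local_quotient r u f Q powr (1 / r) * local_quotient t v g Q powr (1 / t))"
      by (simp only: mult_ac)
    also have "w powr (1 + \<alpha>) * w powr (- (1 / r)) * w powr (- (1 / t)) = w powr (1 + \<alpha> - 1 / r - 1 / t)"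
      by (simp add: powr_add[symmetric])
    finally show "avg r f Q * avg t g Q * epow (emeasure lebesgue Q) (1 + \<alpha>)
      = ennreal (vol Q powr (1 + \<alpha> - 1 / r - 1 / t)
     * rmass u Q powr (1 / r - e1) * rmass v Q powr (1 / t - e2) *
      (rmass u Q powr e1 * rmass v Q powr e2 *
       (local_quotient r u f Q powr (1 / r) * local_quotient t v g Q powr (1 / t))))"
      by (simp add: w_def mult_ac)
  qed
  then show ?thesis by (simp add: sum_ennreal)
qed

lemma A_const_real:
  assumes A: "A_const a \<beta> \<gamma> u v = ennreal A" and Q: "Q \<in> cubes" and A0: "0 \<le> A"
    and u: "0 < mass u Q" "mass u Q < \<infinity>" and v: "0 < mass v Q" "mass v Q < \<infinity>"
  shows "vol Q powr a * rmass u Q powr \<beta> * rmass v Q powr \<gamma> \<le> A"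
proof -
  have *: "epow x b = ennreal (enn2real x powr b)" if "0 < x" "x < \<infinity>" for x b
    using that by (cases x) (auto simp: epow_ennreal)
  have "epow (emeasure lebesgue Q) a * epow (mass u Q) \<beta> * epow (mass v Q) \<gamma> \<le> ennreal A"
    unfolding A[symmetric] A_const_def using Q by (rule SUP_upper)
  then show ?thesis
    using *[OF cubes_emeasure[OF Q]] *[OF u] *[OF v] A0 by (simp add: ennreal_mult[symmetric])
qed

lemma Lp_norm_real:
  assumes p: "0 < p" and f: "f \<in> Lp (ereal p) \<omega>"
  obtains X where "0 \<le> X" "(\<integral>\<^sup>+x. ennreal (\<bar>f x\<bar> powr p) * \<omega> x \<partial>lebesgue) = ennreal X"
    "Lp_norm (ereal p) \<omega> f = ennreal (X powr (1 / p))"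
proof -
  have "epow (\<integral>\<^sup>+x. ennreal (\<bar>f x\<bar> powr p) * \<omega> x \<partial>lebesgue) (1 / p) < \<infinity>"
    using f by (simp add: Lp_def Lp_norm_def)
  then have "(\<integral>\<^sup>+x. ennreal (\<bar>f x\<bar> powr p) * \<omega> x \<partial>lebesgue) \<noteq> top" using epow_top(2)[of "1 / p"] p by auto
  then obtain X where X: "0 \<le> X" "(\<integral>\<^sup>+x. ennreal (\<bar>f x\<bar> powr p) * \<omega> x \<partial>lebesgue) = ennreal X"
    by (cases "\<integral>\<^sup>+x. ennreal (\<bar>f x\<bar> powr p) * \<omega> x \<partial>lebesgue") auto
  then show thesis using that p by (simp add: Lp_norm_def epow_ennreal_nonneg)
qed

lemma Doob_Lp:
  fixes \<omega> :: "real ^ 'n \<Rightarrow> ennreal" and f :: "real ^ 'n \<Rightarrow> real"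
  assumes rp: "0 < r" "r < p" and om: "weight \<omega>"
    and u_def: "u = (\<lambda>x. epow (\<omega> x) (r / (r - p)))" and u: "weight u" and f: "f \<in> Lp (ereal p) \<omega>"
  obtains X where "0 \<le> X" "Lp_norm (ereal p) \<omega> f = ennreal (X powr (1 / p))"
    "\<And>Q. Q \<in> cubes \<Longrightarrow> (pint r f Q) < \<infinity>"
    "\<And>S. laminar S \<Longrightarrow> S \<subseteq> cubes \<Longrightarrow>
      (\<Sum>Q\<in>S. incr S (\<lambda>Q. smax S (local_quotient r u f) Q powr (1 / r * p)) Q * rmass u Q)
        \<le> doob_const (p / r) * X"
proof -
  have fm: "f \<in> borel_measurable lebesgue" using f by (simp add: Lp_def)
  obtain X where X: "0 \<le> X" "(\<integral>\<^sup>+x. ennreal (\<bar>f x\<bar> powr p) * \<omega> x \<partial>lebesgue) = ennreal X"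
    "Lp_norm (ereal p) \<omega> f = ennreal (X powr (1 / p))"
    using Lp_norm_real[OF _ f] rp by auto
  have "1 / r * p = p / r" by simp
  then show thesis
    using weighted_Doob[OF rp om u_def u fm X(2,1)] X
    by (intro that[of X]) (simp_all only: local_quotient_def[abs_def])
qed

text \<open>The factor 1 + c dominates c^(1/p) for small and for large c.\<close>

lemma powr_inverse_mult:
  fixes c X :: real
  assumes "0 \<le> c" "0 \<le> X" "1 \<le> p"
  shows "(c * X) powr (1 / p) \<le> (1 + c) * X powr (1 / p)"
proof -
  have "c powr (1 / p) \<le> (1 + c) powr (1 / p)" using assms by (intro powr_mono2) auto
  also have "\<dots> \<le> (1 + c) powr 1" using assms by (intro powr_mono) auto
  finally have "c powr (1 / p) \<le> 1 + c" using assms by simp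
  then show ?thesis using assms by (simp add: powr_mult mult_right_mono)
qed

text \<open>The setting with finite exponents, where d stands for q' and t for s'. The data
  (\<omega>, u, p, r) and (\<sigma>, v, d, t) enter symmetrically, so every statement about one
  function serves both. \<open>A\<close> is the real value of [u,v].\<close>

locale dual_pair =
  fixes \<omega> \<sigma> u v :: "real ^ 'n \<Rightarrow> ennreal" and p d r t \<alpha> \<eta> A :: real and D S :: "(real ^ 'n) set set"
  assumes p: "1 \<le> p" and d: "1 \<le> d" and pd: "1 \<le> 1 / p + 1 / d" and rp: "0 < r" "r < p" and td: "0 < t" "t < d"
    and eta: "0 < \<eta>" "\<eta> < 1" and om: "weight \<omega>" and si: "weight \<sigma>"
    and u_def: "u = (\<lambda>x. epow (\<omega> x) (r / (r - p)))" and u: "weight u"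
    and v_def: "v = (\<lambda>x. epow (\<sigma> x) (t / (t - d)))" and v: "weight v"
    and D: "dyadic_lattice D" and S: "S \<subseteq> D" and sp: "sparse_family \<eta> S"
    and ge1: "1 \<le> A_infty_const u" "1 \<le> A_infty_const v"
    and A: "A_const (1 + \<alpha> - 1 / r - 1 / t) (1 / r - 1 / p) (1 / t - 1 / d) u v = ennreal A" "0 < A"
begin

abbreviation "a \<equiv> 1 + \<alpha> - 1 / r - 1 / t"
abbreviation "\<beta> \<equiv> 1 / r - 1 / p"
abbreviation "\<gamma> \<equiv> 1 / t - 1 / d"
abbreviation "W \<equiv> \<lambda>Q :: (real ^ 'n) set. vol Q"
abbreviation "U \<equiv> \<lambda>Q. rmass u Q"
abbreviation "V \<equiv> \<lambda>Q. rmass v Q"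
abbreviation "H \<equiv> local_quotient r u"
abbreviation "K \<equiv> local_quotient t v"
abbreviation "c1 \<equiv> doob_const (p / r)"
abbreviation "c2 \<equiv> doob_const (d / t)"

abbreviation summand :: "(real ^ 'n \<Rightarrow> real) \<Rightarrow> (real ^ 'n \<Rightarrow> real) \<Rightarrow> (real ^ 'n) set \<Rightarrow> real" where
  "summand f g Q \<equiv> W Q powr a * U Q powr \<beta> * V Q powr \<gamma> *
     (U Q powr (1 / p) * V Q powr (1 / d) * (H f Q powr (1 / r) * K g Q powr (1 / t)))"

text \<open>Everything that the discrete estimates ask of a finite subfamily. X and Y will be the
  p-th power of the norm of f and the d-th power of the norm of g, the same for all
  subfamilies.\<close>

definition controlled :: "(real ^ 'n \<Rightarrow> real) \<Rightarrow> (real ^ 'n \<Rightarrow> real) \<Rightarrow> real \<Rightarrow> real \<Rightarrow> (real ^ 'n) set set \<Rightarrow> bool" where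
  "controlled f g X Y F \<longleftrightarrow> finite F \<and> F \<subseteq> S \<and> laminar F \<and> F \<subseteq> cubes
     \<and> superadd F U \<and> superadd F V \<and> superadd F W \<and> carleson F W (1 / \<eta>)
     \<and> (\<forall>Q\<in>F. 0 < mass u Q \<and> 0 < mass v Q)
     \<and> (\<forall>Q\<in>F. W Q powr a * U Q powr \<beta> * V Q powr \<gamma> \<le> A)
     \<and> (\<Sum>Q\<in>F. incr F (\<lambda>Q. smax F (H f) Q powr (1 / r * p)) Q * U Q) \<le> c1 * X
     \<and> (\<Sum>Q\<in>F. incr F (\<lambda>Q. smax F (K g) Q powr (1 / t * d)) Q * V Q) \<le> c2 * Y
     \<and> sparse_form r t \<alpha> F f g = ennreal (\<Sum>Q\<in>F. summand f g Q)"

lemma const_pos: "0 < c1" "0 < c2"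
  using rp td by (auto intro!: doob_const_pos)

lemma ex_controlled:
  assumes f: "f \<in> Lp (ereal p) \<omega>" and g: "g \<in> Lp (ereal d) \<sigma>"
  obtains X Y where "Lp_norm (ereal p) \<omega> f = ennreal (X powr (1 / p))"
    "Lp_norm (ereal d) \<sigma> g = ennreal (Y powr (1 / d))" "0 \<le> X" "0 \<le> Y"
    "\<forall>F. finite F \<and> F \<subseteq> S \<longrightarrow> controlled f g X Y F"
proof -
  obtain X where X: "0 \<le> X" "Lp_norm (ereal p) \<omega> f = ennreal (X powr (1 / p))"
    "\<And>Q. Q \<in> cubes \<Longrightarrow> (pint r f Q) < \<infinity>"
    "\<And>S. laminar S \<Longrightarrow> S \<subseteq> cubes \<Longrightarrow>
      (\<Sum>Q\<in>S. incr S (\<lambda>Q. smax S (local_quotient r u f) Q powr (1 / r * p)) Q * rmass u Q)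
        \<le> doob_const (p / r) * X"
    using Doob_Lp[OF rp om u_def u f] by blast
  obtain Y where Y: "0 \<le> Y" "Lp_norm (ereal d) \<sigma> g = ennreal (Y powr (1 / d))"
    "\<And>Q. Q \<in> cubes \<Longrightarrow> (pint t g Q) < \<infinity>"
    "\<And>S. laminar S \<Longrightarrow> S \<subseteq> cubes \<Longrightarrow>
      (\<Sum>Q\<in>S. incr S (\<lambda>Q. smax S (local_quotient t v g) Q powr (1 / t * d)) Q * rmass v Q)
        \<le> doob_const (d / t) * Y"
    using Doob_Lp[OF td si v_def v g] by blast
  have "AE x in lebesgue. 0 < u x" "AE x in lebesgue. 0 < v x"
    unfolding u_def v_def using rp td
    by (auto intro!: dual_weight_AE_pos om si simp: divide_le_0_iff)
  then have mu: "0 < mass u Q \<and> mass u Q < \<infinity>" and mv: "0 < mass v Q \<and> mass v Q < \<infinity>" if "Q \<in> cubes" for Q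
    using that u v weight_mass_finite mass_pos by (auto simp: weight_def)
  have Dc: "D \<subseteq> cubes" using D by (simp add: dyadic_lattice_def)
  show thesis
  proof (rule that[OF X(2) Y(2) X(1) Y(1)], intro allI impI, elim conjE)
    fix F assume F: "finite F" "F \<subseteq> S"
    have Fc: "F \<subseteq> cubes" using F S Dc by auto
    have lam: "laminar F" using F S by (intro dyadic_lattice_laminar[OF D]) auto
    have pos: "0 < mass u Q" "0 < mass v Q" if "Q \<in> F" for Q using mu mv Fc that by auto
    show "controlled f g X Y F"
      unfolding controlled_def
    proof (intro conjI ballI)
      show "superadd F U" "superadd F V"
        by (intro superadd_mass F(1) Fc u v pos, assumption)+
      show "superadd F W" by (rule superadd_volume[OF F(1) Fc])
      show "carleson F W (1 / \<eta>)" by (rule carleson_volume[OF sp eta(1) F Fc])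
      show "sparse_form r t \<alpha> F f g = ennreal (\<Sum>Q\<in>F. summand f g Q)"
        by (rule sparse_form_eq[OF F(1) Fc rp(1) td(1) X(3) Y(3) mu mv])
      fix Q assume "Q \<in> F"
      then have "Q \<in> cubes" using Fc by auto
      then show "W Q powr a * U Q powr \<beta> * V Q powr \<gamma> \<le> A"
        using mu mv A(2) by (intro A_const_real[OF A(1)]) auto
    qed (use F lam Fc pos X(4)[OF lam Fc] Y(4)[OF lam Fc] in blast)+
  qed
qed

text \<open>\<open>M\<close> carries the Carleson constants and may depend on F; only its bound
  \<open>c * Z\<close> has to be uniform, since the supremum over F is taken at the end. The
  constants of the maximal theorem leave the powers as 1 + c1 and 1 + c2.\<close>

lemma sparse_form_transfer:
  assumes f: "f \<in> Lp (ereal p) \<omega>" and g: "g \<in> Lp (ereal d) \<sigma>" and c: "0 \<le> C0" "0 \<le> c"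
    and bound: "\<And>X Y F. 0 \<le> X \<Longrightarrow> 0 \<le> Y \<Longrightarrow> (\<And>F'. F' \<subseteq> F \<Longrightarrow> controlled f g X Y F') \<Longrightarrow>
      \<exists>M\<ge>0. ennreal M \<le> ennreal c * Z \<and>
        (\<Sum>Q\<in>F. summand f g Q) \<le> C0 * A * (M * ((c1 * X) powr (1 / p) * (c2 * Y) powr (1 / d)))"
  shows "sparse_form r t \<alpha> S f g \<le> ennreal (C0 * c * ((1 + c1) * (1 + c2))) * ennreal A * Z
    * Lp_norm (ereal p) \<omega> f * Lp_norm (ereal d) \<sigma> g"
proof (rule sparse_form_le)
  obtain X Y where XY: "Lp_norm (ereal p) \<omega> f = ennreal (X powr (1 / p))"
    "Lp_norm (ereal d) \<sigma> g = ennreal (Y powr (1 / d))" "0 \<le> X" "0 \<le> Y"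
    and data: "\<forall>F. finite F \<and> F \<subseteq> S \<longrightarrow> controlled f g X Y F"
    by (rule ex_controlled[OF f g]) (rule that)
  fix F assume F: "finite F" "F \<subseteq> S"
  have sub: "controlled f g X Y F'" if "F' \<subseteq> F" for F'
    using data that F finite_subset[OF that F(1)] by blast
  obtain M where M: "0 \<le> M" "ennreal M \<le> ennreal c * Z"
    "(\<Sum>Q\<in>F. summand f g Q) \<le> C0 * A * (M * ((c1 * X) powr (1 / p) * (c2 * Y) powr (1 / d)))"
    using bound[OF XY(3,4) sub] by blast
  note pos = const_pos
  have "(\<Sum>Q\<in>F. summand f g Q) \<le> C0 * A * (M * (((1 + c1) * X powr (1 / p)) * ((1 + c2) * Y powr (1 / d))))"
    using pos XY(3,4) p d c A(2) M(1)
    by (intro order_trans[OF M(3)] mult_left_mono mult_mono powr_inverse_mult) auto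
  then have "sparse_form r t \<alpha> F f g
    \<le> ennreal (C0 * A * (M * (((1 + c1) * X powr (1 / p)) * ((1 + c2) * Y powr (1 / d)))))"
    using sub[OF order_refl] by (simp add: controlled_def ennreal_leI)
  also have "\<dots> = ennreal (C0 * ((1 + c1) * (1 + c2))) * ennreal A * ennreal M
      * Lp_norm (ereal p) \<omega> f * Lp_norm (ereal d) \<sigma> g"
    unfolding XY using c A(2) M(1) pos by (simp add: ennreal_mult[symmetric] mult_ac)
  also have "\<dots> \<le> ennreal (C0 * ((1 + c1) * (1 + c2))) * ennreal A * (ennreal c * Z)
      * Lp_norm (ereal p) \<omega> f * Lp_norm (ereal d) \<sigma> g"
    by (intro mult_right_mono mult_left_mono M) auto
  also have "\<dots> = (ennreal (C0 * ((1 + c1) * (1 + c2))) * ennreal c) * ennreal A * Z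
      * Lp_norm (ereal p) \<omega> f * Lp_norm (ereal d) \<sigma> g"
    by (simp only: mult_ac)
  also have "ennreal (C0 * ((1 + c1) * (1 + c2))) * ennreal c = ennreal (C0 * c * ((1 + c1) * (1 + c2)))"
    using c pos by (subst ennreal_mult[symmetric]) (auto simp: mult_ac)
  finally show "sparse_form r t \<alpha> F f g \<le> ennreal (C0 * c * ((1 + c1) * (1 + c2))) * ennreal A * Z
    * Lp_norm (ereal p) \<omega> f * Lp_norm (ereal d) \<sigma> g" .
qed

lemma carleson_u:
  assumes "controlled f g X Y F" "0 \<le> e" "e \<le> 1" "0 < e \<Longrightarrow> A_infty_const u < \<infinity>"
  shows "\<exists>B\<ge>0. carleson F U B \<and> ennreal (B powr e) \<le> ennreal (1 / \<eta>) * epow (A_infty_const u) e"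
  using assms(1) by (intro carleson_mass_powr[OF sp eta _ _ _ u _ assms(2-4) ge1(1)]) (auto simp: controlled_def)

lemma carleson_v:
  assumes "controlled f g X Y F" "0 \<le> e" "e \<le> 1" "0 < e \<Longrightarrow> A_infty_const v < \<infinity>"
  shows "\<exists>B\<ge>0. carleson F V B \<and> ennreal (B powr e) \<le> ennreal (1 / \<eta>) * epow (A_infty_const v) e"
  using assms(1) by (intro carleson_mass_powr[OF sp eta _ _ _ v _ assms(2-4) ge1(2)]) (auto simp: controlled_def)

text \<open>Here 1 - 1/d is 1/q and 1 - 1/p is 1/p'. Finiteness of an A-infinity constant is asked
  for only when its exponent is positive, which admits p = 1 with an infinite constant of v.\<close>

lemma upper_bound_sum:
  assumes a: "a < 0" and e: "0 < \<epsilon>" "\<epsilon> * \<beta> \<le> 1 / p" "\<epsilon> * \<gamma> \<le> 1 / d"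
      "1 \<le> - (\<epsilon> * a) + (1 / p - \<epsilon> * \<beta>) + (1 / d - \<epsilon> * \<gamma>)"
    and fin: "0 < 1 - 1 / d \<Longrightarrow> A_infty_const u < \<infinity>" "0 < 1 - 1 / p \<Longrightarrow> A_infty_const v < \<infinity>"
    and f: "f \<in> Lp (ereal p) \<omega>" and g: "g \<in> Lp (ereal d) \<sigma>"
  shows "sparse_form r t \<alpha> S f g \<le>
    ennreal ((1 + 6 * piece_const \<epsilon> a \<beta> \<gamma> p d (1 / \<eta>)) * (1 / \<eta>) * ((1 + c1) * (1 + c2))) * ennreal A
    * (epow (A_infty_const u) (1 - 1 / d) + epow (A_infty_const v) (1 - 1 / p))
    * Lp_norm (ereal p) \<omega> f * Lp_norm (ereal d) \<sigma> g"
proof (rule sparse_form_transfer[OF f g])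
  fix X Y F assume sub: "\<And>F'. F' \<subseteq> F \<Longrightarrow> controlled f g X Y F'"
  note F = sub[OF order_refl]
  obtain BU where BU: "0 \<le> BU" "carleson F U BU"
    "ennreal (BU powr (1 - 1 / d)) \<le> ennreal (1 / \<eta>) * epow (A_infty_const u) (1 - 1 / d)"
    using carleson_u[OF F, of "1 - 1 / d"] fin(1) d by auto
  obtain BV where BV: "0 \<le> BV" "carleson F V BV"
    "ennreal (BV powr (1 - 1 / p)) \<le> ennreal (1 / \<eta>) * epow (A_infty_const v) (1 - 1 / p)"
    using carleson_v[OF F, of "1 - 1 / p"] fin(2) p by auto
  have le: "ennreal (BU powr (1 - 1 / d) + BV powr (1 - 1 / p))
    \<le> ennreal (1 / \<eta>) * (epow (A_infty_const u) (1 - 1 / d) + epow (A_infty_const v) (1 - 1 / p))"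
    using add_mono[OF BU(3) BV(3)] by (simp add: distrib_left)
  have L: "1 \<le> 1 / \<eta>" and rt: "0 < 1 / r" "0 < 1 / t" using eta rp td by auto
  have "(\<Sum>Q\<in>F. summand f g Q) \<le> (1 + 6 * piece_const \<epsilon> a \<beta> \<gamma> p d (1 / \<eta>)) * A
    * ((BU powr (1 - 1 / d) + BV powr (1 - 1 / p)) * ((c1 * X) powr (1 / p) * (c2 * Y) powr (1 / d)))"
    by (rule sum_form_le[OF a e p d pd rt L _ _ _ _ _ BU(2,1) BV(2,1) A(2) _
          local_quotient_nonneg local_quotient_nonneg]) (use F sub in \<open>simp_all only: controlled_def\<close>)
  then show "\<exists>M\<ge>0. ennreal M \<le> ennreal (1 / \<eta>)
        * (epow (A_infty_const u) (1 - 1 / d) + epow (A_infty_const v) (1 - 1 / p)) \<and>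
      (\<Sum>Q\<in>F. summand f g Q) \<le> (1 + 6 * piece_const \<epsilon> a \<beta> \<gamma> p d (1 / \<eta>)) * A
        * (M * ((c1 * X) powr (1 / p) * (c2 * Y) powr (1 / d)))"
    using le by (intro exI[of _ "BU powr (1 - 1 / d) + BV powr (1 - 1 / p)"]) simp
qed (use eta piece_const_nonneg in auto)

lemma upper_bound_product:
  assumes fin: "A_infty_const u < \<infinity>" "A_infty_const v < \<infinity>"
    and f: "f \<in> Lp (ereal p) \<omega>" and g: "g \<in> Lp (ereal d) \<sigma>"
  shows "sparse_form r t \<alpha> S f g \<le> ennreal (3 * (1 / \<eta>)\<^sup>2 * ((1 + c1) * (1 + c2))) * ennreal A
        * (epow (A_infty_const u) (1 / p) * epow (A_infty_const v) (1 / d))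
        * Lp_norm (ereal p) \<omega> f * Lp_norm (ereal d) \<sigma> g"
proof (rule sparse_form_transfer[OF f g])
  fix X Y F assume sub: "\<And>F'. F' \<subseteq> F \<Longrightarrow> controlled f g X Y F'"
  note F = sub[OF order_refl]
  obtain BU where BU: "0 \<le> BU" "carleson F U BU"
    "ennreal (BU powr (1 / p)) \<le> ennreal (1 / \<eta>) * epow (A_infty_const u) (1 / p)"
    using carleson_u[OF F, of "1 / p"] fin(1) p by auto
  obtain BV where BV: "0 \<le> BV" "carleson F V BV"
    "ennreal (BV powr (1 / d)) \<le> ennreal (1 / \<eta>) * epow (A_infty_const v) (1 / d)"
    using carleson_v[OF F, of "1 / d"] fin(2) d by auto
  \<comment> \<open>One factor 1/\<eta> for each of the two embeddings.\<close>
  have "ennreal (BU powr (1 / p) * BV powr (1 / d))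
    \<le> (ennreal (1 / \<eta>) * ennreal (1 / \<eta>)) * (epow (A_infty_const u) (1 / p) * epow (A_infty_const v) (1 / d))"
    using mult_mono[OF BU(3) BV(3)] by (simp add: ennreal_mult mult_ac)
  moreover have "ennreal (1 / \<eta>) * ennreal (1 / \<eta>) = ennreal ((1 / \<eta>)\<^sup>2)"
    using eta by (subst ennreal_mult[symmetric]) (auto simp: power2_eq_square)
  ultimately have le: "ennreal (BU powr (1 / p) * BV powr (1 / d))
    \<le> ennreal ((1 / \<eta>)\<^sup>2) * (epow (A_infty_const u) (1 / p) * epow (A_infty_const v) (1 / d))"
    by (simp only:)
  have rt: "0 < 1 / r" "0 < 1 / t" using rp td by auto
  have "(\<Sum>Q\<in>F. summand f g Q) \<le> 3 * A
      * (BU powr (1 / p) * BV powr (1 / d) * ((c1 * X) powr (1 / p) * (c2 * Y) powr (1 / d)))"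
    by (rule sum_form_simple_le[OF p d rt pd _ _ _ BU(2,1) BV(2,1) A(2) _
          local_quotient_nonneg local_quotient_nonneg]) (use F in \<open>simp_all only: controlled_def\<close>)
  then show "\<exists>M\<ge>0. ennreal M \<le> ennreal ((1 / \<eta>)\<^sup>2)
        * (epow (A_infty_const u) (1 / p) * epow (A_infty_const v) (1 / d)) \<and>
      (\<Sum>Q\<in>F. summand f g Q) \<le> 3 * A * (M * ((c1 * X) powr (1 / p) * (c2 * Y) powr (1 / d)))"
    using le by (intro exI[of _ "BU powr (1 / p) * BV powr (1 / d)"]) simp
qed auto

end

text \<open>The essential supremum is taken with respect to \<sigma> dx and sees g only where
  \<sigma> > 0; positivity on Q turns it into a bound for Lebesgue almost every point of Q.\<close>

lemma average_le_Linfty: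
  fixes \<sigma> :: "real ^ 'n \<Rightarrow> ennreal"
  assumes Q: "Q \<in> cubes" and t: "0 < t" and si: "\<sigma> \<in> borel_measurable lebesgue"
    and pos: "AE x in lebesgue. x \<in> Q \<longrightarrow> 0 < \<sigma> x" and G: "Lp_norm \<infinity> \<sigma> g = ennreal G" "0 \<le> G"
  shows "avg t g Q \<le> ennreal G"
proof -
  have "AE x in density lebesgue \<sigma>. ennreal \<bar>g x\<bar> \<le> ennreal G"
    using esssup_AE[of "\<lambda>x. ennreal \<bar>g x\<bar>" "density lebesgue \<sigma>"] G by (simp add: Lp_norm_def)
  then have "AE x in lebesgue. 0 < \<sigma> x \<longrightarrow> ennreal \<bar>g x\<bar> \<le> ennreal G"
    using si by (simp add: AE_density)
  then have ae: "AE x in lebesgue. x \<in> Q \<longrightarrow> \<bar>g x\<bar> \<le> G"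
    using pos by eventually_elim (use G in \<open>auto simp: ennreal_le_iff\<close>)
  have "(pint t g Q) \<le> (\<integral>\<^sup>+x\<in>Q. ennreal (G powr t) \<partial>lebesgue)"
  proof (intro nn_integral_mono_AE, use ae in eventually_elim)
    fix x assume "x \<in> Q \<longrightarrow> \<bar>g x\<bar> \<le> G"
    then show "ennreal (\<bar>g x\<bar> powr t) * indicator Q x \<le> ennreal (G powr t) * indicator Q x"
      using t by (auto simp: indicator_def intro!: ennreal_leI powr_mono2)
  qed
  also have "\<dots> = ennreal (G powr t) * emeasure lebesgue Q"
    using cubes_sets[OF Q] by (simp add: nn_integral_cmult_indicator)
  finally have "(pint t g Q) / emeasure lebesgue Q
      \<le> ennreal (G powr t) * emeasure lebesgue Q / emeasure lebesgue Q"
    by (rule divide_right_mono_ennreal)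
  also have "\<dots> = ennreal (G powr t)"
    using cubes_emeasure[OF Q] by (simp add: ennreal_mult_divide_eq)
  finally have "avg t g Q \<le> epow (ennreal (G powr t)) (1 / t)"
    unfolding average_def using t by (intro epow_mono) auto
  also have "\<dots> = ennreal G" using G(2) t by (simp add: epow_ennreal_nonneg powr_powr)
  finally show ?thesis .
qed

text \<open>The case p = q = 1. Every average of g is at most its norm, and a single Carleson
  embedding for |f|^r / u in L^(1/r)(u) remains; hence the first power of [u].\<close>

lemma upper_bound_Linfty:
  fixes \<omega> \<sigma> u :: "real ^ 'n \<Rightarrow> ennreal" and r t \<alpha> \<eta> :: real
  assumes r: "0 < r" "r < 1" and t: "0 < t" and eta: "0 < \<eta>"
    and om: "weight \<omega>" and si: "weight \<sigma>" and u_def: "u = (\<lambda>x. epow (\<omega> x) (r / (r - 1)))" and u: "weight u"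
    and D: "dyadic_lattice D" and S: "S \<subseteq> D" and sp: "sparse_family \<eta> S"
    and pos: "\<And>Q. Q \<in> S \<Longrightarrow> AE x in lebesgue. x \<in> Q \<longrightarrow> 0 < \<sigma> x"
    and iu: "A_infty_const u < \<infinity>"
    and A: "A_const (1 + \<alpha> - 1 / r - 1 / t) (1 / r - 1) (1 / t) u (\<lambda>x. 1) = ennreal A" "0 < A"
    and f: "f \<in> Lp (ereal 1) \<omega>" and g: "g \<in> Lp \<infinity> \<sigma>"
  shows "sparse_form r t \<alpha> S f g \<le> ennreal (1 / \<eta> * doob_const (1 / r)) * ennreal A
        * A_infty_const u * Lp_norm (ereal 1) \<omega> f * Lp_norm \<infinity> \<sigma> g"
proof -
  obtain X where X: "0 \<le> X" "Lp_norm (ereal 1) \<omega> f = ennreal (X powr (1 / 1))"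
    "\<And>Q. Q \<in> cubes \<Longrightarrow> (pint r f Q) < \<infinity>"
    "\<And>S. laminar S \<Longrightarrow> S \<subseteq> cubes \<Longrightarrow>
      (\<Sum>Q\<in>S. incr S (\<lambda>Q. smax S (local_quotient r u f) Q powr (1 / r * 1)) Q * rmass u Q)
        \<le> doob_const (1 / r) * X"
    using Doob_Lp[OF r om u_def u f] by blast
  obtain G where G: "Lp_norm \<infinity> \<sigma> g = ennreal G" "0 \<le> G"
    using g by (cases "Lp_norm \<infinity> \<sigma> g") (auto simp: Lp_def)
  obtain B where B: "A_infty_const u = ennreal B" "0 \<le> B" using iu by (cases "A_infty_const u") auto
  have c: "0 < doob_const (1 / r)" using r by (intro doob_const_pos) simp
  define k where "k = 1 / \<eta> * doob_const (1 / r)"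
  have k: "0 \<le> k" using c eta by (simp add: k_def)
  have sim: "\<sigma> \<in> borel_measurable lebesgue" using si by (simp add: weight_def)
  have "AE x in lebesgue. 0 < u x"
    unfolding u_def using r by (intro dual_weight_AE_pos om) (simp add: divide_le_0_iff)
  then have mu: "0 < mass u Q" "mass u Q < \<infinity>" if "Q \<in> cubes" for Q
    using that u weight_mass_finite mass_pos by (auto simp: weight_def)
  have Dc: "D \<subseteq> cubes" using D by (simp add: dyadic_lattice_def)
  let ?U = "\<lambda>Q. rmass u Q" and ?H = "local_quotient r u f"
  show ?thesis
  proof (rule sparse_form_le)
    fix F assume F: "finite F" "F \<subseteq> S"
    have Fc: "F \<subseteq> cubes" using F S Dc by auto
    have lam: "laminar F" using F S by (intro dyadic_lattice_laminar[OF D]) auto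
    have U: "superadd F ?U" using mu Fc by (intro superadd_mass F(1) Fc u) auto
    have dec: "decreasing F (smax F ?H)" by (intro smax_decreasing lam local_quotient_nonneg)
    have "sparse_form r t \<alpha> F f g \<le> (\<Sum>Q\<in>F. ennreal (A * G * (?U Q * smax F ?H Q powr (1 / r))))"
      unfolding sparse_form_def infsum_finite[OF F(1)]
    proof (rule sum_mono)
      fix Q assume QF: "Q \<in> F"
      then have Q: "Q \<in> cubes" "Q \<in> S" using Fc F by auto
      define w where "w = vol Q"
      have w: "emeasure lebesgue Q = ennreal w" "0 < w"
        using cubes_emeasure[OF Q(1)] by (auto simp: w_def enn2real_positive_iff)
      have U0: "0 < ?U Q" using mu[OF Q(1)] by (simp add: enn2real_positive_iff)
      have m1: "mass (\<lambda>x. 1) Q = emeasure lebesgue Q" using cubes_sets[OF Q(1)] by (simp add: mass_def)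
      have le: "w powr (1 + \<alpha> - 1 / r - 1 / t) * ?U Q powr (1 / r - 1) * w powr (1 / t) \<le> A"
        using A_const_real[OF A(1) Q(1) less_imp_le[OF A(2)] mu[OF Q(1)]] cubes_emeasure[OF Q(1)]
        unfolding m1 w_def by simp
      have H: "?H Q powr (1 / r) \<le> smax F ?H Q powr (1 / r)"
        using smax_ge[OF lam QF order_refl, of ?H] local_quotient_nonneg r by (intro powr_mono2) auto
      have vol: "epow (emeasure lebesgue Q) (1 + \<alpha>) = ennreal (w powr (1 + \<alpha>))"
        unfolding w(1) using w(2) by (rule epow_ennreal)
      have "avg r f Q * avg t g Q * epow (emeasure lebesgue Q) (1 + \<alpha>)
        \<le> ennreal (w powr (- (1 / r)) * ?U Q powr (1 / r) * ?H Q powr (1 / r)) * ennreal G * ennreal (w powr (1 + \<alpha>))"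
        unfolding vol
        using average_local_quotient[OF Q(1) r(1) X(3)[OF Q(1)] mu[OF Q(1)], folded w_def]
          average_le_Linfty[OF Q(1) t sim pos[OF Q(2)] G]
        by (intro mult_mono) auto
      also have "\<dots> = ennreal (w powr (- (1 / r)) * ?U Q powr (1 / r) * ?H Q powr (1 / r) * G * w powr (1 + \<alpha>))"
        using G(2) by (simp add: ennreal_mult)
      also have "\<dots> \<le> ennreal (A * G * (?U Q * smax F ?H Q powr (1 / r)))"
      proof (rule ennreal_leI)
        have e1: "?U Q powr (1 / r) = ?U Q powr (1 / r - 1) * ?U Q"
          using powr_mult_base[of "?U Q" "1 / r - 1"] by (simp add: mult.commute)
        \<comment> \<open>The factor w^(1/t) stands for v(Q)^(1/t) with v = 1; splitting it off
          makes the A-quantity appear.\<close>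
        have e2: "w powr (1 + \<alpha> - 1 / r - 1 / t) * w powr (1 / t) = w powr (- (1 / r)) * w powr (1 + \<alpha>)"
          by (simp add: powr_add[symmetric])
        have "w powr (- (1 / r)) * ?U Q powr (1 / r) * ?H Q powr (1 / r) * G * w powr (1 + \<alpha>)
          = (w powr (- (1 / r)) * w powr (1 + \<alpha>)) * ?U Q powr (1 / r - 1) * G * (?U Q * ?H Q powr (1 / r))"
          unfolding e1 by (simp only: mult_ac)
        also have "\<dots> = (w powr (1 + \<alpha> - 1 / r - 1 / t) * ?U Q powr (1 / r - 1) * w powr (1 / t)) * G
            * (?U Q * ?H Q powr (1 / r))"
          unfolding e2[symmetric] by (simp only: mult_ac)
        also have "\<dots> \<le> A * G * (?U Q * smax F ?H Q powr (1 / r))"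
          using le H G(2) A(2) U0 by (intro mult_mono) auto
        finally show "w powr (- (1 / r)) * ?U Q powr (1 / r) * ?H Q powr (1 / r) * G * w powr (1 + \<alpha>)
          \<le> A * G * (?U Q * smax F ?H Q powr (1 / r))" .
      qed
      finally show "avg r f Q * avg t g Q * epow (emeasure lebesgue Q) (1 + \<alpha>)
        \<le> ennreal (A * G * (?U Q * smax F ?H Q powr (1 / r)))" .
    qed
    also have "\<dots> = ennreal (A * G * (\<Sum>Q\<in>F. smax F ?H Q powr (1 / r) * ?U Q))"
      using A(2) G(2) by (subst sum_ennreal) (auto simp: sum_distrib_left mult_ac)
    also have "\<dots> \<le> ennreal (A * G * (1 / \<eta> * B * (doob_const (1 / r) * X)))"
    proof (intro ennreal_leI mult_left_mono)
      have cB: "carleson F ?U (1 / \<eta> * B)"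
        using mu Fc by (intro carleson_mass[OF sp eta F Fc u _ B]) auto
      have "(\<Sum>Q\<in>F. smax F ?H Q powr (1 / r) * ?U Q)
        \<le> 1 / \<eta> * B * (\<Sum>R\<in>F. incr F (\<lambda>Q. smax F ?H Q powr (1 / r)) R * ?U R)"
        using r by (intro carleson_embedding lam U dec cB) auto
      also have "\<dots> \<le> 1 / \<eta> * B * (doob_const (1 / r) * X)"
        using X(4)[OF lam Fc] eta B by (intro mult_left_mono) auto
      finally show "(\<Sum>Q\<in>F. smax F ?H Q powr (1 / r) * ?U Q) \<le> 1 / \<eta> * B * (doob_const (1 / r) * X)" .
    qed (use A(2) G(2) in auto)
    also have "\<dots> = ennreal (k * A * B * X * G)" by (simp add: k_def mult_ac)
    also have "\<dots> = ennreal k * ennreal A * A_infty_const u * Lp_norm (ereal 1) \<omega> f * Lp_norm \<infinity> \<sigma> g"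
      unfolding B(1) X(2) G(1) using A(2) B(2) X(1) G(2) k by (simp add: ennreal_mult)
    finally show "sparse_form r t \<alpha> F f g \<le> ennreal (1 / \<eta> * doob_const (1 / r)) * ennreal A
        * A_infty_const u * Lp_norm (ereal 1) \<omega> f * Lp_norm \<infinity> \<sigma> g" unfolding k_def .
  qed
qed

section \<open>Exponents and the best constant\<close>

lemma conj_exp_real:
  assumes "1 < x" shows "conj_exp (ereal x) = ereal (x / (x - 1))"
proof -
  have "1 / (1 - 1 / x) = x / (x - 1)" "1 - 1 / x \<noteq> 0" using assms by (auto simp: field_simps)
  then show ?thesis using assms by (simp add: conj_exp_def one_ereal_def)
qed

lemma conj_exp_one: "conj_exp 1 = \<infinity>"
  by (simp add: conj_exp_def divide_ereal_def one_ereal_def)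

lemma conj_exp_infinity: "conj_exp \<infinity> = 1"
  by (simp add: conj_exp_def one_ereal_def)

lemma inverse_conj_exp:
  assumes "1 \<le> p"
  shows "real_of_ereal (1 / conj_exp (ereal p)) = 1 - 1 / p"
    "real_of_ereal (1 / (conj_exp (ereal p))\<^sup>2) = (1 - 1 / p)\<^sup>2"
proof -
  have "real_of_ereal (1 / conj_exp (ereal p)) = 1 - 1 / p
    \<and> real_of_ereal (1 / (conj_exp (ereal p))\<^sup>2) = (1 - 1 / p)\<^sup>2"
  proof (cases "p = 1")
    case True
    then show ?thesis by (simp add: conj_exp_one one_ereal_def[symmetric])
  next
    case False
    then have p: "1 < p" using assms by simp
    then have eq: "(p - 1) / p = 1 - 1 / p" by (simp add: field_simps)
    have "1 / (p / (p - 1))\<^sup>2 = ((p - 1) / p)\<^sup>2" by (simp add: power_divide)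
    then show ?thesis
      using p unfolding eq by (simp add: conj_exp_real one_ereal_def eq)
  qed
  then show "real_of_ereal (1 / conj_exp (ereal p)) = 1 - 1 / p"
    "real_of_ereal (1 / (conj_exp (ereal p))\<^sup>2) = (1 - 1 / p)\<^sup>2" by auto
qed

text \<open>Since s > 1, the exponent s' is a real number t, also for s = \<infinity>; from here on
  t replaces s.\<close>

lemma conj_exp_greater:
  assumes "1 \<le> q" "ereal q < s"
  obtains t where "conj_exp s = ereal t" "1 \<le> t" "1 / t = 1 - real_of_ereal (1 / s)"
    "real_of_ereal (1 / s) < 1 / q"
proof (cases s)
  case (real x)
  then have x: "1 < x" "q < x" using assms by auto
  show thesis
  proof (rule that)
    show "conj_exp s = ereal (x / (x - 1))" unfolding real by (rule conj_exp_real[OF x(1)])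
    show "1 \<le> x / (x - 1)" using x by simp
    show "1 / (x / (x - 1)) = 1 - real_of_ereal (1 / s)"
      unfolding real using x by (simp add: one_ereal_def field_simps)
    show "real_of_ereal (1 / s) < 1 / q"
      unfolding real using x assms by (simp add: one_ereal_def frac_less2)
  qed
next
  case PInf
  then show thesis using assms by (intro that[of 1]) (auto simp: conj_exp_infinity one_ereal_def)
next
  case MInf
  then show thesis using assms by simp
qed

lemma dual_exponent:
  assumes "0 < t" "t < d"
  shows "real_of_ereal (ereal t / (ereal t - ereal d)) = t / (t - d)"
  using assms by simp

text \<open>For q' = \<infinity> the dual weight is the power 0 of \<sigma>, that is, the constant
  1.\<close>

lemma dual_exponent_infinity: "real_of_ereal (ereal t / (ereal t - \<infinity>)) = 0"
  by simp

text \<open>With h = (1/p)(1/p') the exponents on the right are 1/p + h, 1/p' - h and 1/p - h, 1/p'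
  + h. The left-hand side is thus the geometric mean of the two terms, and comparing x with y shows
  which one is larger.\<close>

lemma exponent_between:
  fixes p x y :: real
  assumes p: "1 \<le> p" and xy: "0 < x" "0 < y"
  shows "x powr (1 / p) * y powr (1 - 1 / p)
    \<le> x powr (1 - (1 - 1 / p)\<^sup>2) * y powr ((1 - 1 / p)\<^sup>2) + x powr (1 / p\<^sup>2) * y powr (1 - 1 / p\<^sup>2)"
proof -
  define h where "h = 1 / p * (1 - 1 / p)"
  have h: "0 \<le> h" using p by (simp add: h_def)
  have e: "1 - ((1 - 1 / p) - h) = 1 / p + h" "(1 - 1 / p)\<^sup>2 = (1 - 1 / p) - h"
    "1 / p\<^sup>2 = 1 / p - h" "1 - (1 / p - h) = (1 - 1 / p) + h"
    using p by (simp_all add: h_def power2_eq_square field_simps)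
  show ?thesis
  proof (cases "y \<le> x")
    case True
    then have "1 \<le> (x / y) powr h" using xy h by (intro ge_one_powr_ge_zero) auto
    then have "x powr (1 / p) * y powr (1 - 1 / p) * 1 \<le> x powr (1 / p) * y powr (1 - 1 / p) * (x / y) powr h"
      by (intro mult_left_mono) auto
    also have "\<dots> = x powr (1 / p + h) * y powr ((1 - 1 / p) - h)"
      using xy by (simp add: powr_divide powr_add powr_diff mult_ac)
    also have "\<dots> \<le> x powr (1 / p + h) * y powr ((1 - 1 / p) - h) + x powr (1 / p - h) * y powr ((1 - 1 / p) + h)"
      by simp
    finally show ?thesis unfolding e by simp
  next
    case False
    then have "1 \<le> (y / x) powr h" using xy h by (intro ge_one_powr_ge_zero) auto
    then have "x powr (1 / p) * y powr (1 - 1 / p) * 1 \<le> x powr (1 / p) * y powr (1 - 1 / p) * (y / x) powr h"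
      by (intro mult_left_mono) auto
    also have "\<dots> = x powr (1 / p - h) * y powr ((1 - 1 / p) + h)"
      using xy by (simp add: powr_divide powr_add powr_diff mult_ac)
    also have "\<dots> \<le> x powr (1 / p + h) * y powr ((1 - 1 / p) - h) + x powr (1 / p - h) * y powr ((1 - 1 / p) + h)"
      by simp
    finally show ?thesis unfolding e by simp
  qed
qed

section \<open>Testing the best constant\<close>

lemma best_const_le:
  assumes "conj_exp s = ereal t"
    and "\<And>f g. f \<in> Lp (ereal p) \<omega> \<Longrightarrow> g \<in> Lp (conj_exp (ereal q)) \<sigma> \<Longrightarrow>
      sparse_form r t \<alpha> S f g \<le> c * Lp_norm (ereal p) \<omega> f * Lp_norm (conj_exp (ereal q)) \<sigma> g"
  shows "best_const r s \<alpha> p q \<omega> \<sigma> S \<le> c"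
  unfolding best_const_def assms(1) using assms(2) by (intro Inf_lower) simp

text \<open>The term of one cube is part of the form over S, so every constant admissible for S is
  admissible for {Q}.\<close>

lemma test_value_le_best_const:
  fixes \<omega> \<sigma> :: "real ^ 'n \<Rightarrow> ennreal"
  assumes q: "1 \<le> q" and rp: "0 < r" "r < p" and t: "conj_exp s = ereal t" "1 \<le> t"
    and tq: "1 - 1 / q < 1 / t" and om: "weight \<omega>" and si: "weight \<sigma>"
    and Q: "Q \<in> cubes" "Q \<in> S"
  shows "epow (emeasure lebesgue Q) (1 + \<alpha> - 1 / r - 1 / t)
      * epow (mass (\<lambda>x. epow (\<omega> x) (r / (r - p))) Q) (1 / r - 1 / p)
      * epow (mass (\<lambda>x. epow (\<sigma> x) (real_of_ereal (ereal t / (ereal t - conj_exp (ereal q))))) Q) (1 / t - (1 - 1 / q))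
    \<le> best_const r s \<alpha> p q \<omega> \<sigma> S"
proof -
  let ?u = "\<lambda>x. epow (\<omega> x) (r / (r - p))"
  let ?v = "\<lambda>x. epow (\<sigma> x) (real_of_ereal (ereal t / (ereal t - conj_exp (ereal q))))"
  have t0: "0 < t" using t by simp
  have [measurable]: "\<omega> \<in> borel_measurable lebesgue" "\<sigma> \<in> borel_measurable lebesgue"
    using om si by (auto simp: weight_def)
  note Qs = cubes_sets[OF Q(1)]
  define m1 where "m1 k = mass (\<lambda>x. min (?u x) (ennreal (real (Suc k)))) Q" for k
  have S1: "(SUP k. m1 k) = mass ?u Q" unfolding m1_def by (rule SUP_mass_min[OF _ Qs]) measurable
  have T1: "0 < m1 k" "m1 k < \<infinity>" "\<exists>f\<in>Lp (ereal p) \<omega>. Lp_norm (ereal p) \<omega> f \<le> epow (m1 k) (1 / p) \<and>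
       avg r f Q = epow (m1 k / emeasure lebesgue Q) (1 / r)" for k
    unfolding m1_def by (rule test_function[OF rp om refl Q(1)], simp)+
  obtain m2 where S2: "(SUP k :: nat. m2 k) = mass ?v Q" and T2: "\<And>k. 0 < m2 k" "\<And>k. m2 k < \<infinity>"
    "\<And>k. \<exists>g\<in>Lp (conj_exp (ereal q)) \<sigma>. Lp_norm (conj_exp (ereal q)) \<sigma> g \<le> epow (m2 k) (1 - 1 / q) \<and>
       avg t g Q = epow (m2 k / emeasure lebesgue Q) (1 / t)"
  proof (cases "q = 1")
    \<comment> \<open>For q = 1 the mass of v is |Q| and the norm exponent 1 - 1/q is 0, so a
      constant sequence does the work of the truncated masses.\<close>
    case True
    then have v: "?v = (\<lambda>x. 1)" by (simp add: conj_exp_one one_ereal_def[symmetric])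
    have "mass ?v Q = emeasure lebesgue Q" unfolding v using Qs by (simp add: mass_def)
    then show thesis
      using test_function_infinity[of \<sigma>, OF _ Q(1) t0] cubes_emeasure[OF Q(1)] True
      by (intro that[of "\<lambda>_. emeasure lebesgue Q"]) (auto simp: conj_exp_one one_ereal_def[symmetric])
  next
    case False
    then have q1: "1 < q" using q by simp
    define d where "d = q / (q - 1)"
    have d: "conj_exp (ereal q) = ereal d" unfolding d_def by (rule conj_exp_real[OF q1])
    have "1 / d = 1 - 1 / q" "0 < d" using q1 by (auto simp: d_def field_simps)
    moreover have "t < d"
    proof -
      have "1 / d < 1 / t" "0 < d" using tq calculation by auto
      then show ?thesis using t0 by (simp add: frac_less2 field_simps)
    qed
    ultimately have dd: "1 / d = 1 - 1 / q" "t < d" by auto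
    have v: "real_of_ereal (ereal t / (ereal t - conj_exp (ereal q))) = t / (t - d)"
      unfolding d by (rule dual_exponent[OF t0 dd(2)])
    show thesis
    proof (rule that)
      show "(SUP k. mass (\<lambda>x. min (?v x) (ennreal (real (Suc k)))) Q) = mass ?v Q"
        by (rule SUP_mass_min[OF _ Qs]) measurable
      show "0 < mass (\<lambda>x. min (?v x) (ennreal (real (Suc k)))) Q"
        "mass (\<lambda>x. min (?v x) (ennreal (real (Suc k)))) Q < \<infinity>"
        "\<exists>g\<in>Lp (conj_exp (ereal q)) \<sigma>. Lp_norm (conj_exp (ereal q)) \<sigma> g
           \<le> epow (mass (\<lambda>x. min (?v x) (ennreal (real (Suc k)))) Q) (1 - 1 / q) \<and>
         avg t g Q
           = epow (mass (\<lambda>x. min (?v x) (ennreal (real (Suc k)))) Q / emeasure lebesgue Q) (1 / t)" for k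
        unfolding v unfolding d dd(1)[symmetric] by (rule test_function[OF t0 dd(2) si refl Q(1)], simp)+
    qed
  qed
  show ?thesis
    unfolding best_const_def S1[symmetric] S2[symmetric]
  proof (rule Inf_greatest)
    fix N assume *: "N \<in> {N. \<forall>f\<in>Lp (ereal p) \<omega>. \<forall>g\<in>Lp (conj_exp (ereal q)) \<sigma>.
      sparse_form r (real_of_ereal (conj_exp s)) \<alpha> S f g \<le> N * Lp_norm (ereal p) \<omega> f * Lp_norm (conj_exp (ereal q)) \<sigma> g}"
    have N: "\<forall>f\<in>Lp (ereal p) \<omega>. \<forall>g\<in>Lp (conj_exp (ereal q)) \<sigma>.
      sparse_form r t \<alpha> {Q} f g \<le> N * Lp_norm (ereal p) \<omega> f * Lp_norm (conj_exp (ereal q)) \<sigma> g"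
    proof (intro ballI)
      fix f g assume "f \<in> Lp (ereal p) \<omega>" "g \<in> Lp (conj_exp (ereal q)) \<sigma>"
      then have "sparse_form r t \<alpha> S f g \<le> N * Lp_norm (ereal p) \<omega> f * Lp_norm (conj_exp (ereal q)) \<sigma> g"
        using * unfolding t(1) by simp
      then show "sparse_form r t \<alpha> {Q} f g \<le> N * Lp_norm (ereal p) \<omega> f * Lp_norm (conj_exp (ereal q)) \<sigma> g"
        using sparse_form_mono[of "{Q}" S r t \<alpha> f g] Q(2) by simp
    qed
    show "epow (emeasure lebesgue Q) (1 + \<alpha> - 1 / r - 1 / t) * epow (SUP k. m1 k) (1 / r - 1 / p)
      * epow (SUP k. m2 k) (1 / t - (1 - 1 / q)) \<le> N"
      using rp by (intro test_value_le[OF Q(1) rp(1) t0 T1 T2 N _ tq]) (simp add: frac_less2)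
  qed
qed

text \<open>If \<sigma> vanished on a part Z of Q with positive measure, the indicator of Z would
  have norm 0 in L^\<infinity>(\<sigma>) while the form stays positive. As N * 0 = 0 even for N =
  \<infinity>, no constant would be admissible, and the infimum of the empty set is
  \<infinity>.\<close>

lemma weight_pos_of_best_const_finite:
  fixes \<omega> \<sigma> :: "real ^ 'n \<Rightarrow> ennreal"
  assumes rp: "0 < r" "r < p" and t: "conj_exp s = ereal t" "1 \<le> t" and om: "weight \<omega>" and si: "weight \<sigma>"
    and Q: "Q \<in> cubes" "Q \<in> S" and fin: "best_const r s \<alpha> p 1 \<omega> \<sigma> S < \<infinity>"
  shows "AE x in lebesgue. x \<in> Q \<longrightarrow> 0 < \<sigma> x"
proof (rule ccontr)
  assume nae: "\<not> (AE x in lebesgue. x \<in> Q \<longrightarrow> 0 < \<sigma> x)"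
  have [measurable]: "\<sigma> \<in> borel_measurable lebesgue" "Q \<in> sets lebesgue"
    using si cubes_sets[OF Q(1)] by (auto simp: weight_def)
  define Z where "Z = {x \<in> space lebesgue. x \<in> Q \<and> \<sigma> x = 0}"
  have Zm [measurable]: "Z \<in> sets lebesgue" unfolding Z_def by measurable
  have Z0: "emeasure lebesgue Z \<noteq> 0"
  proof
    assume "emeasure lebesgue Z = 0"
    then have "AE x in lebesgue. x \<notin> Z" using Zm by (intro AE_not_in) (auto simp: null_sets_def)
    then have "AE x in lebesgue. x \<in> Q \<longrightarrow> 0 < \<sigma> x"
      by eventually_elim (auto simp: Z_def zero_less_iff_neq_zero)
    then show False using nae by simp
  qed
  let ?g = "indicator Z :: real ^ 'n \<Rightarrow> real"
  have "AE x in density lebesgue \<sigma>. ennreal \<bar>?g x\<bar> \<le> 0"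
    by (subst AE_density) (auto simp: Z_def indicator_def)
  then have "esssup (density lebesgue \<sigma>) (\<lambda>x. ennreal \<bar>?g x\<bar>) \<le> 0"
    by (rule esssup_I[rotated]) measurable
  then have "Lp_norm \<infinity> \<sigma> ?g \<le> 0" by (simp only: Lp_norm_def if_True refl)
  then have g: "Lp_norm \<infinity> \<sigma> ?g = 0" "?g \<in> Lp \<infinity> \<sigma>" by (auto simp: Lp_def)
  obtain m where m: "0 < m" "\<exists>f\<in>Lp (ereal p) \<omega>. Lp_norm (ereal p) \<omega> f \<le> epow m (1 / p) \<and>
       avg r f Q = epow (m / emeasure lebesgue Q) (1 / r)"
    using test_function[OF rp om refl Q(1), of 1] by auto
  then obtain f where f: "f \<in> Lp (ereal p) \<omega>" "avg r f Q = epow (m / emeasure lebesgue Q) (1 / r)"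
    by blast
  note em = cubes_emeasure[OF Q(1)]
  have "(pint t ?g Q) = (\<integral>\<^sup>+x. indicator Z x \<partial>lebesgue)"
    by (intro nn_integral_cong) (auto simp: indicator_def Z_def)
  then have ag: "avg t ?g Q = epow (emeasure lebesgue Z / emeasure lebesgue Q) (1 / t)"
    by (simp add: average_def)
  have "0 < avg r f Q"
    unfolding f(2) using m(1) em rp by (intro epow_pos) (auto simp: ennreal_zero_less_divide)
  moreover have "0 < avg t ?g Q"
    unfolding ag using Z0 em t by (intro epow_pos) (auto simp: ennreal_zero_less_divide zero_less_iff_neq_zero)
  moreover have "0 < epow (emeasure lebesgue Q) (1 + \<alpha>)"
    using em by (cases "emeasure lebesgue Q") (auto simp: epow_ennreal)
  ultimately have "0 < sparse_form r t \<alpha> {Q} f ?g"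
    unfolding sparse_form_singleton by (simp add: ennreal_zero_less_mult_iff)
  then have pos: "0 < sparse_form r t \<alpha> S f ?g"
    using sparse_form_mono[of "{Q}" S r t \<alpha> f ?g] Q(2) by (auto intro: less_le_trans)
  have "{N. \<forall>f\<in>Lp (ereal p) \<omega>. \<forall>g\<in>Lp (conj_exp (ereal 1)) \<sigma>.
      sparse_form r (real_of_ereal (conj_exp s)) \<alpha> S f g \<le> N * Lp_norm (ereal p) \<omega> f * Lp_norm (conj_exp (ereal 1)) \<sigma> g} = {}"
  proof (rule ccontr)
    assume "\<not> ?thesis"
    then obtain N where "\<forall>f\<in>Lp (ereal p) \<omega>. \<forall>g\<in>Lp \<infinity> \<sigma>.
      sparse_form r t \<alpha> S f g \<le> N * Lp_norm (ereal p) \<omega> f * Lp_norm \<infinity> \<sigma> g"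
      unfolding t(1) by (auto simp: conj_exp_one one_ereal_def[symmetric])
    then have "sparse_form r t \<alpha> S f ?g \<le> N * Lp_norm (ereal p) \<omega> f * Lp_norm \<infinity> \<sigma> ?g"
      using f(1) g(2) by blast
    then show False using pos unfolding g(1) by simp
  qed
  then have "best_const r s \<alpha> p 1 \<omega> \<sigma> S = Inf {}" by (simp only: best_const_def)
  then show False using fin by simp
qed

section \<open>The A-infinity factor and the upper bound\<close>

lemma A_infty_factor_otherwise:
  assumes "1 \<le> p" "\<not> (p = q \<and> 0 < \<alpha>)"
  shows "A_infty_factor p q \<alpha> u v = epow (A_infty_const u) (1 / q) + epow (A_infty_const v) (1 - 1 / p)"
  unfolding A_infty_factor_def Let_def if_not_P[OF assms(2)] inverse_conj_exp[OF assms(1)] ..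

lemma A_infty_factor_diagonal:
  assumes "1 \<le> p" "0 < \<alpha>"
  shows "A_infty_factor p p \<alpha> u v =
    epow (A_infty_const u) (1 - (1 - 1 / p)\<^sup>2) * epow (A_infty_const v) ((1 - 1 / p)\<^sup>2)
    + epow (A_infty_const u) (1 / p\<^sup>2) * epow (A_infty_const v) (1 - 1 / p\<^sup>2)"
  using assms by (simp add: A_infty_factor_def Let_def inverse_conj_exp)

text \<open>Excludes the product \<infinity> * 0 = 0 in the bound when [u,v] is infinite.\<close>

lemma A_infty_factor_nonzero:
  assumes "1 \<le> p" "p \<le> q" "1 \<le> A_infty_const u" "1 \<le> A_infty_const v"
  shows "A_infty_factor p q \<alpha> u v \<noteq> 0"
proof (cases "p = q \<and> 0 < \<alpha>")
  case True
  have "0 \<le> (1 - 1 / p)\<^sup>2" "(1 - 1 / p)\<^sup>2 \<le> 1" using assms by (auto intro!: power_le_one)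
  then have "1 \<le> epow (A_infty_const u) (1 - (1 - 1 / p)\<^sup>2)" "1 \<le> epow (A_infty_const v) ((1 - 1 / p)\<^sup>2)"
    using assms by (auto intro!: epow_ge_1)
  then show ?thesis using True assms by (auto simp: A_infty_factor_diagonal)
next
  case False
  have "1 \<le> epow (A_infty_const u) (1 / q)" using assms by (intro epow_ge_1) auto
  then show ?thesis using False assms by (auto simp: A_infty_factor_otherwise)
qed

text \<open>All powers involved are at least 1, so a finite sum of products has finite factors. The
  constant of u always occurs with a positive exponent, that of v does so for p > 1.\<close>

lemma A_infty_factor_finite:
  assumes "1 \<le> p" "p \<le> q" "1 \<le> A_infty_const u" "1 \<le> A_infty_const v" "A_infty_factor p q \<alpha> u v < \<infinity>"
  shows "A_infty_const u < \<infinity>" "1 < p \<Longrightarrow> A_infty_const v < \<infinity>"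
proof -
  have fin: "x < \<infinity>" if "epow x e < \<infinity>" "0 < e" for x e
    using that epow_top(2)[of e] by (cases x) auto
  have prod: "x < \<infinity> \<and> y < \<infinity>" if "x * y < \<infinity>" "x \<noteq> 0" "y \<noteq> 0" for x y :: ennreal
    using that by (auto simp: ennreal_mult_less_top)
  have ge: "epow (A_infty_const u) e \<noteq> 0" "epow (A_infty_const v) e \<noteq> 0" if "0 \<le> e" for e
    using epow_ge_1[OF assms(3) that] epow_ge_1[OF assms(4) that] by auto
  have "A_infty_const u < \<infinity> \<and> (1 < p \<longrightarrow> A_infty_const v < \<infinity>)"
  proof (cases "p = q \<and> 0 < \<alpha>")
    case True
    have "1 / p > 0" "1 / p \<le> 1" using assms(1) by auto
    then have s: "0 \<le> (1 - 1 / p)\<^sup>2" "(1 - 1 / p)\<^sup>2 < 1" "0 < 1 / p\<^sup>2" "1 / p\<^sup>2 \<le> 1"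
      using assms(1) by (auto simp: power_one_over[symmetric] power_less_one_iff power_le_one abs_square_less_1)
    have *: "epow (A_infty_const u) (1 - (1 - 1 / p)\<^sup>2) * epow (A_infty_const v) ((1 - 1 / p)\<^sup>2) < \<infinity>"
      "epow (A_infty_const u) (1 / p\<^sup>2) * epow (A_infty_const v) (1 - 1 / p\<^sup>2) < \<infinity>"
      using assms True by (auto simp: A_infty_factor_diagonal ennreal_add_less_top)
    have "epow (A_infty_const u) (1 / p\<^sup>2) < \<infinity>" "epow (A_infty_const v) (1 - 1 / p\<^sup>2) < \<infinity>"
      using prod[OF *(2)] ge s by auto
    moreover have "0 < 1 - 1 / p\<^sup>2" if "1 < p" using that by (simp add: power2_eq_square less_1_mult)
    ultimately show ?thesis using fin s by blast
  next
    case False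
    then have "epow (A_infty_const u) (1 / q) < \<infinity>" "epow (A_infty_const v) (1 - 1 / p) < \<infinity>"
      using assms by (auto simp: A_infty_factor_otherwise ennreal_add_less_top)
    then show ?thesis using fin[of "A_infty_const u" "1 / q"] fin[of "A_infty_const v" "1 - 1 / p"] assms by auto
  qed
  then show "A_infty_const u < \<infinity>" "1 < p \<Longrightarrow> A_infty_const v < \<infinity>" by auto
qed

lemma epow_product_le_factor:
  assumes p: "1 < p" "0 < \<alpha>" and u: "1 \<le> A_infty_const u" "A_infty_const u < \<infinity>"
    and v: "1 \<le> A_infty_const v" "A_infty_const v < \<infinity>"
  shows "epow (A_infty_const u) (1 / p) * epow (A_infty_const v) (1 - 1 / p) \<le> A_infty_factor p p \<alpha> u v"
proof -
  obtain x y where x: "A_infty_const u = ennreal x" "A_infty_const v = ennreal y" "0 < x" "0 < y"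
    using u v by (cases "A_infty_const u"; cases "A_infty_const v") (auto simp: ennreal_ge_1)
  have "ennreal (x powr (1 / p) * y powr (1 - 1 / p))
    \<le> ennreal (x powr (1 - (1 - 1 / p)\<^sup>2) * y powr ((1 - 1 / p)\<^sup>2) + x powr (1 / p\<^sup>2) * y powr (1 - 1 / p\<^sup>2))"
    using exponent_between[of p x y] p x by (intro ennreal_leI) auto
  then show ?thesis
    using p x by (simp add: A_infty_factor_diagonal epow_ennreal ennreal_mult ennreal_plus)
qed

text \<open>At p = q = 1 the factor is twice [u] if \<alpha> > 0, and [u] + 1 otherwise.\<close>

lemma A_infty_factor_one:
  assumes "1 \<le> A_infty_const v"
  shows "A_infty_const u \<le> A_infty_factor 1 1 \<alpha> u v"
proof -
  have e1: "epow x 1 = x" for x using epow_epow_inverse[of 1 x] by (cases x) (auto simp: epow_def)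
  show ?thesis
    by (cases "0 < \<alpha>") (auto simp: A_infty_factor_diagonal A_infty_factor_otherwise e1)
qed

text \<open>\<open>C\<close> must be fixed before the weights and the family, so the case
  distinction concerns exponents alone: q = 1, which falls outside \<open>dual_pair\<close>, and the
  two cases of the claim for q > 1.\<close>

lemma best_const_upper_bound:
  fixes p q r \<alpha> \<eta> t :: real and s :: ereal
  assumes pq: "1 \<le> p" "p \<le> q" and rp: "0 < r" "r < p"
    and a: "1 + \<alpha> - 1 / r - 1 / t < 0" and eta: "0 < \<eta>" "\<eta> < 1"
    and t: "conj_exp s = ereal t" "1 \<le> t" "1 - 1 / q < 1 / t"
  shows "\<exists>C>0. \<forall>(\<omega> :: real ^ 'n \<Rightarrow> ennreal) \<sigma> u v D S.
    weight \<omega> \<and> weight \<sigma> \<and> u = (\<lambda>x. epow (\<omega> x) (r / (r - p))) \<and> weight u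
    \<and> v = (\<lambda>x. epow (\<sigma> x) (real_of_ereal (ereal t / (ereal t - conj_exp (ereal q))))) \<and> weight v
    \<and> dyadic_lattice D \<and> S \<subseteq> D \<and> sparse_family \<eta> S
    \<and> 1 \<le> A_infty_const u \<and> 1 \<le> A_infty_const v
    \<and> 0 < A_const (1 + \<alpha> - 1 / r - 1 / t) (1 / r - 1 / p) (1 / t - (1 - 1 / q)) u v
    \<and> A_const (1 + \<alpha> - 1 / r - 1 / t) (1 / r - 1 / p) (1 / t - (1 - 1 / q)) u v < \<infinity>
    \<and> A_infty_factor p q \<alpha> u v < \<infinity> \<and> best_const r s \<alpha> p q \<omega> \<sigma> S < \<infinity>
    \<longrightarrow> best_const r s \<alpha> p q \<omega> \<sigma> S \<le> ennreal C *
      A_const (1 + \<alpha> - 1 / r - 1 / t) (1 / r - 1 / p) (1 / t - (1 - 1 / q)) u v * A_infty_factor p q \<alpha> u v"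
    (is "\<exists>C>0. \<forall>\<omega> \<sigma> u v D S. ?hyp \<omega> \<sigma> u v D S \<longrightarrow> ?concl C \<omega> \<sigma> u v D S")
proof (cases "q = 1")
  case True
  then have p1: "p = 1" using pq by simp
  have ci: "conj_exp (ereal q) = \<infinity>" unfolding True by (simp add: conj_exp_one one_ereal_def[symmetric])
  let ?C = "1 / \<eta> * doob_const (1 / r)"
  let ?A = "\<lambda>u :: real ^ 'n \<Rightarrow> ennreal. A_const (1 + \<alpha> - 1 / r - 1 / t) (1 / r - 1) (1 / t) u (\<lambda>x. 1)"
  have "0 < ?C" using eta rp p1 by (auto intro!: divide_pos_pos doob_const_pos)
  show ?thesis
  proof (intro exI[of _ ?C] conjI allI impI, fact)
    fix \<omega> \<sigma> u v :: "real ^ 'n \<Rightarrow> ennreal" and D S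
    assume H: "?hyp \<omega> \<sigma> u v D S"
    have v: "v = (\<lambda>x. 1)" using H unfolding ci by (simp add: dual_exponent_infinity)
    have om: "weight \<omega>" "weight \<sigma>" "u = (\<lambda>x. epow (\<omega> x) (r / (r - 1)))" "weight u"
      and D: "dyadic_lattice D" "S \<subseteq> D" "sparse_family \<eta> S" using H p1 by auto
    have Ac: "A_const (1 + \<alpha> - 1 / r - 1 / t) (1 / r - 1 / p) (1 / t - (1 - 1 / q)) u v = ?A u"
      unfolding v True p1 by simp
    obtain A where A: "?A u = ennreal A" "0 < A" using H unfolding Ac by (cases "?A u") auto
    have iu: "A_infty_const u < \<infinity>" using H A_infty_factor_finite(1)[OF pq] by blast
    have Dc: "D \<subseteq> cubes" using D by (simp add: dyadic_lattice_def)
    have pos: "AE x in lebesgue. x \<in> Q \<longrightarrow> 0 < \<sigma> x" if "Q \<in> S" for Q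
      using weight_pos_of_best_const_finite[OF rp t(1,2) om(1,2), of Q S \<alpha>] that D Dc H True by auto
    show "?concl ?C \<omega> \<sigma> u v D S"
    proof (rule best_const_le[OF t(1)], unfold ci Ac)
      fix f g assume fg: "f \<in> Lp (ereal p) \<omega>" "g \<in> Lp \<infinity> \<sigma>"
      have "sparse_form r t \<alpha> S f g \<le> ennreal ?C * ennreal A
        * A_infty_const u * Lp_norm (ereal 1) \<omega> f * Lp_norm \<infinity> \<sigma> g"
        using rp t(2) fg p1
        by (intro upper_bound_Linfty[OF rp(1) _ _ eta(1) om D pos iu A]) auto
      also have "\<dots> \<le> ennreal ?C * ennreal A * A_infty_factor p q \<alpha> u v * Lp_norm (ereal p) \<omega> f * Lp_norm \<infinity> \<sigma> g"
        unfolding True p1 using H by (intro mult_right_mono mult_left_mono A_infty_factor_one) auto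
      finally show "sparse_form r t \<alpha> S f g \<le> ennreal ?C * ?A u * A_infty_factor p q \<alpha> u v
          * Lp_norm (ereal p) \<omega> f * Lp_norm \<infinity> \<sigma> g" unfolding A(1) .
    qed
  qed
next
  case False
  then have q1: "1 < q" using pq by simp
  have t0: "0 < t" using t(2) by simp
  define d where "d = q / (q - 1)"
  have cd: "conj_exp (ereal q) = ereal d" unfolding d_def by (rule conj_exp_real[OF q1])
  have d: "1 / d = 1 - 1 / q" "1 \<le> d" using q1 by (auto simp: d_def field_simps)
  have td: "t < d"
  proof -
    have "1 / d < 1 / t" using d t(3) by simp
    then show ?thesis using t0 d(2) by (simp add: field_simps)
  qed
  have ve: "real_of_ereal (ereal t / (ereal t - conj_exp (ereal q))) = t / (t - d)"
    unfolding cd by (rule dual_exponent[OF t0 td])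
  have q_d: "1 / q = 1 - 1 / d" using d by simp
  have "1 / q \<le> 1 / p" using pq by (intro divide_left_mono) auto
  then have pd: "1 \<le> 1 / p + 1 / d" using d(1) by simp
  let ?a = "1 + \<alpha> - 1 / r - 1 / t" and ?\<beta> = "1 / r - 1 / p" and ?\<gamma> = "1 / t - 1 / d"
  let ?c = "(1 + doob_const (p / r)) * (1 + doob_const (d / t))"
  have c: "0 < ?c" using rp td t0 by (intro mult_pos_pos add_pos_pos doob_const_pos) auto
  have pair: "\<exists>A. dual_pair \<omega> \<sigma> u v p d r t \<alpha> \<eta> A D S" if "?hyp \<omega> \<sigma> u v D S"
    for \<omega> \<sigma> u v :: "real ^ 'n \<Rightarrow> ennreal" and D S
  proof -
    have "0 < A_const ?a ?\<beta> ?\<gamma> u v" "A_const ?a ?\<beta> ?\<gamma> u v < \<infinity>"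
      using that unfolding d(1)[symmetric] by auto
    then obtain A where "A_const ?a ?\<beta> ?\<gamma> u v = ennreal A" "0 < A"
      by (cases "A_const ?a ?\<beta> ?\<gamma> u v") auto
    then have "dual_pair \<omega> \<sigma> u v p d r t \<alpha> \<eta> A D S"
      using that unfolding ve d(1)[symmetric] by unfold_locales (use pq d pd rp td t0 eta in auto)
    then show ?thesis ..
  qed
  show ?thesis
  proof (cases "p = q \<and> 0 < \<alpha>")
    case True
    then have p1: "1 < p" and pd': "1 / d = 1 - 1 / p" using q1 d by auto
    let ?C = "3 * (1 / \<eta>)\<^sup>2 * ?c"
    have "0 < ?C" using eta by (intro mult_pos_pos[OF _ c]) auto
    show ?thesis
    proof (intro exI[of _ ?C] conjI allI impI, fact)
      fix \<omega> \<sigma> u v :: "real ^ 'n \<Rightarrow> ennreal" and D S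
      assume H: "?hyp \<omega> \<sigma> u v D S"
      then obtain A where "dual_pair \<omega> \<sigma> u v p d r t \<alpha> \<eta> A D S" using pair by blast
      then interpret X: dual_pair \<omega> \<sigma> u v p d r t \<alpha> \<eta> A D S .
      note fin = A_infty_factor_finite[OF pq X.ge1, of \<alpha>]
      have fin': "A_infty_const u < \<infinity>" "A_infty_const v < \<infinity>" using fin H p1 by auto
      show "?concl ?C \<omega> \<sigma> u v D S"
      proof (rule best_const_le[OF t(1)], unfold cd d(1)[symmetric] X.A(1))
        fix f g assume fg: "f \<in> Lp (ereal p) \<omega>" "g \<in> Lp (ereal d) \<sigma>"
        have "sparse_form r t \<alpha> S f g \<le> ennreal ?C * ennreal A
          * (epow (A_infty_const u) (1 / p) * epow (A_infty_const v) (1 / d))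
          * Lp_norm (ereal p) \<omega> f * Lp_norm (ereal d) \<sigma> g"
          by (rule X.upper_bound_product[OF fin' fg])
        also have "\<dots> \<le> ennreal ?C * ennreal A * A_infty_factor p q \<alpha> u v
          * Lp_norm (ereal p) \<omega> f * Lp_norm (ereal d) \<sigma> g"
          unfolding pd' using epow_product_le_factor[OF p1 _ X.ge1(1) fin'(1) X.ge1(2) fin'(2), of \<alpha>] True
          by (intro mult_right_mono mult_left_mono) auto
        finally show "sparse_form r t \<alpha> S f g \<le> ennreal ?C * ennreal A * A_infty_factor p q \<alpha> u v
          * Lp_norm (ereal p) \<omega> f * Lp_norm (ereal d) \<sigma> g" .
      qed
    qed
  next
    case other: False
    \<comment> \<open>Here a + \<beta> + \<gamma> = 1 + \<alpha> - 1/p - 1/d, which reduces to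
      \<alpha> when p = q.\<close>
    have cond: "1 < 1 / p + 1 / d \<or> (1 \<le> 1 / p + 1 / d \<and> ?a + ?\<beta> + ?\<gamma> \<le> 0)"
    proof (cases "p = q")
      case True
      then show ?thesis using other d(1) by auto
    next
      case False
      then have "1 / q < 1 / p" using pq by (intro divide_strict_left_mono) auto
      then show ?thesis using d(1) by simp
    qed
    have bg: "0 \<le> ?\<beta>" "0 \<le> ?\<gamma>" using rp td t0 by (auto simp: frac_le)
    obtain \<epsilon> where e: "0 < \<epsilon>" "\<epsilon> * ?\<beta> \<le> 1 / p" "\<epsilon> * ?\<gamma> \<le> 1 / d"
      "1 \<le> - (\<epsilon> * ?a) + (1 / p - \<epsilon> * ?\<beta>) + (1 / d - \<epsilon> * ?\<gamma>)"
      by (rule ex_small_exponent[OF bg pq(1) d(2) cond])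
    let ?C = "(1 + 6 * piece_const \<epsilon> ?a ?\<beta> ?\<gamma> p d (1 / \<eta>)) * (1 / \<eta>) * ?c"
    have "0 < 1 + 6 * piece_const \<epsilon> ?a ?\<beta> ?\<gamma> p d (1 / \<eta>)"
      using piece_const_nonneg[of \<epsilon> ?a ?\<beta> ?\<gamma> p d "1 / \<eta>"] by linarith
    then have "0 < ?C" using eta by (intro mult_pos_pos[OF _ c] mult_pos_pos) auto
    show ?thesis
    proof (intro exI[of _ ?C] conjI allI impI, fact)
      fix \<omega> \<sigma> u v :: "real ^ 'n \<Rightarrow> ennreal" and D S
      assume H: "?hyp \<omega> \<sigma> u v D S"
      then obtain A where "dual_pair \<omega> \<sigma> u v p d r t \<alpha> \<eta> A D S" using pair by blast
      then interpret X: dual_pair \<omega> \<sigma> u v p d r t \<alpha> \<eta> A D S .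
      have fin: "A_infty_const u < \<infinity>" "0 < 1 - 1 / p \<Longrightarrow> A_infty_const v < \<infinity>"
        using A_infty_factor_finite[OF pq X.ge1, of \<alpha>] H pq(1) by auto
      show "?concl ?C \<omega> \<sigma> u v D S"
      proof (rule best_const_le[OF t(1)], unfold cd d(1)[symmetric] A_infty_factor_otherwise[OF pq(1) other],
          unfold q_d X.A(1))
        fix f g assume fg: "f \<in> Lp (ereal p) \<omega>" "g \<in> Lp (ereal d) \<sigma>"
        show "sparse_form r t \<alpha> S f g \<le> ennreal ?C * ennreal A
          * (epow (A_infty_const u) (1 - 1 / d) + epow (A_infty_const v) (1 - 1 / p))
          * Lp_norm (ereal p) \<omega> f * Lp_norm (ereal d) \<sigma> g"
          by (rule X.upper_bound_sum[OF a e fin fg])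
      qed
    qed
  qed
qed

lemma epow_pos_of_finite: "0 < x \<Longrightarrow> x < \<infinity> \<Longrightarrow> 0 < epow x a"
  by (cases x) (auto simp: epow_ennreal)

text \<open>In [0, \<infinity>] a finite product forces finite factors only if no factor vanishes,
  hence the positivity of both masses.\<close>

lemma mass_finite_of_product_finite:
  assumes "Q \<in> cubes" "0 < mass u Q" "0 < mass v Q" "0 < \<beta>" "0 < \<gamma>"
    and fin: "epow (emeasure lebesgue Q) a * epow (mass u Q) \<beta> * epow (mass v Q) \<gamma> < \<infinity>"
  shows "mass u Q < \<infinity>" "mass v Q < \<infinity>"
proof -
  have pos: "0 < epow (emeasure lebesgue Q) a" "0 < epow (mass u Q) \<beta>" "0 < epow (mass v Q) \<gamma>"
    using assms(4,5) by (auto intro: epow_pos_of_finite cubes_emeasure assms(1) epow_pos[OF assms(2)] epow_pos[OF assms(3)])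
  then have "epow (mass u Q) \<beta> < \<infinity>" "epow (mass v Q) \<gamma> < \<infinity>"
    using fin by (auto simp: ennreal_mult_less_top)
  then show "mass u Q < \<infinity>" "mass v Q < \<infinity>"
    using epow_top(1)[of \<beta>] epow_top(1)[of \<gamma>] assms(4,5)
    by (metis infinity_ennreal_def less_top order_less_irrefl)+
qed

theorem theorem3p2:
  fixes p q r \<alpha> \<eta> :: real and s :: ereal
  assumes "1 \<le> p" and "p \<le> q" and "ereal q < s"
    and "0 < r" and "r < p"
    and "1 / p - 1 / q \<le> \<alpha>" and "\<alpha> < 1 / r - real_of_ereal (1 / s)"
    and "0 < \<eta>" and "\<eta> < 1"
  shows "\<exists>C > (0 :: real). \<forall>(\<omega> :: real ^ 'n \<Rightarrow> ennreal) (\<sigma> :: real ^ 'n \<Rightarrow> ennreal).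
    weight \<omega> \<and> weight \<sigma> \<longrightarrow>
    (let s' = conj_exp s; q' = conj_exp (ereal q);
         u = (\<lambda>x. epow (\<omega> x) (r / (r - p)));
         v = (\<lambda>x. epow (\<sigma> x) (real_of_ereal (s' / (s' - q'))));
         a = \<alpha> - 1 / r + real_of_ereal (1 / s);
         \<beta> = 1 / r - 1 / p;
         \<gamma> = 1 / q - real_of_ereal (1 / s);
         N = best_const r s \<alpha> p q \<omega> \<sigma>;
         Nsup = uniform_best_const \<eta> r s \<alpha> p q \<omega> \<sigma>;
         bound = ennreal C * A_const a \<beta> \<gamma> u v * A_infty_factor p q \<alpha> u v
     in (Nsup < \<infinity> \<longrightarrow>
           (u, v) \<in> A_class a \<beta> \<gamma> \<and> A_const a \<beta> \<gamma> u v \<le> Nsup \<and> Nsup \<le> bound) \<and>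
        (\<forall>D S. dyadic_lattice D \<and> S \<subseteq> D \<and> sparse_family \<eta> S \<longrightarrow> N S < \<infinity> \<longrightarrow> N S \<le> bound))"
proof -
  obtain t where t: "conj_exp s = ereal t" "1 \<le> t" "1 / t = 1 - real_of_ereal (1 / s)"
    "real_of_ereal (1 / s) < 1 / q"
    using conj_exp_greater[of q s] assms by auto
  have tq: "1 - 1 / q < 1 / t" using t by simp
  have a_eq: "1 + \<alpha> - 1 / r - 1 / t = \<alpha> - 1 / r + real_of_ereal (1 / s)"
    and g_eq: "1 / t - (1 - 1 / q) = 1 / q - real_of_ereal (1 / s)" using t(3) by auto
  have a_neg: "1 + \<alpha> - 1 / r - 1 / t < 0" unfolding a_eq using assms by simp
  have q: "1 \<le> q" using assms by simp
  have \<beta>\<gamma>: "0 < 1 / r - 1 / p" "0 < 1 / q - real_of_ereal (1 / s)"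
    using assms t(4) by (auto simp: frac_less2)
  obtain C where C: "C > 0" and ub: "\<forall>(\<omega> :: real ^ 'n \<Rightarrow> ennreal) \<sigma> u v D S.
    weight \<omega> \<and> weight \<sigma> \<and> u = (\<lambda>x. epow (\<omega> x) (r / (r - p))) \<and> weight u
    \<and> v = (\<lambda>x. epow (\<sigma> x) (real_of_ereal (ereal t / (ereal t - conj_exp (ereal q))))) \<and> weight v
    \<and> dyadic_lattice D \<and> S \<subseteq> D \<and> sparse_family \<eta> S
    \<and> 1 \<le> A_infty_const u \<and> 1 \<le> A_infty_const v
    \<and> 0 < A_const (1 + \<alpha> - 1 / r - 1 / t) (1 / r - 1 / p) (1 / t - (1 - 1 / q)) u v
    \<and> A_const (1 + \<alpha> - 1 / r - 1 / t) (1 / r - 1 / p) (1 / t - (1 - 1 / q)) u v < \<infinity>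
    \<and> A_infty_factor p q \<alpha> u v < \<infinity> \<and> best_const r s \<alpha> p q \<omega> \<sigma> S < \<infinity>
    \<longrightarrow> best_const r s \<alpha> p q \<omega> \<sigma> S \<le> ennreal C *
      A_const (1 + \<alpha> - 1 / r - 1 / t) (1 / r - 1 / p) (1 / t - (1 - 1 / q)) u v * A_infty_factor p q \<alpha> u v"
    using best_const_upper_bound[OF assms(1,2,4,5) a_neg assms(8,9) t(1,2) tq, where 'n = 'n]
    by (elim exE conjE) (rule that)
  show ?thesis
  proof (intro exI[of _ C] conjI allI impI C, elim conjE)
    fix \<omega> \<sigma> :: "real ^ 'n \<Rightarrow> ennreal"
    assume om: "weight \<omega>" and si: "weight \<sigma>"
    define u where "u = (\<lambda>x. epow (\<omega> x) (r / (r - p)))"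
    define v where "v = (\<lambda>x. epow (\<sigma> x) (real_of_ereal (ereal t / (ereal t - conj_exp (ereal q)))))"
    define a where "a = \<alpha> - 1 / r + real_of_ereal (1 / s)"
    define \<beta> where "\<beta> = 1 / r - 1 / p"
    define \<gamma> where "\<gamma> = 1 / q - real_of_ereal (1 / s)"
    define bound where "bound = ennreal C * A_const a \<beta> \<gamma> u v * A_infty_factor p q \<alpha> u v"
    let ?val = "\<lambda>Q. epow (emeasure lebesgue Q) a * epow (mass u Q) \<beta> * epow (mass v Q) \<gamma>"
    let ?N = "best_const r s \<alpha> p q \<omega> \<sigma>"
    have bg: "0 < \<beta>" "0 < \<gamma>" using \<beta>\<gamma> by (auto simp: \<beta>_def \<gamma>_def)
    have [measurable]: "\<omega> \<in> borel_measurable lebesgue" "\<sigma> \<in> borel_measurable lebesgue"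
      using om si by (auto simp: weight_def)
    have um: "u \<in> borel_measurable lebesgue" and vm: "v \<in> borel_measurable lebesgue"
      unfolding u_def v_def by measurable
    \<comment> \<open>This sign makes v positive almost everywhere. For q > 1 it rests on t < q',
      the hypothesis q < s in terms of conjugate exponents.\<close>
    have \<kappa>: "real_of_ereal (ereal t / (ereal t - conj_exp (ereal q))) \<le> 0"
    proof (cases "q = 1")
      case True
      then show ?thesis by (simp add: conj_exp_one one_ereal_def[symmetric])
    next
      case False
      then have q1: "1 < q" using q by simp
      have "(q - 1) / q < 1 / t" using tq q1 by (simp add: diff_divide_distrib)
      then have "t < q / (q - 1)" using t(2) q1 by (simp add: field_simps)
      then show ?thesis
        unfolding conj_exp_real[OF q1] using t(2) by (subst dual_exponent) (auto simp: divide_le_0_iff)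
    qed
    have mu: "0 < mass u Q" if "Q \<in> cubes" for Q
      using assms(4,5) unfolding u_def
      by (intro mass_pos[OF um[unfolded u_def] _ that] dual_weight_AE_pos om) (simp add: divide_le_0_iff)
    have mv: "0 < mass v Q" if "Q \<in> cubes" for Q
      unfolding v_def by (intro mass_pos[OF vm[unfolded v_def] _ that] dual_weight_AE_pos si \<kappa>)
    have low: "?val Q \<le> ?N S" if "Q \<in> cubes" "Q \<in> S" for Q S
      using test_value_le_best_const[OF q assms(4,5) t(1,2) tq om si that, of \<alpha>]
      unfolding a_eq g_eq u_def v_def a_def \<beta>_def \<gamma>_def .
    have val_le: "?val Q \<le> A_const a \<beta> \<gamma> u v" if "Q \<in> cubes" for Q
      unfolding A_const_def using that by (rule SUP_upper)
    \<comment> \<open>Local integrability of u and v is a conclusion: a finite A-constant bounds the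
      product of the two masses on every cube, and positivity separates them.\<close>
    have weights: "weight u" "weight v" if "A_const a \<beta> \<gamma> u v < \<infinity>"
      using mass_finite_of_product_finite[OF _ mu mv bg le_less_trans[OF val_le that]]
      by (auto intro: weightI_cubes um vm)
    have upper: "?N S \<le> bound" if D: "dyadic_lattice D" and S: "S \<subseteq> D" and sp: "sparse_family \<eta> S"
      and fin: "?N S < \<infinity>" for D S
    proof (cases "S = {}")
      case True
      \<comment> \<open>No cube is tested by the empty family, so no mass is known to be finite; but
        its best constant is 0.\<close>
      have "?N S \<le> 0" unfolding True by (rule best_const_le[OF t(1)]) (simp add: sparse_form_def)
      then show ?thesis by simp
    next
      case False
      then obtain Q where Q: "Q \<in> S" by blast
      have "D \<subseteq> cubes" using D by (simp add: dyadic_lattice_def)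
      then have Qc: "Q \<in> cubes" using Q S by auto
      \<comment> \<open>Finite masses on a single cube suffice for both A-infinity constants to be
        at least 1.\<close>
      note mfin = mass_finite_of_product_finite[OF Qc mu[OF Qc] mv[OF Qc] bg le_less_trans[OF low[OF Qc Q] fin]]
      have ge: "1 \<le> A_infty_const u" "1 \<le> A_infty_const v"
        using A_infty_const_ge_1[OF Qc mu[OF Qc] mfin(1)] A_infty_const_ge_1[OF Qc mv[OF Qc] mfin(2)] by auto
      have f0: "A_infty_factor p q \<alpha> u v \<noteq> 0" by (rule A_infty_factor_nonzero[OF assms(1,2) ge])
      have "0 < ?val Q"
        using bg epow_pos_of_finite[OF cubes_emeasure[OF Qc], of a] epow_pos[OF mu[OF Qc], of \<beta>]
          epow_pos[OF mv[OF Qc], of \<gamma>]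
        by (simp add: ennreal_zero_less_mult_iff)
      then have A0: "0 < A_const a \<beta> \<gamma> u v" using val_le[OF Qc] by order
      show ?thesis
      proof (cases "A_const a \<beta> \<gamma> u v < \<infinity> \<and> A_infty_factor p q \<alpha> u v < \<infinity>")
        case True
        then have Ac: "A_const a \<beta> \<gamma> u v < \<infinity>" and fac: "A_infty_factor p q \<alpha> u v < \<infinity>" by auto
        show ?thesis
          unfolding bound_def
          by (rule ub[rule_format, unfolded a_eq g_eq, folded a_def \<beta>_def \<gamma>_def], intro conjI)
            (fact om si u_def v_def weights(1)[OF Ac] weights(2)[OF Ac] D S sp ge A0 Ac fac fin)+
      next
        \<comment> \<open>One of the two constants is infinite and no factor is 0, so the bound is
          \<infinity>.\<close>
        case False
        then have "bound = \<infinity>"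
          unfolding bound_def using C A0 f0 by (auto simp: ennreal_mult_eq_top_iff less_top[symmetric])
        then show ?thesis by simp
      qed
    qed
    have part1: "(u, v) \<in> A_class a \<beta> \<gamma> \<and> A_const a \<beta> \<gamma> u v \<le> uniform_best_const \<eta> r s \<alpha> p q \<omega> \<sigma>
        \<and> uniform_best_const \<eta> r s \<alpha> p q \<omega> \<sigma> \<le> bound"
      if fin: "uniform_best_const \<eta> r s \<alpha> p q \<omega> \<sigma> < \<infinity>"
    proof -
      have le_sup: "?N S \<le> uniform_best_const \<eta> r s \<alpha> p q \<omega> \<sigma>" if "S \<in> sparse_families \<eta>" for S
        unfolding uniform_best_const_def using that by (rule SUP_upper)
      have A_le: "A_const a \<beta> \<gamma> u v \<le> uniform_best_const \<eta> r s \<alpha> p q \<omega> \<sigma>"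
        unfolding A_const_def
      proof (rule SUP_least)
        fix Q :: "(real ^ 'n) set" assume Q: "Q \<in> cubes"
        have "?val Q \<le> ?N {Q}" by (rule low[OF Q]) simp
        also have "\<dots> \<le> uniform_best_const \<eta> r s \<alpha> p q \<omega> \<sigma>"
          by (rule le_sup[OF singleton_sparse_families[OF Q assms(8,9)]])
        finally show "?val Q \<le> uniform_best_const \<eta> r s \<alpha> p q \<omega> \<sigma>" .
      qed
      have A_fin: "A_const a \<beta> \<gamma> u v < \<infinity>" using A_le fin by (rule le_less_trans)
      have "uniform_best_const \<eta> r s \<alpha> p q \<omega> \<sigma> \<le> bound"
        unfolding uniform_best_const_def
      proof (rule SUP_least)
        fix S :: "(real ^ 'n) set set" assume S: "S \<in> sparse_families \<eta>"
        then obtain D where "sparse_family \<eta> S" "dyadic_lattice D" "S \<subseteq> D" by (auto simp: sparse_families_def)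
        then show "?N S \<le> bound" using upper le_less_trans[OF le_sup[OF S] fin] by blast
      qed
      then show ?thesis using weights[OF A_fin] A_le A_fin by (simp add: A_class_def)
    qed
    have part2: "\<forall>D S. dyadic_lattice D \<and> S \<subseteq> D \<and> sparse_family \<eta> S \<longrightarrow> ?N S < \<infinity> \<longrightarrow> ?N S \<le> bound"
      using upper by blast
    show "let s' = conj_exp s; q' = conj_exp (ereal q);
         u = (\<lambda>x. epow (\<omega> x) (r / (r - p)));
         v = (\<lambda>x. epow (\<sigma> x) (real_of_ereal (s' / (s' - q'))));
         a = \<alpha> - 1 / r + real_of_ereal (1 / s);
         \<beta> = 1 / r - 1 / p;
         \<gamma> = 1 / q - real_of_ereal (1 / s);
         N = best_const r s \<alpha> p q \<omega> \<sigma>;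
         Nsup = uniform_best_const \<eta> r s \<alpha> p q \<omega> \<sigma>;
         bound = ennreal C * A_const a \<beta> \<gamma> u v * A_infty_factor p q \<alpha> u v
     in (Nsup < \<infinity> \<longrightarrow>
           (u, v) \<in> A_class a \<beta> \<gamma> \<and> A_const a \<beta> \<gamma> u v \<le> Nsup \<and> Nsup \<le> bound) \<and>
        (\<forall>D S. dyadic_lattice D \<and> S \<subseteq> D \<and> sparse_family \<eta> S \<longrightarrow> N S < \<infinity> \<longrightarrow> N S \<le> bound)"
      unfolding Let_def t(1) u_def[symmetric] v_def[symmetric] a_def[symmetric] \<beta>_def[symmetric]
        \<gamma>_def[symmetric] bound_def[symmetric]
      using part1 part2 by blast
  qed
qed

end
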